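(* Let $\alpha$ be a set with an involution $\tau$, let $\pi=\pi(\alpha,\tau)$, and let $\varphi:\pi\to\mathbb Z$ be an additive homomorphism such that $\varphi(a)\in\{+1,-1\}$ for all $a\in\alpha$. For any nanowords $w,v$ over $\alpha$, $$\rho_{wbr}(w,v)\ \ge\ \tfrac12\big(\sigma_\varphi(p_w\oplus p_v^-)-1\big),$$ where $p_w=p(w)$, $p_v=p(v)$ are the $\alpha$-pairings of $w,v$, $\sigma_\varphi$ is the $\varphi$-genus and $\rho_{wbr}$ is the weak bridge pseudo-metric.
   Context: **Nanowords.** $\alpha$ is a set with an involution $\tau:\alpha\to\alpha$ ($\tau^2=\mathrm{id}$). An $\alpha$-alphabet is a set $\mathcal A$ with a map $\mathcal A\to\alpha$, $A\mapsto|A|$. A nanoword of length $n$ over $\alpha$ is a pair $(\mathcal A,w)$ with $\mathcal A$ an $\alpha$-alphabet and $w:\{1,\dots,n\}\to\mathcal A$ a map (written $w(1)\cdots w(n)$) taking every value in $\mathcal A$ exactly twice; $\emptyset$ is the empty nanoword. Nanowords $(\mathcal A,w),(\mathcal A',w')$ are isomorphic if $w'=fw$ for a bijection $f:\mathcal A\to\mathcal A'$ with $|f(A)|=|A|$. The opposite word is $w^-=w(n)\cdots w(1)$. **Homotopy moves.** (1) $(\mathcal A,xAAy)\mapsto(\mathcal A-\{A\},xy)$; (2) $(\mathcal A,xAByBAz)\mapsto(\mathcal A-\{A,B\},xyz)$ if $|B|=\tau(|A|)$; (3) $(\mathcal A,xAByACzBCt)\mapsto(\mathcal A,xBAyCAzCBt)$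 for distinct $A,B,C$ with $|A|=|B|=|C|$. **Circular shift.** The shift of a nanoword $(\mathcal A,w)$ with $w=AxAy$ is $(\hat{\mathcal A},\hat w)$ with $\hat{\mathcal A}=(\mathcal A-\{A\})\cup\{\bar A\}$, $\bar A$ a new letter with $|\bar A|=\tau(|A|)$, and $\hat w=x\bar Ay\bar A$. **Bridge moves.** A factor of $(\mathcal A,w)$ is a sequence of words $\nabla=(\mathcal B,(v_1|\cdots|v_k))$ in a subset $\mathcal B\subset\mathcal A$, each letter of $\mathcal B$ occurring exactly twice in $v_1\cdots v_k$, such that $w=x_1v_1x_2v_2\cdots x_kv_kx_{k+1}$ with $x_i$ words in $\mathcal A-\mathcal B$. A quasi-bridge in $w$ is a pair $(\nabla,\kappa)$ with $\nabla=(\mathcal B,(v_1|\cdots|v_k))$ a factor of $(\mathcal A,w)$, $k\ge1$, and $\kappa$ an involutive permutation of $\{1,\dots,k\}$ such that (a) $v_r$ has even length whenever $\kappa(r)=r$; (b) there is a map $\iota:\mathcal B\to\mathcal B$ with $\iota v_r=v_{\kappa(r)}^-$ for all $r$. The occurrence of $B\in\mathcal B$ in position $j$ of $v_r$ is symmetric to the occurrence of $\iota(B)$ in position $n_r+1-j$ of $v_{\kappa(r)}$, where $n_r$ is the length of $v_r$. Put $\varepsilon(B)=1$ if the occurrence symmetric to the leftmost occurrence of $B$ in $w$ is the leftmost occurrence of $\iota(B)$ in $w$, and $\varepsilon(B)=0$ otherwise. A quasi-bridge is a bridge if $|\iota(B)|=\tau^{\varepsilon(B)}(|B|)$ for all $B\in\mathcal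 B$. The corresponding bridge move $m$ transforms $(\mathcal A,w)$ into $(\mathcal A-\mathcal B,x_1x_2\cdots x_{k+1})$; its number of arches $g(m)=g(m^{-1})$ is the number of 2-element orbits of $\kappa$. (A bridge move is always considered together with the bridge defining it.) **Weak bridge pseudo-metric.** A circular metamorphosis $m:w\to v$ is a finite sequence $m=(m_1,\dots,m_n)$ of isomorphisms, homotopy moves, bridge moves, circular shifts, and inverses of such moves, transforming $w$ into $v$; $g(m)=\sum_ig(m_i)$ where $g(m_i)$ is the number of arches if $m_i$ is a bridge move or the inverse of one, and $g(m_i)=0$ otherwise. Set $\rho_{wbr}(w,v)=\min_mg(m)$ over all circular metamorphoses $m:w\to v$. **$\alpha$-pairings.** $\pi=\pi(\alpha,\tau)$ is the additive abelian group with generators $a\in\alpha$ and relations $a+\tau(a)=0$. An $\alpha$-pairing is a triple $p=(S,s,e)$: a set $S$ (here finite), $s\in S$, a map $S^\circ=S-\{s\}\to\alpha$, $A\mapsto|A|$, and a map $e:S\times S\to\pi$, extended to a bilinear form $\tilde e:\mathbb ZS\times\mathbb ZS\to\pi$. The opposite is $p^-=(S,s,-e)$. The sum $p_1\oplus p_2$ of $p_i=(S_i,s_i,e_i)$ is $(S_1^\circ\sqcup S_2^\circ\sqcup\{s\},s,e)$ with inherited projections, $e=e_i$ on $S_i^\circ\times S_i^\circ$, $e(S_1^\circ,S_2^\circ)=e(S_2^\circ,S_1^\circ)=0$, $e(A,s)=e_i(A,s_i)$, $e(s,A)=e_i(s_i,A)$ for $A\in S_i^\circ$, $e(s,s)=e_1(s_1,s_1)+e_2(s_2,s_2)$.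 A vector $x\in\mathbb ZS$ is short if $x=A\in S^\circ$, or $x=A+B$ with $A\ne B\in S^\circ$, $|A|=|B|$, or $x=A-B$ with $A\ne B\in S^\circ$, $|A|=\tau(|B|)$. A filling of $p$ is a finite family $\{\lambda_i\}$ in $\mathbb ZS$ such that one $\lambda_i$ equals $s$, all others are short, and every element of $S^\circ$ occurs with non-zero coefficient in exactly one $\lambda_i$. The $\varphi$-genus is $\sigma_\varphi(p)=\min_\lambda\frac12\operatorname{rk}\big(\varphi\tilde e(\lambda_i,\lambda_j)\big)_{i,j}$, the minimum over all fillings $\lambda$ of $p$ (rank over $\mathbb Q$). **The $\alpha$-pairing of a nanoword $(\mathcal A,w)$.** $p_w=p(w)=(\mathcal A\cup\{s\},s,e_w)$ with the given projection $\mathcal A\to\alpha$. For $A,B\in\mathcal A$ let $n_w(A,B)=1$ if $w=\cdots A\cdots B\cdots A\cdots B\cdots$, $-1$ if $w=\cdots B\cdots A\cdots B\cdots A\cdots$, $0$ otherwise. Let $i_A<j_A$ be the elements of $w^{-1}(A)$, and $A\circ_wB=\sum|D|\in\pi$ over $D\in\mathcal A$ with $i_A<i_D<j_A$ and $i_B<j_D<j_B$. Then $e_w(A,B)=2(A\circ_wB-B\circ_wA)+n_w(A,B)(|A|+|B|)$, $e_w(A,s)=-e_w(s,A)=\sum_{D\in\mathcal A}n_w(A,D)|D|$, $e_w(s,s)=0$. *)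

theory Defs
  imports
    "HOL-Algebra.Free_Abelian_Groups"
    "HOL-Combinatorics.Permutations"
    "HOL-Library.Infinite_Typeclass"
    "Jordan_Normal_Form.DL_Rank"
begin

definition involution_on :: "'a set \<Rightarrow> ('a \<Rightarrow> 'a) \<Rightarrow> bool" where
  "involution_on \<alpha> \<tau> \<longleftrightarrow> \<tau> \<in> \<alpha> \<rightarrow> \<alpha> \<and> (\<forall>a\<in>\<alpha>. \<tau> (\<tau> a) = a)"


section \<open>Nanowords\<close>

text \<open>
  The word \<open>w(1) \<dots> w(n)\<close> is a list; positions are counted from 0.  The projection
  \<open>A \<mapsto> |A|\<close> is extensional on the alphabet, so that two nanowords are equal as records
  exactly when they have the same alphabet, the same projection and the same word.
\<close>

record ('l, 'a) nanoword =
  letters :: "'l set"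
  proj :: "'l \<Rightarrow> 'a"
  word :: "'l list"

definition nanoword :: "'a set \<Rightarrow> ('l, 'a) nanoword \<Rightarrow> bool" where
  "nanoword \<alpha> w \<longleftrightarrow>
     proj w \<in> letters w \<rightarrow>\<^sub>E \<alpha> \<and>
     set (word w) \<subseteq> letters w \<and>
     (\<forall>A\<in>letters w. count_list (word w) A = 2)"

definition first_occ :: "('l, 'a) nanoword \<Rightarrow> 'l \<Rightarrow> nat" where
  "first_occ w A = Min {i. i < length (word w) \<and> word w ! i = A}"

definition last_occ :: "('l, 'a) nanoword \<Rightarrow> 'l \<Rightarrow> nat" where
  "last_occ w A = Max {i. i < length (word w) \<and> word w ! i = A}"

definition remove_letters ::
  "('l, 'a) nanoword \<Rightarrow> 'l set \<Rightarrow> 'l list \<Rightarrow> ('l, 'a) nanoword" where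
  "remove_letters w B u =
     \<lparr>letters = letters w - B, proj = restrict (proj w) (letters w - B), word = u\<rparr>"

definition isomorphism_move :: "('l, 'a) nanoword \<Rightarrow> ('l, 'a) nanoword \<Rightarrow> bool" where
  "isomorphism_move w w' \<longleftrightarrow>
     (\<exists>f. bij_betw f (letters w) (letters w') \<and>
          (\<forall>A\<in>letters w. proj w' (f A) = proj w A) \<and>
          word w' = map f (word w))"

definition homotopy_move1 :: "('l, 'a) nanoword \<Rightarrow> ('l, 'a) nanoword \<Rightarrow> bool" where
  "homotopy_move1 w w' \<longleftrightarrow>
     (\<exists>x y A. word w = x @ [A, A] @ y \<and> w' = remove_letters w {A} (x @ y))"

definition homotopy_move2 ::
  "('a \<Rightarrow> 'a) \<Rightarrow> ('l, 'a) nanoword \<Rightarrow> ('l, 'a) nanoword \<Rightarrow> bool" where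
  "homotopy_move2 \<tau> w w' \<longleftrightarrow>
     (\<exists>x y z A B. word w = x @ [A, B] @ y @ [B, A] @ z \<and>
        proj w B = \<tau> (proj w A) \<and>
        w' = remove_letters w {A, B} (x @ y @ z))"

definition homotopy_move3 :: "('l, 'a) nanoword \<Rightarrow> ('l, 'a) nanoword \<Rightarrow> bool" where
  "homotopy_move3 w w' \<longleftrightarrow>
     (\<exists>x y z t A B C. distinct [A, B, C] \<and>
        proj w A = proj w B \<and> proj w B = proj w C \<and>
        word w = x @ [A, B] @ y @ [A, C] @ z @ [B, C] @ t \<and>
        w' = w\<lparr>word := x @ [B, A] @ y @ [C, A] @ z @ [C, B] @ t\<rparr>)"

definition circular_shift ::
  "('a \<Rightarrow> 'a) \<Rightarrow> ('l, 'a) nanoword \<Rightarrow> ('l, 'a) nanoword \<Rightarrow> bool" where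
  "circular_shift \<tau> w w' \<longleftrightarrow>
     (\<exists>x y A A'. word w = [A] @ x @ [A] @ y \<and>
        A' \<notin> letters w \<and>
        w' = \<lparr>letters = insert A' (letters w - {A}),
              proj = (restrict (proj w) (letters w - {A}))(A' := \<tau> (proj w A)),
              word = x @ [A'] @ y @ [A']\<rparr>)"


section \<open>Bridge moves\<close>

text \<open>
  In the following, \<open>x\<close> and \<open>v\<close> are families of words indexed by \<open>1, \<dots>, k + 1\<close> and by
  \<open>1, \<dots>, k\<close>; their values at other indices are irrelevant.
\<close>

definition is_factor ::
  "('l, 'a) nanoword \<Rightarrow> 'l set \<Rightarrow> nat \<Rightarrow> (nat \<Rightarrow> 'l list) \<Rightarrow> (nat \<Rightarrow> 'l list) \<Rightarrow> bool" where
  "is_factor w B k x v \<longleftrightarrow>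
     B \<subseteq> letters w \<and>
     (\<forall>r\<in>{1..k}. set (v r) \<subseteq> B) \<and>
     (\<forall>b\<in>B. count_list (concat (map v [1..<Suc k])) b = 2) \<and>
     (\<forall>r\<in>{1..Suc k}. set (x r) \<subseteq> letters w - B) \<and>
     word w = concat (map (\<lambda>r. x r @ v r) [1..<Suc k]) @ x (Suc k)"

definition quasi_bridge ::
  "('l, 'a) nanoword \<Rightarrow> 'l set \<Rightarrow> nat \<Rightarrow> (nat \<Rightarrow> 'l list) \<Rightarrow> (nat \<Rightarrow> 'l list) \<Rightarrow>
   (nat \<Rightarrow> nat) \<Rightarrow> ('l \<Rightarrow> 'l) \<Rightarrow> bool" where
  "quasi_bridge w B k x v \<kappa> \<iota> \<longleftrightarrow>
     is_factor w B k x v \<and> k \<ge> 1 \<and>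
     \<kappa> permutes {1..k} \<and> (\<forall>r\<in>{1..k}. \<kappa> (\<kappa> r) = r) \<and>
     (\<forall>r\<in>{1..k}. \<kappa> r = r \<longrightarrow> even (length (v r))) \<and>
     \<iota> \<in> B \<rightarrow> B \<and> (\<forall>r\<in>{1..k}. map \<iota> (v r) = rev (v (\<kappa> r)))"

text \<open>The position in \<open>x\<^sub>1 v\<^sub>1 \<dots> x\<^sub>k v\<^sub>k x\<^sub>k\<^sub>+\<^sub>1\<close> at which the block \<open>v\<^sub>r\<close> starts.\<close>

definition block_start :: "(nat \<Rightarrow> 'l list) \<Rightarrow> (nat \<Rightarrow> 'l list) \<Rightarrow> nat \<Rightarrow> nat" where
  "block_start x v r = length (concat (map (\<lambda>i. x i @ v i) [1..<r]) @ x r)"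

text \<open>
  With positions counted from 0, the occurrence in position \<open>j\<close> of \<open>v\<^sub>r\<close> is symmetric to the
  one in position \<open>n\<^sub>r - 1 - j\<close> of \<open>v\<^bsub>\<kappa>(r)\<^esub>\<close>.
\<close>

definition bridge_eps ::
  "('l, 'a) nanoword \<Rightarrow> nat \<Rightarrow> (nat \<Rightarrow> 'l list) \<Rightarrow> (nat \<Rightarrow> 'l list) \<Rightarrow>
   (nat \<Rightarrow> nat) \<Rightarrow> ('l \<Rightarrow> 'l) \<Rightarrow> 'l \<Rightarrow> nat" where
  "bridge_eps w k x v \<kappa> \<iota> b =
     (if \<exists>r\<in>{1..k}. \<exists>j<length (v r).
           block_start x v r + j = first_occ w b \<and>
           block_start x v (\<kappa> r) + (length (v r) - 1 - j) = first_occ w (\<iota> b)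
      then 1 else 0)"

definition bridge ::
  "('a \<Rightarrow> 'a) \<Rightarrow> ('l, 'a) nanoword \<Rightarrow> 'l set \<Rightarrow> nat \<Rightarrow> (nat \<Rightarrow> 'l list) \<Rightarrow> (nat \<Rightarrow> 'l list) \<Rightarrow>
   (nat \<Rightarrow> nat) \<Rightarrow> ('l \<Rightarrow> 'l) \<Rightarrow> bool" where
  "bridge \<tau> w B k x v \<kappa> \<iota> \<longleftrightarrow>
     quasi_bridge w B k x v \<kappa> \<iota> \<and>
     (\<forall>b\<in>B. proj w (\<iota> b) = (\<tau> ^^ bridge_eps w k x v \<kappa> \<iota> b) (proj w b))"

definition arches :: "nat \<Rightarrow> (nat \<Rightarrow> nat) \<Rightarrow> nat" where
  "arches k \<kappa> = card {{r, \<kappa> r} | r. r \<in> {1..k} \<and> \<kappa> r \<noteq> r}"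

definition bridge_move ::
  "('a \<Rightarrow> 'a) \<Rightarrow> ('l, 'a) nanoword \<Rightarrow> nat \<Rightarrow> ('l, 'a) nanoword \<Rightarrow> bool" where
  "bridge_move \<tau> w g w' \<longleftrightarrow>
     (\<exists>B k x v \<kappa> \<iota>. bridge \<tau> w B k x v \<kappa> \<iota> \<and> g = arches k \<kappa> \<and>
        w' = remove_letters w B (concat (map x [1..<Suc (Suc k)])))"


section \<open>The weak bridge pseudo-metric\<close>

text \<open>\<open>elementary_move \<tau> w g w'\<close>: some move \<open>m\<close> with \<open>g(m) = g\<close> transforms \<open>w\<close> into \<open>w'\<close>.\<close>

inductive elementary_move ::
  "('a \<Rightarrow> 'a) \<Rightarrow> ('l, 'a) nanoword \<Rightarrow> nat \<Rightarrow> ('l, 'a) nanoword \<Rightarrow> bool"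
  for \<tau> where
  isomorphism: "isomorphism_move w w' \<Longrightarrow> elementary_move \<tau> w 0 w'"
| homotopy1: "homotopy_move1 w w' \<Longrightarrow> elementary_move \<tau> w 0 w'"
| homotopy2: "homotopy_move2 \<tau> w w' \<Longrightarrow> elementary_move \<tau> w 0 w'"
| homotopy3: "homotopy_move3 w w' \<Longrightarrow> elementary_move \<tau> w 0 w'"
| shift: "circular_shift \<tau> w w' \<Longrightarrow> elementary_move \<tau> w 0 w'"
| bridge: "bridge_move \<tau> w g w' \<Longrightarrow> elementary_move \<tau> w g w'"

text \<open>
  \<open>metamorphosis \<alpha> \<tau> w g v\<close>: there is a circular metamorphosis \<open>m : w \<rightarrow> v\<close> with \<open>g(m) = g\<close>.
\<close>

inductive metamorphosis ::
  "'a set \<Rightarrow> ('a \<Rightarrow> 'a) \<Rightarrow> ('l, 'a) nanoword \<Rightarrow> nat \<Rightarrow> ('l, 'a) nanoword \<Rightarrow> bool"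
  for \<alpha> \<tau> where
  empty: "nanoword \<alpha> w \<Longrightarrow> metamorphosis \<alpha> \<tau> w 0 w"
| move: "metamorphosis \<alpha> \<tau> w g u \<Longrightarrow> elementary_move \<tau> u h v \<Longrightarrow> nanoword \<alpha> v \<Longrightarrow>
    metamorphosis \<alpha> \<tau> w (g + h) v"
| inverse_move: "metamorphosis \<alpha> \<tau> w g u \<Longrightarrow> elementary_move \<tau> v h u \<Longrightarrow> nanoword \<alpha> v \<Longrightarrow>
    metamorphosis \<alpha> \<tau> w (g + h) v"

text \<open>
  By \<open>ex_metamorphosis\<close> below, the minimum is over a nonempty set.  The statement takes the type
  of letters to be infinite, so that the inverse moves and the circular shifts never run out of
  new letters.
\<close>

definition rho_wbr ::
  "'a set \<Rightarrow> ('a \<Rightarrow> 'a) \<Rightarrow> ('l, 'a) nanoword \<Rightarrow> ('l, 'a) nanoword \<Rightarrow> nat" where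
  "rho_wbr \<alpha> \<tau> w v = (LEAST g. metamorphosis \<alpha> \<tau> w g v)"


section \<open>\<open>\<alpha>\<close>-pairings\<close>

text \<open>
  The group \<open>\<pi>(\<alpha>, \<tau>)\<close> is written multiplicatively, as always in HOL-Algebra: the sums of the
  mathematical text become \<open>\<otimes>\<close> and \<open>finprod\<close>, and integer multiples become powers.
\<close>

definition pi_relators :: "'a set \<Rightarrow> ('a \<Rightarrow> 'a) \<Rightarrow> ('a \<Rightarrow>\<^sub>0 int) set" where
  "pi_relators \<alpha> \<tau> =
     generate (free_Abelian_group \<alpha>) {frag_of a + frag_of (\<tau> a) | a. a \<in> \<alpha>}"

definition pi_group :: "'a set \<Rightarrow> ('a \<Rightarrow> 'a) \<Rightarrow> ('a \<Rightarrow>\<^sub>0 int) set monoid" where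
  "pi_group \<alpha> \<tau> = free_Abelian_group \<alpha> Mod pi_relators \<alpha> \<tau>"

definition pi_gen :: "'a set \<Rightarrow> ('a \<Rightarrow> 'a) \<Rightarrow> 'a \<Rightarrow> ('a \<Rightarrow>\<^sub>0 int) set" where
  "pi_gen \<alpha> \<tau> a = pi_relators \<alpha> \<tau> #>\<^bsub>free_Abelian_group \<alpha>\<^esub> frag_of a"

record ('s, 'a) pairing =
  elems :: "'s set"
  base :: "'s"
  pproj :: "'s \<Rightarrow> 'a"
  form :: "'s \<Rightarrow> 's \<Rightarrow> ('a \<Rightarrow>\<^sub>0 int) set"

definition alpha_pairing :: "'a set \<Rightarrow> ('a \<Rightarrow> 'a) \<Rightarrow> ('s, 'a) pairing \<Rightarrow> bool" where
  "alpha_pairing \<alpha> \<tau> p \<longleftrightarrow>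
     finite (elems p) \<and> base p \<in> elems p \<and>
     pproj p \<in> elems p - {base p} \<rightarrow> \<alpha> \<and>
     form p \<in> elems p \<rightarrow> elems p \<rightarrow> carrier (pi_group \<alpha> \<tau>)"

definition pairing_opp ::
  "'a set \<Rightarrow> ('a \<Rightarrow> 'a) \<Rightarrow> ('s, 'a) pairing \<Rightarrow> ('s, 'a) pairing" where
  "pairing_opp \<alpha> \<tau> p = p\<lparr>form := \<lambda>A B. inv\<^bsub>pi_group \<alpha> \<tau>\<^esub> (form p A B)\<rparr>"

text \<open>In the sum, \<open>None\<close> is the new distinguished element \<open>s\<close>.\<close>

definition pairing_sum ::
  "'a set \<Rightarrow> ('a \<Rightarrow> 'a) \<Rightarrow> ('s, 'a) pairing \<Rightarrow> ('t, 'a) pairing \<Rightarrow>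
   (('s + 't) option, 'a) pairing" where
  "pairing_sum \<alpha> \<tau> p q =
     \<lparr>elems = insert None (Some ` ((elems p - {base p}) <+> (elems q - {base q}))),
      base = None,
      pproj = (\<lambda>u. case u of Some (Inl A) \<Rightarrow> pproj p A | Some (Inr A) \<Rightarrow> pproj q A),
      form = (\<lambda>u u'. case (u, u') of
          (Some (Inl A), Some (Inl B)) \<Rightarrow> form p A B
        | (Some (Inr A), Some (Inr B)) \<Rightarrow> form q A B
        | (Some (Inl A), Some (Inr B)) \<Rightarrow> \<one>\<^bsub>pi_group \<alpha> \<tau>\<^esub>
        | (Some (Inr A), Some (Inl B)) \<Rightarrow> \<one>\<^bsub>pi_group \<alpha> \<tau>\<^esub>
        | (Some (Inl A), None) \<Rightarrow> form p A (base p)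
        | (Some (Inr A), None) \<Rightarrow> form q A (base q)
        | (None, Some (Inl B)) \<Rightarrow> form p (base p) B
        | (None, Some (Inr B)) \<Rightarrow> form q (base q) B
        | (None, None) \<Rightarrow> form p (base p) (base p) \<otimes>\<^bsub>pi_group \<alpha> \<tau>\<^esub> form q (base q) (base q))\<rparr>"

definition bilinear_form ::
  "'a set \<Rightarrow> ('a \<Rightarrow> 'a) \<Rightarrow> ('s, 'a) pairing \<Rightarrow> ('s \<Rightarrow>\<^sub>0 int) \<Rightarrow> ('s \<Rightarrow>\<^sub>0 int) \<Rightarrow>
   ('a \<Rightarrow>\<^sub>0 int) set" where
  "bilinear_form \<alpha> \<tau> p x y =
     finprod (pi_group \<alpha> \<tau>)
       (\<lambda>(A, B). form p A B [^]\<^bsub>pi_group \<alpha> \<tau>\<^esub> (Poly_Mapping.lookup x A * Poly_Mapping.lookup y B))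
       (elems p \<times> elems p)"

definition short_vector ::
  "('a \<Rightarrow> 'a) \<Rightarrow> ('s, 'a) pairing \<Rightarrow> ('s \<Rightarrow>\<^sub>0 int) \<Rightarrow> bool" where
  "short_vector \<tau> p x \<longleftrightarrow>
     (\<exists>A \<in> elems p - {base p}. x = frag_of A) \<or>
     (\<exists>A \<in> elems p - {base p}. \<exists>B \<in> elems p - {base p}.
        A \<noteq> B \<and> pproj p A = pproj p B \<and> x = frag_of A + frag_of B) \<or>
     (\<exists>A \<in> elems p - {base p}. \<exists>B \<in> elems p - {base p}.
        A \<noteq> B \<and> pproj p A = \<tau> (pproj p B) \<and> x = frag_of A - frag_of B)"

text \<open>A finite family of vectors is given as a list.\<close>

definition filling :: "('a \<Rightarrow> 'a) \<Rightarrow> ('s, 'a) pairing \<Rightarrow> ('s \<Rightarrow>\<^sub>0 int) list \<Rightarrow> bool" where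
  "filling \<tau> p L \<longleftrightarrow>
     (\<exists>i<length L. L ! i = frag_of (base p) \<and>
        (\<forall>j<length L. j \<noteq> i \<longrightarrow> short_vector \<tau> p (L ! j))) \<and>
     (\<forall>A \<in> elems p - {base p}. \<exists>!i. i < length L \<and> Poly_Mapping.lookup (L ! i) A \<noteq> 0)"

definition filling_matrix ::
  "'a set \<Rightarrow> ('a \<Rightarrow> 'a) \<Rightarrow> (('a \<Rightarrow>\<^sub>0 int) set \<Rightarrow> int) \<Rightarrow> ('s, 'a) pairing \<Rightarrow>
   ('s \<Rightarrow>\<^sub>0 int) list \<Rightarrow> rat mat" where
  "filling_matrix \<alpha> \<tau> \<phi> p L =
     mat (length L) (length L)
       (\<lambda>(i, j). of_int (\<phi> (bilinear_form \<alpha> \<tau> p (L ! i) (L ! j))))"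

text \<open>
  By \<open>ex_filling\<close> below, every \<open>\<alpha>\<close>-pairing has a filling, so that the minimum exists.
  The rank need not be even, so that the genus is a half-integer.
\<close>

definition phi_genus ::
  "'a set \<Rightarrow> ('a \<Rightarrow> 'a) \<Rightarrow> (('a \<Rightarrow>\<^sub>0 int) set \<Rightarrow> int) \<Rightarrow> ('s, 'a) pairing \<Rightarrow> real" where
  "phi_genus \<alpha> \<tau> \<phi> p =
     real (LEAST r. \<exists>L. filling \<tau> p L \<and>
       r = vec_space.rank (length L) (filling_matrix \<alpha> \<tau> \<phi> p L)) / 2"


section \<open>The \<open>\<alpha>\<close>-pairing of a nanoword\<close>

definition interlacing :: "('l, 'a) nanoword \<Rightarrow> 'l \<Rightarrow> 'l \<Rightarrow> int" where
  "interlacing w A B =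
     (if \<exists>x1 x2 x3 x4 x5. word w = x1 @ [A] @ x2 @ [B] @ x3 @ [A] @ x4 @ [B] @ x5 then 1
      else if \<exists>x1 x2 x3 x4 x5. word w = x1 @ [B] @ x2 @ [A] @ x3 @ [B] @ x4 @ [A] @ x5 then - 1
      else 0)"

definition circ ::
  "'a set \<Rightarrow> ('a \<Rightarrow> 'a) \<Rightarrow> ('l, 'a) nanoword \<Rightarrow> 'l \<Rightarrow> 'l \<Rightarrow> ('a \<Rightarrow>\<^sub>0 int) set" where
  "circ \<alpha> \<tau> w A B =
     finprod (pi_group \<alpha> \<tau>) (\<lambda>D. pi_gen \<alpha> \<tau> (proj w D))
       {D \<in> letters w.
          first_occ w A < first_occ w D \<and> first_occ w D < last_occ w A \<and>
          first_occ w B < last_occ w D \<and> last_occ w D < last_occ w B}"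

definition letter_form ::
  "'a set \<Rightarrow> ('a \<Rightarrow> 'a) \<Rightarrow> ('l, 'a) nanoword \<Rightarrow> 'l \<Rightarrow> 'l \<Rightarrow> ('a \<Rightarrow>\<^sub>0 int) set" where
  "letter_form \<alpha> \<tau> w A B =
     (circ \<alpha> \<tau> w A B \<otimes>\<^bsub>pi_group \<alpha> \<tau>\<^esub> inv\<^bsub>pi_group \<alpha> \<tau>\<^esub> circ \<alpha> \<tau> w B A) [^]\<^bsub>pi_group \<alpha> \<tau>\<^esub> (2::int)
     \<otimes>\<^bsub>pi_group \<alpha> \<tau>\<^esub>
     (pi_gen \<alpha> \<tau> (proj w A) \<otimes>\<^bsub>pi_group \<alpha> \<tau>\<^esub> pi_gen \<alpha> \<tau> (proj w B))
       [^]\<^bsub>pi_group \<alpha> \<tau>\<^esub> interlacing w A B"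

definition base_form ::
  "'a set \<Rightarrow> ('a \<Rightarrow> 'a) \<Rightarrow> ('l, 'a) nanoword \<Rightarrow> 'l \<Rightarrow> ('a \<Rightarrow>\<^sub>0 int) set" where
  "base_form \<alpha> \<tau> w A =
     finprod (pi_group \<alpha> \<tau>)
       (\<lambda>D. pi_gen \<alpha> \<tau> (proj w D) [^]\<^bsub>pi_group \<alpha> \<tau>\<^esub> interlacing w A D) (letters w)"

text \<open>The element \<open>s\<close> is \<open>None\<close>.\<close>

definition nanoword_pairing ::
  "'a set \<Rightarrow> ('a \<Rightarrow> 'a) \<Rightarrow> ('l, 'a) nanoword \<Rightarrow> ('l option, 'a) pairing" where
  "nanoword_pairing \<alpha> \<tau> w =
     \<lparr>elems = insert None (Some ` letters w),
      base = None,
      pproj = (\<lambda>u. case u of Some A \<Rightarrow> proj w A),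
      form = (\<lambda>u u'. case (u, u') of
          (Some A, Some B) \<Rightarrow> letter_form \<alpha> \<tau> w A B
        | (Some A, None) \<Rightarrow> base_form \<alpha> \<tau> w A
        | (None, Some B) \<Rightarrow> inv\<^bsub>pi_group \<alpha> \<tau>\<^esub> base_form \<alpha> \<tau> w B
        | (None, None) \<Rightarrow> \<one>\<^bsub>pi_group \<alpha> \<tau>\<^esub>)\<rparr>"


section \<open>Well-definedness\<close>

lemma comm_group_pi_group: "involution_on \<alpha> \<tau> \<Longrightarrow> comm_group (pi_group \<alpha> \<tau>)"
  and pi_gen_closed: "involution_on \<alpha> \<tau> \<Longrightarrow> a \<in> \<alpha> \<Longrightarrow> pi_gen \<alpha> \<tau> a \<in> carrier (pi_group \<alpha> \<tau>)"
proof -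
  assume inv: "involution_on \<alpha> \<tau>"
  interpret F: comm_group "free_Abelian_group \<alpha>" by (rule abelian_free_Abelian_group)
  have "{frag_of a + frag_of (\<tau> a) | a. a \<in> \<alpha>} \<subseteq> carrier (free_Abelian_group \<alpha>)"
    using inv by (auto simp: involution_on_def Pi_iff dest!: subsetD[OF keys_add])
  then have sub: "subgroup (pi_relators \<alpha> \<tau>) (free_Abelian_group \<alpha>)"
    unfolding pi_relators_def by (rule F.generate_is_subgroup)
  then show "comm_group (pi_group \<alpha> \<tau>)"
    unfolding pi_group_def by (rule F.abelian_FactGroup)
  show "a \<in> \<alpha> \<Longrightarrow> pi_gen \<alpha> \<tau> a \<in> carrier (pi_group \<alpha> \<tau>)"
    unfolding pi_gen_def pi_group_def FactGroup_def
    by (auto intro!: F.rcosetsI subgroup.subset[OF sub])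
qed

lemma finite_letters: "nanoword \<alpha> w \<Longrightarrow> finite (letters w)"
proof (rule finite_subset)
  assume "nanoword \<alpha> w"
  then show "letters w \<subseteq> set (word w)"
    unfolding nanoword_def by (metis count_list_0_iff subsetI zero_neq_numeral)
qed simp

lemma alpha_pairing_nanoword: "involution_on \<alpha> \<tau> \<Longrightarrow> nanoword \<alpha> w \<Longrightarrow> alpha_pairing \<alpha> \<tau> (nanoword_pairing \<alpha> \<tau> w)"
proof -
  assume inv: "involution_on \<alpha> \<tau>" and w: "nanoword \<alpha> w"
  interpret P: comm_group "pi_group \<alpha> \<tau>" using inv by (rule comm_group_pi_group)
  have gen: "A \<in> letters w \<Longrightarrow> pi_gen \<alpha> \<tau> (proj w A) \<in> carrier (pi_group \<alpha> \<tau>)" for A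
    using w inv by (auto simp: nanoword_def intro!: pi_gen_closed)
  have circ: "circ \<alpha> \<tau> w A B \<in> carrier (pi_group \<alpha> \<tau>)" for A B
    unfolding circ_def by (rule P.finprod_closed) (auto intro: gen)
  have base: "base_form \<alpha> \<tau> w A \<in> carrier (pi_group \<alpha> \<tau>)" for A
    unfolding base_form_def by (rule P.finprod_closed) (auto intro!: gen P.int_pow_closed)
  have letter: "A \<in> letters w \<Longrightarrow> B \<in> letters w \<Longrightarrow>
      letter_form \<alpha> \<tau> w A B \<in> carrier (pi_group \<alpha> \<tau>)" for A B
    unfolding letter_form_def
    by (intro P.m_closed P.int_pow_closed P.inv_closed circ gen)
  show ?thesis
    using w finite_letters[OF w] circ base letter
    by (auto simp: alpha_pairing_def nanoword_pairing_def nanoword_def)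
qed

lemma alpha_pairing_opp: "involution_on \<alpha> \<tau> \<Longrightarrow> alpha_pairing \<alpha> \<tau> p \<Longrightarrow> alpha_pairing \<alpha> \<tau> (pairing_opp \<alpha> \<tau> p)"
  using group.inv_closed[OF comm_group.axioms(2)[OF comm_group_pi_group]]
  by (force simp: alpha_pairing_def pairing_opp_def Pi_iff)

lemma alpha_pairing_sum:
  assumes "involution_on \<alpha> \<tau>" "alpha_pairing \<alpha> \<tau> p" "alpha_pairing \<alpha> \<tau> q"
  shows "alpha_pairing \<alpha> \<tau> (pairing_sum \<alpha> \<tau> p q)"
proof -
  interpret P: comm_group "pi_group \<alpha> \<tau>" using assms(1) by (rule comm_group_pi_group)
  show ?thesis using assms(2,3)
    by (auto simp: alpha_pairing_def pairing_sum_def Pi_iff)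
qed

lemma ex_filling:
  assumes "alpha_pairing \<alpha> \<tau> p"
  shows "\<exists>L. filling \<tau> p L"
proof -
  obtain xs where xs: "set xs = elems p - {base p}" "distinct xs"
    using assms finite_distinct_list[of "elems p - {base p}"] by (auto simp: alpha_pairing_def)
  let ?L = "frag_of (base p) # map frag_of xs"
  have "\<exists>!i. i < length ?L \<and> Poly_Mapping.lookup (?L ! i) A \<noteq> 0"
    if A: "A \<in> elems p - {base p}" for A
  proof -
    obtain i where i: "i < length xs" "xs ! i = A"
      using A xs by (metis in_set_conv_nth)
    show ?thesis
    proof (rule ex1I[of _ "Suc i"])
      fix j assume "j < length ?L \<and> Poly_Mapping.lookup (?L ! j) A \<noteq> 0"
      then show "j = Suc i"
        using A i xs(2) by (cases j) (auto simp: nth_eq_iff_index_eq split: if_splits)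
    qed (use i in auto)
  qed
  moreover have "short_vector \<tau> p (?L ! j)" if "j < length ?L" "j \<noteq> 0" for j
    using that xs(1) nth_mem[of "j - 1" xs] by (cases j) (auto simp: short_vector_def)
  ultimately have "filling \<tau> p ?L"
    unfolding filling_def by (intro conjI exI[of _ 0]) auto
  then show ?thesis ..
qed

lemma bridge_move_to_empty:
  fixes w :: "('l, 'a) nanoword"
  assumes w: "nanoword \<alpha> w" and ne: "word w \<noteq> []"
  shows "\<exists>g. bridge_move \<tau> w g (remove_letters w (letters w) [])"
proof -
  define n where "n = length (word w)"
  define v where "v r = [word w ! (r - 1)]" for r
  define x :: "nat \<Rightarrow> 'l list" where "x r = []" for r
  have ex: "\<exists>!j. j < n \<and> j \<noteq> i \<and> word w ! j = word w ! i" if i: "i < n" for i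
  proof -
    let ?S = "{j. j < n \<and> word w ! j = word w ! i}"
    have "word w ! i \<in> letters w"
      using w i nth_mem unfolding nanoword_def n_def by blast
    then have "count_list (word w) (word w ! i) = 2"
      using w by (simp add: nanoword_def)
    moreover have "count_list (word w) A = card {j. j < n \<and> word w ! j = A}" for A
      unfolding count_list_eq_length_filter length_filter_conv_card n_def
      by (rule arg_cong[where f = card]) auto
    ultimately have "card ?S = 2"
      by simp
    then obtain a b where ab: "?S = {a, b}" "a \<noteq> b" by (auto simp: card_2_iff)
    have "i \<in> ?S" using i by simp
    then have "i = a \<or> i = b" unfolding ab(1) by simp
    then have "\<exists>!j. j \<in> {a, b} \<and> j \<noteq> i" using ab(2) by auto
    then show ?thesis unfolding ab(1)[symmetric] by (simp add: conj_ac)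
  qed
  define other where "other i = (THE j. j < n \<and> j \<noteq> i \<and> word w ! j = word w ! i)" for i
  have other: "other i < n" "other i \<noteq> i" "word w ! other i = word w ! i" if "i < n" for i
    using theI'[OF ex[OF that]] by (auto simp: other_def)
  have other2: "other (other i) = i" if "i < n" for i
    using other[OF that] other[OF other(1)[OF that]] ex[OF other(1)[OF that]] that by metis
  define \<kappa> where "\<kappa> r = (if r \<in> {1..n} then Suc (other (r - 1)) else r)" for r
  have \<kappa>_Suc: "\<kappa> (Suc i) = Suc (other i)" if "i < n" for i
    using that by (simp add: \<kappa>_def)
  have idx: "\<exists>i<n. r = Suc i" if "r \<in> {1..n}" for r
    using that by (intro exI[of _ "r - 1"]) auto
  have \<kappa>_in: "\<kappa> r \<in> {1..n}" if "r \<in> {1..n}" for r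
    using idx[OF that] \<kappa>_Suc other(1) by (auto simp: Suc_le_eq)
  have \<kappa>_ne: "\<kappa> r \<noteq> r" if "r \<in> {1..n}" for r
    using idx[OF that] \<kappa>_Suc other(2) by auto
  have \<kappa>2: "\<kappa> (\<kappa> r) = r" for r
  proof (cases "r \<in> {1..n}")
    case True
    then show ?thesis using idx[OF True] \<kappa>_Suc other(1) other2 by auto
  next
    case False
    then show ?thesis by (simp only: \<kappa>_def if_False)
  qed
  have perm: "\<kappa> permutes {1..n}"
  proof (rule bij_imp_permutes)
    show "bij_betw \<kappa> {1..n} {1..n}"
      by (rule bij_betwI[where g = \<kappa>]) (use \<kappa>_in \<kappa>2 in blast)+
    show "\<kappa> r = r" if "r \<notin> {1..n}" for r
      using that by (simp only: \<kappa>_def if_False)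
  qed
  have conc: "concat (map v [1..<Suc k]) = take k (word w)" if "k \<le> n" for k
    using that
  proof (induction k)
    case (Suc k)
    then show ?case by (simp add: v_def n_def take_Suc_conv_app_nth)
  qed simp
  have start: "block_start x v r = r - 1" if r: "r \<in> {1..n}" for r
  proof -
    obtain i where i: "i < n" "r = Suc i" using idx[OF r] by blast
    then have "concat (map v [1..<r]) = take i (word w)" using conc[of i] by simp
    then show ?thesis using i by (simp add: block_start_def x_def n_def)
  qed
  have eps: "bridge_eps w n x v \<kappa> id b = 0" for b
  proof -
    have "block_start x v r \<noteq> block_start x v (\<kappa> r)" if "r \<in> {1..n}" for r
      using start[OF that] start[OF \<kappa>_in[OF that]] \<kappa>_ne[OF that] \<kappa>_in[OF that] that by auto
    then show ?thesis by (simp add: bridge_eps_def v_def) (metis atLeastAtMost_iff)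
  qed
  have "is_factor w (letters w) n x v"
  proof -
    have c: "concat (map v [1..<Suc n]) = word w" "concat (map (\<lambda>r. x r @ v r) [1..<Suc n]) = word w"
      using conc[of n] by (simp_all add: x_def n_def del: upt_Suc)
    have "set (v r) \<subseteq> letters w" if r: "r \<in> {1..n}" for r
    proof -
      obtain i where "i < n" "r = Suc i" using idx[OF r] by blast
      then show ?thesis using w nth_mem[of i "word w"] by (auto simp: nanoword_def v_def n_def)
    qed
    then show ?thesis
      unfolding is_factor_def c using w by (auto simp: nanoword_def x_def)
  qed
  moreover have "map id (v r) = rev (v (\<kappa> r))" if "r \<in> {1..n}" for r
    using idx[OF that] \<kappa>_Suc other(3) by (auto simp: v_def)
  ultimately have "quasi_bridge w (letters w) n x v \<kappa> id"
    using perm \<kappa>2 \<kappa>_ne ne by (auto simp: quasi_bridge_def n_def Suc_le_eq)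
  then have "bridge \<tau> w (letters w) n x v \<kappa> id"
    using eps by (simp add: bridge_def)
  moreover have "concat (map x [1..<Suc (Suc n)]) = []"
    by (simp add: x_def)
  ultimately show ?thesis
    unfolding bridge_move_def by metis
qed

lemma ex_metamorphosis:
  fixes w v :: "('l, 'a) nanoword"
  assumes "nanoword \<alpha> w" "nanoword \<alpha> v"
  shows "\<exists>g. metamorphosis \<alpha> \<tau> w g v"
proof -
  define e :: "('l, 'a) nanoword" where "e = \<lparr>letters = {}, proj = (\<lambda>_. undefined), word = []\<rparr>"
  have e: "nanoword \<alpha> e" by (simp add: nanoword_def e_def)
  have to_e: "u = e \<or> (\<exists>g. elementary_move \<tau> u g e)" if u: "nanoword \<alpha> u" for u
  proof (cases "word u = []")
    case True
    then have "letters u = {}" using u by (force simp: nanoword_def)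
    then have "u = e" using True u by (cases u) (auto simp: nanoword_def e_def PiE_def extensional_def)
    then show ?thesis ..
  next
    case False
    have "remove_letters u (letters u) [] = e"
      by (simp add: remove_letters_def e_def restrict_def)
    then show ?thesis
      using bridge_move_to_empty[OF u False] elementary_move.bridge by metis
  qed
  have "\<exists>g. metamorphosis \<alpha> \<tau> w g e"
    using to_e[OF assms(1)] metamorphosis.intros(1,2) assms(1) e by metis
  then show ?thesis
    using to_e[OF assms(2)] metamorphosis.intros(3) assms(2) by metis
qed

end

theory Submission
  imports Defs "HOL-Combinatorics.Cycles"
begin

text \<open>
  Composed with \<open>\<phi>\<close>, the pairing of a nanoword becomes an intersection form: let the letter
  \<open>A\<close> act as the function on positions that is 1 between its two occurrences, 1/2 at them and
  0 elsewhere, and let \<open>s\<close> be the constant 1/2; then \<open>\<phi>(e(x, y))\<close> is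
  twice the signed sum over all letters \<open>D\<close> of \<open>x(i) y(j) - x(j) y(i)\<close>, where \<open>i < j\<close> are the
  occurrences of \<open>D\<close>.  Each move yields a linear relation between functions on the positions of
  the two words that contains a filling up to multiples of the constant functions.  On this
  relation the difference of the two forms vanishes, except for a bridge move, where each arch
  contributes two summands of the shape \<open>c(x) d(y) - d(x) c(y)\<close>.  Composing relations adds the
  numbers of summands.  Finally, the constants of the two words have to be separated, which costs
  one more summand, so that the rank is at most \<open>2 (2 \<rho> + 1)\<close>.
\<close>

section \<open>Skew forms of bounded rank\<close>

text \<open>The obstacle is a triangle inequality: fillings for (w, u) and for (u, v) cannot be
  added up to one for (w, v), because their short vectors overlap in the letters of u. Hence a
  filling is stored as an involution on the disjoint union of two alphabets, its orbits being the
  short vectors other than s. The union of two such involutions is a graph of paths and cycles;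
  following the paths through the letters of u to their ends gives the involution for (w, v). The
  sums of loops along a path agree on u from both sides up to constants, which is what the
  composition of linear relations demands.

  Relations, rather than spans of concrete vectors, leave room for functions on positions that come
  from no letter, so that a move can be described by what it does to positions. Only isomorphisms,
  shifts, the third homotopy move and bridges need such a description: the first two homotopy moves
  are bridges without arches.

  The genus is half of a rank, and a summand c(x) d(y) - d(x) c(y) has rank at most two, so the
  genus is bounded by the number of summands.\<close>

definition skew_rank_le :: "nat \<Rightarrow> 'x set \<Rightarrow> ('x \<Rightarrow> 'x \<Rightarrow> rat) \<Rightarrow> bool" where
  "skew_rank_le m S F \<longleftrightarrow>
     (\<exists>c d. \<forall>x\<in>S. \<forall>y\<in>S. F x y = (\<Sum>k<m. c k x * d k y - d k x * c k y))"

lemma skew_rank_leE: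
  assumes "skew_rank_le m S F"
  obtains c d :: "nat \<Rightarrow> 'x \<Rightarrow> rat"
  where "\<forall>x\<in>S. \<forall>y\<in>S. F x y = (\<Sum>k<m. c k x * d k y - d k x * c k y)"
  using assms unfolding skew_rank_le_def by blast

lemma skew_rank_le_0: "(\<And>x y. x \<in> S \<Longrightarrow> y \<in> S \<Longrightarrow> F x y = 0) \<Longrightarrow> skew_rank_le 0 S F"
  by (simp add: skew_rank_le_def)

text \<open>No linearity is asked of \<open>c\<close> and \<open>d\<close>, so \<open>h\<close> may
  be any map. Later it is often a map that involves arbitrary choices.\<close>

lemma skew_rank_le_pullback:
  assumes "skew_rank_le m S F"
    and "\<And>x. x \<in> T \<Longrightarrow> h x \<in> S" and "\<And>x y. x \<in> T \<Longrightarrow> y \<in> T \<Longrightarrow> G x y = F (h x) (h y)"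
  shows "skew_rank_le m T G"
proof -
  obtain c d where "\<forall>x\<in>S. \<forall>y\<in>S. F x y = (\<Sum>k<m. c k x * d k y - d k x * c k y)"
    using assms(1) by (rule skew_rank_leE)
  then show ?thesis
    unfolding skew_rank_le_def using assms(2,3)
    by (intro exI[of _ "\<lambda>k. c k \<circ> h"] exI[of _ "\<lambda>k. d k \<circ> h"]) simp
qed

lemma skew_rank_le_uminus:
  assumes "skew_rank_le m S F"
  shows "skew_rank_le m S (\<lambda>x y. - F x y)"
proof -
  obtain c d where "\<forall>x\<in>S. \<forall>y\<in>S. F x y = (\<Sum>k<m. c k x * d k y - d k x * c k y)"
    using assms by (rule skew_rank_leE)
  then show ?thesis
    unfolding skew_rank_le_def
    by (intro exI[of _ d] exI[of _ c]) (simp flip: sum_negf)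
qed

lemma skew_rank_le_add:
  assumes "skew_rank_le m S F" and "skew_rank_le n S G"
  shows "skew_rank_le (m + n) S (\<lambda>x y. F x y + G x y)"
proof -
  obtain c d where F: "\<forall>x\<in>S. \<forall>y\<in>S. F x y = (\<Sum>k<m. c k x * d k y - d k x * c k y)"
    using assms(1) by (rule skew_rank_leE)
  obtain c' d' where G: "\<forall>x\<in>S. \<forall>y\<in>S. G x y = (\<Sum>k<n. c' k x * d' k y - d' k x * c' k y)"
    using assms(2) by (rule skew_rank_leE)
  have split: "(\<Sum>k<m + n. f k) = (\<Sum>k<m. f k) + (\<Sum>k<n. f (m + k))" for f :: "nat \<Rightarrow> rat"
    by (induction n) auto
  show ?thesis
    unfolding skew_rank_le_def using F G
    by (intro exI[of _ "\<lambda>k. if k < m then c k else c' (k - m)"]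
        exI[of _ "\<lambda>k. if k < m then d k else d' (k - m)"]) (simp add: split)
qed

lemma skew_rank_le_sum:
  assumes "finite I"
    and "\<And>x y. x \<in> S \<Longrightarrow> y \<in> S \<Longrightarrow> F x y = (\<Sum>i\<in>I. c i x * d i y - d i x * c i y)"
  shows "skew_rank_le (card I) S F"
proof -
  obtain h where h: "bij_betw h {..<card I} I"
    using bij_betw_from_nat_into_finite[OF assms(1)] ..
  have "F x y = (\<Sum>k<card I. c (h k) x * d (h k) y - d (h k) x * c (h k) y)"
    if "x \<in> S" "y \<in> S" for x y
    unfolding assms(2)[OF that] by (rule sum.reindex_bij_betw[OF h, symmetric])
  then show ?thesis
    unfolding skew_rank_le_def
    by (intro exI[of _ "\<lambda>k. c (h k)"] exI[of _ "\<lambda>k. d (h k)"] ballI)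
qed

section \<open>Ranks of Gram matrices\<close>

lemma rank_sum_products_le:
  fixes f g :: "'i \<Rightarrow> nat \<Rightarrow> 'f::field"
  assumes "finite I"
  shows "vec_space.rank n (mat n n (\<lambda>(i, j). \<Sum>k\<in>I. f k i * g k j)) \<le> card I"
  using assms
proof (induction I rule: finite_induct)
  case empty
  have "mat n n (\<lambda>(i, j). \<Sum>k\<in>{}. f k i * g k j) = 0\<^sub>m n n" by (intro eq_matI) auto
  then show ?case by (simp only: vec_space.rank_0I card.empty)
next
  case (insert k I)
  let ?A = "mat n n (\<lambda>(i, j). f k i * g k j)"
  let ?B = "mat n n (\<lambda>(i, j). \<Sum>k\<in>I. f k i * g k j)"
  have "mat n n (\<lambda>(i, j). \<Sum>k\<in>insert k I. f k i * g k j) = ?A + ?B"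
    using insert.hyps by (intro eq_matI) auto
  moreover have "vec_space.rank n ?A \<le> 1"
    by (rule vec_space.rank_le_1_product_entries[where nc = n and f = "f k" and g = "g k"]) auto
  moreover have "vec_space.rank n (?A + ?B) \<le> vec_space.rank n ?A + vec_space.rank n ?B"
    by (rule vec_space.rank_subadditive[where nc = n]) auto
  ultimately show ?case using insert by simp
qed

lemma rank_gram_le:
  assumes "skew_rank_le m S F" and "\<And>i. i < n \<Longrightarrow> u i \<in> S"
  shows "vec_space.rank n (mat n n (\<lambda>(i, j). a * F (u i) (u j))) \<le> 2 * m"
proof -
  obtain c d where F: "\<forall>x\<in>S. \<forall>y\<in>S. F x y = (\<Sum>k<m. c k x * d k y - d k x * c k y)"
    using assms(1) by (rule skew_rank_leE)
  \<comment> \<open>A skew summand is a difference of two outer products, so the index set is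
    doubled; the scalar and the sign are absorbed in the left factor.\<close>
  let ?f = "\<lambda>k i. case k of Inl k \<Rightarrow> a * c k (u i) | Inr k \<Rightarrow> - a * d k (u i)"
  let ?g = "\<lambda>k i. case k of Inl k \<Rightarrow> d k (u i) | Inr k \<Rightarrow> c k (u i)"
  have "mat n n (\<lambda>(i, j). a * F (u i) (u j)) =
      mat n n (\<lambda>(i, j). \<Sum>k\<in>{..<m} <+> {..<m}. ?f k i * ?g k j)"
    (is "?M = ?N")
  proof (rule eq_matI)
    fix i j assume "i < dim_row ?N" and "j < dim_col ?N"
    then have ij: "i < n" "j < n" by simp_all
    then have "F (u i) (u j) = (\<Sum>k<m. c k (u i) * d k (u j) - d k (u i) * c k (u j))"
      using F assms(2) by simp
    then have "a * F (u i) (u j) =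
        (\<Sum>k<m. a * c k (u i) * d k (u j)) + (\<Sum>k<m. - a * d k (u i) * c k (u j))"
      by (simp add: sum_distrib_left right_diff_distrib mult.assoc sum_subtractf sum_negf)
    then show "?M $$ (i, j) = ?N $$ (i, j)"
      using ij by (simp add: sum.Plus)
  qed simp_all
  then show ?thesis
    using rank_sum_products_le[of "{..<m} <+> {..<m}" n ?f ?g] by (simp add: card_Plus)
qed

section \<open>Composition of matchings\<close>

text \<open>For involutions this is the orbit under the dihedral group generated by \<open>f\<close>
  and \<open>g\<close>; no inverses are needed as generators.\<close>

inductive_set joint_orbit :: "('z \<Rightarrow> 'z) \<Rightarrow> ('z \<Rightarrow> 'z) \<Rightarrow> 'z \<Rightarrow> 'z set" for f g x where
  start: "x \<in> joint_orbit f g x"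
| left: "y \<in> joint_orbit f g x \<Longrightarrow> f y \<in> joint_orbit f g x"
| right: "y \<in> joint_orbit f g x \<Longrightarrow> g y \<in> joint_orbit f g x"

lemma joint_orbit_commute: "joint_orbit f g x = joint_orbit g f x"
proof -
  have "joint_orbit f g x \<subseteq> joint_orbit g f x" for f g :: "'a \<Rightarrow> 'a"
  proof
    fix y assume "y \<in> joint_orbit f g x"
    then show "y \<in> joint_orbit g f x" by induction (auto intro: joint_orbit.intros)
  qed
  then show ?thesis by blast
qed

lemma joint_orbit_subset: "y \<in> joint_orbit f g x \<Longrightarrow> joint_orbit f g y \<subseteq> joint_orbit f g x"
proof
  fix z assume y: "y \<in> joint_orbit f g x" and "z \<in> joint_orbit f g y"
  from this(2) show "z \<in> joint_orbit f g x"
    by induction (auto intro: y joint_orbit.intros)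
qed

lemma joint_orbit_sym:
  assumes "\<And>x. f (f x) = x" "\<And>x. g (g x) = x" and "y \<in> joint_orbit f g x"
  shows "x \<in> joint_orbit f g y"
  using assms(3)
proof induction
  case start
  show ?case by (rule joint_orbit.start)
next
  case (left y)
  have "y \<in> joint_orbit f g (f y)"
    using joint_orbit.left[OF joint_orbit.start, of f "f y" g] by (simp add: assms(1))
  from subsetD[OF joint_orbit_subset[OF this] left.IH] show ?case .
next
  case (right y)
  have "y \<in> joint_orbit f g (g y)"
    using joint_orbit.right[OF joint_orbit.start, of g "g y" f] by (simp add: assms(2))
  from subsetD[OF joint_orbit_subset[OF this] right.IH] show ?case .
qed

lemma joint_orbit_eq:
  assumes "\<And>x. f (f x) = x" "\<And>x. g (g x) = x" and "y \<in> joint_orbit f g x"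
  shows "joint_orbit f g y = joint_orbit f g x"
  using joint_orbit_subset[OF assms(3)] joint_orbit_subset[OF joint_orbit_sym[OF assms]] by blast

text \<open>
  On the orbit of a fixed point \<open>x\<close> of \<open>g\<close>, the rotation \<open>g \<circ> f\<close> acts as a cycle of some
  length \<open>n\<close>, and \<open>g\<close> and \<open>f\<close> act on exponents as \<open>k \<mapsto> - k\<close> and \<open>k \<mapsto> - k - 1\<close> modulo \<open>n\<close>.
\<close>

lemma joint_orbit_fixed_points:
  assumes Z: "finite Z" "f permutes Z" "g permutes Z"
    and inv: "\<And>x. f (f x) = x" "\<And>x. g (g x) = x" and x: "g x = x"
  shows "\<exists>y. \<forall>z\<in>joint_orbit f g x. f z = z \<or> g z = z \<longrightarrow> z = x \<or> z = y"
proof -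
  define \<rho> where "\<rho> = g \<circ> f"
  define n where "n = least_power \<rho> x"
  have perm: "permutation \<rho>"
    unfolding \<rho>_def using Z permutes_compose permutation_permutes by blast
  have n: "(\<rho> ^^ n) x = x" "n > 0"
    unfolding n_def using least_power_of_permutation[OF perm] by auto
  have inj: "(\<rho> ^^ k) a = (\<rho> ^^ k) b \<Longrightarrow> a = b" for k a b
    using perm by (metis bij_betw_def bij_fn inj_eq permutation_bijective)
  \<comment> \<open>The dihedral relation: conjugation by \<open>g\<close> turns the rotation g f
    into f g, its inverse.\<close>
  have conj: "(\<rho> ^^ k) (g ((\<rho> ^^ k) a)) = g a" for k a
  proof (induction k arbitrary: a)
    case (Suc k)
    have "(\<rho> ^^ Suc k) (g ((\<rho> ^^ Suc k) a)) = \<rho> ((\<rho> ^^ k) (g ((\<rho> ^^ k) (\<rho> a))))"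
      by (simp add: funpow_swap1)
    also have "\<dots> = g a" unfolding Suc.IH by (simp add: \<rho>_def inv)
    finally show ?case .
  qed simp
  have g: "g ((\<rho> ^^ k) x) = (\<rho> ^^ (n - k)) x" if "k \<le> n" for k
  proof (rule inj)
    show "(\<rho> ^^ k) (g ((\<rho> ^^ k) x)) = (\<rho> ^^ k) ((\<rho> ^^ (n - k)) x)"
      using that conj[of k x] x n(1) by (metis comp_apply funpow_add le_add_diff_inverse)
  qed
  have f: "f a = g (\<rho> a)" for a by (simp add: \<rho>_def inv)
  have mod: "(\<rho> ^^ k) x = (\<rho> ^^ (k mod n)) x" for k
    by (metis n(1) funpow_mod_eq)
  have orbit: "\<exists>k<n. z = (\<rho> ^^ k) x" if "z \<in> joint_orbit f g x" for z
    using that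
  proof induction
    case start
    then show ?case using n by (intro exI[of _ 0]) auto
  next
    case (left y)
    then obtain k where "k < n" "y = (\<rho> ^^ k) x" by blast
    then have "f y = (\<rho> ^^ (n - Suc k)) x" using f g[of "Suc k"] by simp
    then show ?case using n by (intro exI[of _ "n - Suc k"]) auto
  next
    case (right y)
    then obtain k where "k < n" "y = (\<rho> ^^ k) x" by blast
    then have "g y = (\<rho> ^^ ((n - k) mod n)) x" using g[of k] mod by simp
    then show ?case using n by (intro exI[of _ "(n - k) mod n"]) auto
  qed
  have dvd: "n dvd k" if "(\<rho> ^^ k) x = x" for k
    using least_power_dvd[OF perm] that n_def by blast
  \<comment> \<open>Fixed points of \<open>g\<close> correspond to 2 k = 0 modulo n, those of
    \<open>f\<close> to 2 k + 1 = 0. Whatever the parity of n, the only solutions below n are 0 and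
    one further exponent, which in both cases is \<open>n div 2\<close>.\<close>
  have half: "k = 0 \<or> k = n div 2" if "k < n" and "n dvd 2 * k \<or> n dvd 2 * k + 1" for k
  proof -
    have "m = 0 \<or> m = n" if "m < 2 * n" "n dvd m" for m
      using that by (auto elim!: dvdE)
    from this[of "2 * k"] this[of "2 * k + 1"] show ?thesis using that by auto
  qed
  have "z = x \<or> z = (\<rho> ^^ (n div 2)) x"
    if z: "z \<in> joint_orbit f g x" and fp: "f z = z \<or> g z = z" for z
  proof -
    obtain k where k: "k < n" "z = (\<rho> ^^ k) x" using orbit[OF z] by blast
    have "(\<rho> ^^ (2 * k)) x = x \<or> (\<rho> ^^ (2 * k + 1)) x = x"
    proof (cases "g z = z")
      case True
      then have "(\<rho> ^^ k) ((\<rho> ^^ k) x) = x" using conj[of k x] k x by simp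
      then show ?thesis by (simp add: mult_2 funpow_add)
    next
      case False
      then have "g ((\<rho> ^^ Suc k) x) = (\<rho> ^^ k) x" using fp f k by simp
      then have "(\<rho> ^^ Suc k) ((\<rho> ^^ k) x) = x" using conj[of "Suc k" x] x by simp
      then show ?thesis by (simp add: mult_2 funpow_add)
    qed
    then have "k = 0 \<or> k = n div 2" using half k(1) dvd by blast
    then show ?thesis using k(2) by auto
  qed
  then show ?thesis by blast
qed

text \<open>Extended by the identity, the first involution fixes C and the second fixes A. The
  elements of A and C are therefore fixed points of one of the two maps, and a joint orbit has at
  most two of those; \<open>\<theta>\<close> exchanges the ends of a path that lie in A or C. The
  sets A', B', C' record the whole orbit, so that sums over it can be compared later, and the
  colours h are constant on it.\<close>

lemma compose_matchings:
  fixes \<theta>\<^sub>1 :: "'a + 'b \<Rightarrow> 'a + 'b" and \<theta>\<^sub>2 :: "'b + 'c \<Rightarrow> 'b + 'c"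
    and h\<^sub>A :: "'a \<Rightarrow> 'k" and h\<^sub>B :: "'b \<Rightarrow> 'k" and h\<^sub>C :: "'c \<Rightarrow> 'k"
  assumes fin: "finite A" "finite B" "finite C"
    and \<theta>1: "\<And>X. X \<in> A <+> B \<Longrightarrow> \<theta>\<^sub>1 X \<in> A <+> B \<and> \<theta>\<^sub>1 (\<theta>\<^sub>1 X) = X \<and>
       case_sum h\<^sub>A h\<^sub>B (\<theta>\<^sub>1 X) = case_sum h\<^sub>A h\<^sub>B X"
    and \<theta>2: "\<And>X. X \<in> B <+> C \<Longrightarrow> \<theta>\<^sub>2 X \<in> B <+> C \<and> \<theta>\<^sub>2 (\<theta>\<^sub>2 X) = X \<and>
       case_sum h\<^sub>B h\<^sub>C (\<theta>\<^sub>2 X) = case_sum h\<^sub>B h\<^sub>C X"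
  shows "\<exists>\<theta>. \<forall>X\<in>A <+> C. \<theta> X \<in> A <+> C \<and> \<theta> (\<theta> X) = X \<and>
      case_sum h\<^sub>A h\<^sub>C (\<theta> X) = case_sum h\<^sub>A h\<^sub>C X \<and>
      (\<exists>A' B' C'. A' \<subseteq> A \<and> B' \<subseteq> B \<and> C' \<subseteq> C \<and> A' <+> C' = {X, \<theta> X} \<and>
         \<theta>\<^sub>1 ` (A' <+> B') \<subseteq> A' <+> B' \<and> \<theta>\<^sub>2 ` (B' <+> C') \<subseteq> B' <+> C')"
proof -
  define Z where "Z = A <+> (B <+> C)"
  define e :: "'a + 'b \<Rightarrow> 'a + ('b + 'c)" where "e = case_sum Inl (Inr \<circ> Inl)"
  define j :: "'a + 'c \<Rightarrow> 'a + ('b + 'c)" where "j = case_sum Inl (Inr \<circ> Inr)"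
  define T1 where "T1 z = (if z \<in> e ` (A <+> B) then e (\<theta>\<^sub>1 (the_inv e z)) else z)" for z
  define T2 where "T2 z = (if z \<in> Inr ` (B <+> C) then Inr (\<theta>\<^sub>2 (projr z)) else z)"
    for z :: "'a + ('b + 'c)"
  define H where "H = case_sum h\<^sub>A (case_sum h\<^sub>B h\<^sub>C)"
  have inj_e: "inj e" by (auto simp: inj_def e_def split: sum.splits)
  have inj_j: "inj j" by (auto simp: inj_def j_def split: sum.splits)
  have T1e: "T1 (e X) = e (\<theta>\<^sub>1 X)" if "X \<in> A <+> B" for X
    using that by (simp add: T1_def the_inv_f_f[OF inj_e])
  have T2r: "T2 (Inr X) = Inr (\<theta>\<^sub>2 X)" if "X \<in> B <+> C" for X
    using that by (simp add: T2_def)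
  have T1o: "T1 z = z" if "z \<notin> e ` (A <+> B)" for z
    using that by (simp add: T1_def)
  have T2o: "T2 z = z" if "z \<notin> Inr ` (B <+> C)" for z
    using that by (simp add: T2_def)
  have invT1: "T1 (T1 z) = z" for z
  proof (cases "z \<in> e ` (A <+> B)")
    case True
    then obtain X where "z = e X" "X \<in> A <+> B" by blast
    then show ?thesis using T1e \<theta>1 by simp
  qed (simp add: T1o)
  have invT2: "T2 (T2 z) = z" for z
  proof (cases "z \<in> Inr ` (B <+> C)")
    case True
    then obtain X where "z = Inr X" "X \<in> B <+> C" by blast
    then show ?thesis using T2r \<theta>2 by simp
  qed (simp add: T2o)
  have eZ: "e X \<in> Z \<longleftrightarrow> X \<in> A <+> B" for X
    by (cases X) (auto simp: e_def Z_def)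
  have eZ': "e ` (A <+> B) \<subseteq> Z" using eZ by blast
  have finZ: "finite Z" using fin by (simp add: Z_def)
  have perm: "f permutes Z" if "\<And>z. f (f z) = z" "\<And>z. z \<in> Z \<Longrightarrow> f z \<in> Z" "\<And>z. z \<notin> Z \<Longrightarrow> f z = z" for f
    by (rule bij_imp_permutes[OF bij_betwI[where g = f]]) (use that in auto)
  have T1Z: "T1 z \<in> Z" if "z \<in> Z" for z
  proof (cases "z \<in> e ` (A <+> B)")
    case True
    then obtain X where "z = e X" "X \<in> A <+> B" by blast
    then show ?thesis using T1e \<theta>1 eZ by simp
  qed (simp add: T1o that)
  have T2Z: "T2 z \<in> Z" if "z \<in> Z" for z
  proof (cases "z \<in> Inr ` (B <+> C)")
    case True
    then obtain X where "z = Inr X" "X \<in> B <+> C" by blast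
    then show ?thesis unfolding Z_def using T2r \<theta>2 by (metis InrI)
  qed (simp add: T2o that)
  have perm1: "T1 permutes Z"
    using perm[OF invT1 T1Z] T1o eZ' by blast
  have perm2: "T2 permutes Z"
    by (rule perm[OF invT2 T2Z]) (auto intro!: T2o simp: Z_def)
  define O' where "O' X = joint_orbit T1 T2 (j X)" for X
  have O'Z: "O' X \<subseteq> Z" if "X \<in> A <+> C" for X
  proof
    fix z assume "z \<in> O' X"
    moreover have "j X \<in> Z" using that by (cases X) (auto simp: j_def Z_def)
    ultimately show "z \<in> Z" unfolding O'_def
      by (induction rule: joint_orbit.induct) (auto intro: T1Z T2Z)
  qed
  have HT1: "H (T1 z) = H z" for z
  proof (cases "z \<in> e ` (A <+> B)")
    case True
    then obtain X where X: "z = e X" "X \<in> A <+> B" by blast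
    have "H (e Y) = case_sum h\<^sub>A h\<^sub>B Y" for Y by (cases Y) (auto simp: H_def e_def)
    then show ?thesis using X \<theta>1 T1e by simp
  qed (simp add: T1o)
  have HT2: "H (T2 z) = H z" for z
  proof (cases "z \<in> Inr ` (B <+> C)")
    case True
    then obtain X where "z = Inr X" "X \<in> B <+> C" by blast
    then show ?thesis using \<theta>2 T2r by (simp add: H_def)
  qed (simp add: T2o)
  have HO: "H z = H (j X)" if "z \<in> O' X" for z X
    using that unfolding O'_def by (induction rule: joint_orbit.induct) (simp_all add: HT1 HT2)
  have Hj: "H (j X) = case_sum h\<^sub>A h\<^sub>C X" for X by (cases X) (auto simp: H_def j_def)
  have fixed: "T1 (j X) = j X \<or> T2 (j X) = j X" for X
  proof (cases X)
    case (Inr c)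
    then have "j X \<notin> e ` (A <+> B)" by (auto simp: e_def j_def split: sum.splits)
    then show ?thesis by (simp add: T1o)
  next
    case (Inl a)
    then have "j X \<notin> Inr ` (B <+> C)" by (auto simp: j_def)
    then show ?thesis by (simp add: T2o)
  qed
  have uniq: "Y = Y'" if "j Y \<in> O' X" "j Y' \<in> O' X" "Y \<noteq> X" "Y' \<noteq> X" for X Y Y'
  proof -
    have "\<exists>y. \<forall>z\<in>joint_orbit T1 T2 (j X). T1 z = z \<or> T2 z = z \<longrightarrow> z = j X \<or> z = y"
      using fixed[of X]
    proof
      \<comment> \<open>The counting lemma starts from a point fixed by the second of the two maps,
        so here the two maps exchange their roles.\<close>
      assume "T1 (j X) = j X"
      then show ?thesis
        using joint_orbit_fixed_points[OF finZ perm2 perm1 invT2 invT1] joint_orbit_commute[of T1 T2]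
        by (metis (no_types, lifting))
    next
      assume "T2 (j X) = j X"
      then show ?thesis
        by (rule joint_orbit_fixed_points[OF finZ perm1 perm2 invT1 invT2])
    qed
    then obtain y where "\<And>Y. j Y \<in> O' X \<Longrightarrow> j Y = j X \<or> j Y = y"
      unfolding O'_def using fixed by blast
    then show ?thesis using that injD[OF inj_j] by metis
  qed
  have O'_eq: "O' Y = O' X" if "j Y \<in> O' X" for X Y
    using that unfolding O'_def by (rule joint_orbit_eq[OF invT1 invT2])
  have self: "j X \<in> O' X" for X unfolding O'_def by (rule joint_orbit.start)
  \<comment> \<open>For X in A + C without a second end, the path stops at a fixed point of one of
    the given matchings, and X becomes its own partner.\<close>
  define \<theta> where "\<theta> X = (if \<exists>Y. j Y \<in> O' X \<and> Y \<noteq> X then SOME Y. j Y \<in> O' X \<and> Y \<noteq> X else X)" for X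
  have \<theta>_in: "j (\<theta> X) \<in> O' X" for X
    using self[of X] someI_ex[of "\<lambda>Y. j Y \<in> O' X \<and> Y \<noteq> X"] by (auto simp: \<theta>_def)
  have \<theta>_ne: "\<theta> X \<noteq> X" if "j Y \<in> O' X" "Y \<noteq> X" for X Y
    using that someI_ex[of "\<lambda>Y. j Y \<in> O' X \<and> Y \<noteq> X"] by (auto simp: \<theta>_def)
  have pair: "j Y \<in> O' X \<longleftrightarrow> Y = X \<or> Y = \<theta> X" for X Y
    using self \<theta>_in \<theta>_ne uniq by metis
  have \<theta>\<theta>: "\<theta> (\<theta> X) = X" for X
    using pair[of X "\<theta> X"] pair[of "\<theta> X" X] O'_eq[OF \<theta>_in, of X] self[of X] pair by metis
  show ?thesis
  proof (intro exI[of _ \<theta>] ballI conjI)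
    fix X assume X: "X \<in> A <+> C"
    show "\<theta> X \<in> A <+> C"
      using \<theta>_in[of X] O'Z[OF X] by (cases "\<theta> X") (auto simp: j_def Z_def)
    show "\<theta> (\<theta> X) = X" by (rule \<theta>\<theta>)
    show "case_sum h\<^sub>A h\<^sub>C (\<theta> X) = case_sum h\<^sub>A h\<^sub>C X" using HO[OF \<theta>_in] Hj by metis
    define A' where "A' = {a. Inl a \<in> O' X}"
    define B' where "B' = {b. Inr (Inl b) \<in> O' X}"
    define C' where "C' = {c. Inr (Inr c) \<in> O' X}"
    have sub: "A' \<subseteq> A" "B' \<subseteq> B" "C' \<subseteq> C"
      using O'Z[OF X] by (auto simp: A'_def B'_def C'_def Z_def)
    have "Y \<in> A' <+> C' \<longleftrightarrow> j Y \<in> O' X" for Y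
      by (cases Y) (auto simp: A'_def C'_def j_def)
    then have "A' <+> C' = {X, \<theta> X}" using pair by blast
    moreover have mem1: "Y \<in> A' <+> B' \<longleftrightarrow> e Y \<in> O' X" for Y
      by (cases Y) (auto simp: A'_def B'_def e_def)
    moreover have mem2: "Y \<in> B' <+> C' \<longleftrightarrow> Inr Y \<in> O' X" for Y
      by (cases Y) (auto simp: C'_def B'_def)
    moreover have "\<theta>\<^sub>1 Y \<in> A' <+> B'" if "Y \<in> A' <+> B'" for Y
    proof -
      have "Y \<in> A <+> B" using that sub by auto
      then have "e (\<theta>\<^sub>1 Y) = T1 (e Y)" by (simp add: T1e)
      also have "\<dots> \<in> O' X" using that mem1 unfolding O'_def by (auto intro: joint_orbit.left)
      finally show ?thesis using mem1 by blast
    qed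
    moreover have "\<theta>\<^sub>2 Y \<in> B' <+> C'" if "Y \<in> B' <+> C'" for Y
    proof -
      have "Y \<in> B <+> C" using that sub by auto
      then have "Inr (\<theta>\<^sub>2 Y) = T2 (Inr Y)" by (simp add: T2r)
      also have "\<dots> \<in> O' X" using that mem2 unfolding O'_def by (auto intro: joint_orbit.right)
      finally show ?thesis using mem2 by blast
    qed
    ultimately show "\<exists>A' B' C'. A' \<subseteq> A \<and> B' \<subseteq> B \<and> C' \<subseteq> C \<and> A' <+> C' = {X, \<theta> X} \<and>
         \<theta>\<^sub>1 ` (A' <+> B') \<subseteq> A' <+> B' \<and> \<theta>\<^sub>2 ` (B' <+> C') \<subseteq> B' <+> C'"
      using sub by (intro exI[of _ A'] exI[of _ B'] exI[of _ C']) blast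
  qed
qed

section \<open>Intersection forms and cobordism relations\<close>

lemma count_list_eq_card: "count_list xs a = card {i. i < length xs \<and> xs ! i = a}"
  unfolding count_list_eq_length_filter length_filter_conv_card
  by (rule arg_cong[where f = card]) auto

lemma nanoword_occ:
  assumes "nanoword \<alpha> w" and "A \<in> letters w"
  shows first_occ_less_last_occ: "first_occ w A < last_occ w A"
    and last_occ_less_length: "last_occ w A < length (word w)"
    and nth_first_occ: "word w ! first_occ w A = A"
    and nth_last_occ: "word w ! last_occ w A = A"
    and nth_eq_iff_occ:
      "p < length (word w) \<Longrightarrow> word w ! p = A \<longleftrightarrow> p = first_occ w A \<or> p = last_occ w A"
proof -
  let ?S = "{i. i < length (word w) \<and> word w ! i = A}"
  have "card ?S = 2"
    using assms by (simp add: nanoword_def flip: count_list_eq_card)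
  then obtain a b where "?S = {a, b}" "a \<noteq> b" by (auto simp: card_2_iff)
  then obtain i j where S: "?S = {i, j}" and ij: "i < j"
    by (metis insert_commute linorder_neqE_nat)
  then have occ: "first_occ w A = i" "last_occ w A = j"
    unfolding first_occ_def last_occ_def S by simp_all
  have "i \<in> ?S" "j \<in> ?S" unfolding S by simp_all
  moreover have "p \<in> ?S \<longleftrightarrow> p = i \<or> p = j" for p unfolding S by simp
  ultimately show "first_occ w A < last_occ w A" "last_occ w A < length (word w)"
    "word w ! first_occ w A = A" "word w ! last_occ w A = A"
    "p < length (word w) \<Longrightarrow> word w ! p = A \<longleftrightarrow> p = first_occ w A \<or> p = last_occ w A"
    using ij unfolding occ by auto
qed

lemma first_occ_less_length:
  "nanoword \<alpha> w \<Longrightarrow> A \<in> letters w \<Longrightarrow> first_occ w A < length (word w)"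
  by (rule less_trans[OF first_occ_less_last_occ last_occ_less_length])

lemma nth_in_letters: "nanoword \<alpha> w \<Longrightarrow> p < length (word w) \<Longrightarrow> word w ! p \<in> letters w"
  unfolding nanoword_def using nth_mem by blast

lemma occ_eqI:
  assumes "nanoword \<alpha> w" and "i < j" and "j < length (word w)"
    and "word w ! i = A" and "word w ! j = A"
  shows "first_occ w A = i" and "last_occ w A = j"
proof -
  have A: "A \<in> letters w" using nth_in_letters[OF assms(1,3)] assms(5) by simp
  show "first_occ w A = i" "last_occ w A = j"
    using nanoword_occ[OF assms(1) A] assms(2-5)
    by (metis less_asym less_irrefl less_trans)+
qed

lemma proj_in: "nanoword \<alpha> w \<Longrightarrow> A \<in> letters w \<Longrightarrow> proj w A \<in> \<alpha>"
  unfolding nanoword_def by blast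

text \<open>Half the difference of two sign functions: each occurrence can then be handled on its
  own, which the reflection argument for bridges exploits. The values 1/2 at the occurrences produce
  the term n(A, B) (|A| + |B|) of the pairing.\<close>

definition loop :: "('l, 'a) nanoword \<Rightarrow> 'l \<Rightarrow> nat \<Rightarrow> rat" where
  "loop w A p =
     (sgn (of_nat p - of_nat (first_occ w A)) - sgn (of_nat p - of_nat (last_occ w A))) / 2"

definition linear_relation :: "((nat \<Rightarrow> rat) \<times> (nat \<Rightarrow> rat)) set \<Rightarrow> bool" where
  "linear_relation L \<longleftrightarrow>
     (\<forall>x y x' y' a b. (x, y) \<in> L \<longrightarrow> (x', y') \<in> L \<longrightarrow>
        (\<lambda>p. a * x p + b * x' p, \<lambda>p. a * y p + b * y' p) \<in> L)"

lemma linear_relationD: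
  "linear_relation L \<Longrightarrow> (x, y) \<in> L \<Longrightarrow> (x', y') \<in> L \<Longrightarrow>
    (\<lambda>p. a * x p + b * x' p, \<lambda>p. a * y p + b * y' p) \<in> L"
  unfolding linear_relation_def by blast

lemma linear_relation_shift:
  assumes "linear_relation L" and "(\<lambda>_. 1, \<lambda>_. 1) \<in> L" and "(x, y) \<in> L"
  shows "(\<lambda>p. x p + a, \<lambda>p. y p + a) \<in> L"
  using linear_relationD[OF assms(1,3,2), of 1 a] by simp

lemma linear_relation_sum:
  assumes "linear_relation L" and "z \<in> L" and "finite I"
    and "\<And>i. i \<in> I \<Longrightarrow> (f i, g i) \<in> L"
  shows "(\<lambda>p. c * (\<Sum>i\<in>I. f i p), \<lambda>p. c * (\<Sum>i\<in>I. g i p)) \<in> L"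
  using assms(3,4)
proof (induction I rule: finite_induct)
  case empty
  \<comment> \<open>The empty set satisfies \<open>linear_relation\<close>, so the zero pair has to
    be made from a given member, as 0 z + 0 z.\<close>
  show ?case
    using linear_relationD[OF assms(1), of "fst z" "snd z" "fst z" "snd z" 0 0] assms(2) by simp
next
  case (insert i I)
  show ?case
    using linear_relationD[OF assms(1) insert.prems insert.IH, of i c 1] insert.hyps insert.prems
    by (simp add: distrib_left)
qed

lemma linear_relation_converse: "linear_relation L \<Longrightarrow> linear_relation (L\<inverse>)"
  unfolding linear_relation_def by simp

lemma linear_relation_comp:
  assumes "linear_relation L" and "linear_relation M"
  shows "linear_relation (L O M)"
  unfolding linear_relation_def
proof (intro allI impI)
  fix x z x' z' :: "nat \<Rightarrow> rat" and a b
  assume "(x, z) \<in> L O M" "(x', z') \<in> L O M"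
  then obtain y y' where "(x, y) \<in> L" "(y, z) \<in> M" "(x', y') \<in> L" "(y', z') \<in> M" by blast
  then show "(\<lambda>p. a * x p + b * x' p, \<lambda>p. a * z p + b * z' p) \<in> L O M"
    using linear_relationD[OF assms(1), of x y x' y' a b]
      linear_relationD[OF assms(2), of y z y' z' a b] by blast
qed

text \<open>The geometric part sees \<phi> only through its values on the generators, taken rational
  so that one can divide by them.\<close>

locale signed_involution =
  fixes \<alpha> :: "'a set" and \<tau> :: "'a \<Rightarrow> 'a" and sg :: "'a \<Rightarrow> rat"
  assumes involution: "involution_on \<alpha> \<tau>"
    and sg_tau: "a \<in> \<alpha> \<Longrightarrow> sg (\<tau> a) = - sg a"
    and sg_nonzero: "a \<in> \<alpha> \<Longrightarrow> sg a \<noteq> 0"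
begin

lemma tau_tau: "a \<in> \<alpha> \<Longrightarrow> \<tau> (\<tau> a) = a"
  using involution by (auto simp: involution_on_def)

text \<open>The set \<open>S\<close> allows a bridge move to treat the removed and the remaining
  letters separately.\<close>

definition omega_on ::
  "('l, 'a) nanoword \<Rightarrow> 'l set \<Rightarrow> (nat \<Rightarrow> rat) \<Rightarrow> (nat \<Rightarrow> rat) \<Rightarrow> rat" where
  "omega_on w S x y =
     (\<Sum>D\<in>S. sg (proj w D) *
        (x (first_occ w D) * y (last_occ w D) - x (last_occ w D) * y (first_occ w D)))"

abbreviation omega :: "('l, 'a) nanoword \<Rightarrow> (nat \<Rightarrow> rat) \<Rightarrow> (nat \<Rightarrow> rat) \<Rightarrow> rat" where
  "omega w \<equiv> omega_on w (letters w)"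

lemma omega_skew: "omega_on w S y x = - omega_on w S x y"
  unfolding omega_on_def sum_negf[symmetric] by (rule sum.cong) (simp_all add: algebra_simps)

lemma omega_linear_left:
  "omega_on w S (\<lambda>p. a * x p + b * x' p) y = a * omega_on w S x y + b * omega_on w S x' y"
  unfolding omega_on_def sum_distrib_left sum.distrib[symmetric]
  by (rule sum.cong) (simp_all add: algebra_simps)

lemma omega_linear_right:
  "omega_on w S y (\<lambda>p. a * x p + b * x' p) = a * omega_on w S y x + b * omega_on w S y x'"
  by (subst (1 2 3) omega_skew) (simp add: omega_linear_left)

lemma omega_sum_left:
  "omega_on w S (\<lambda>p. \<Sum>i\<in>I. t i * f i p) y = (\<Sum>i\<in>I. t i * omega_on w S (f i) y)"
proof (induction I rule: infinite_finite_induct)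
  case (insert i I)
  then show ?case using omega_linear_left[of w S "t i" "f i" 1] by simp
qed (simp_all add: omega_on_def)

lemma omega_sum_right:
  "omega_on w S y (\<lambda>p. \<Sum>i\<in>I. t i * f i p) = (\<Sum>i\<in>I. t i * omega_on w S y (f i))"
  by (subst (1 2) omega_skew) (simp add: omega_sum_left sum_negf)

lemma omega_cong:
  assumes "\<And>D. D \<in> S \<Longrightarrow> x (first_occ w D) = x' (first_occ w D) \<and> x (last_occ w D) = x' (last_occ w D)"
    and "\<And>D. D \<in> S \<Longrightarrow> y (first_occ w D) = y' (first_occ w D) \<and> y (last_occ w D) = y' (last_occ w D)"
  shows "omega_on w S x y = omega_on w S x' y'"
  unfolding omega_on_def using assms by (intro sum.cong) auto

text \<open>The weight makes the two kinds of short vectors alike: since \<open>sg\<close> changes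
  sign under \<tau>, both A + B with |A| = |B| and A - B with |A| = \<tau>(|B|) become, up to a
  scalar, the sum of two signed loops.\<close>

definition signed_loop :: "('l, 'a) nanoword \<Rightarrow> 'l \<Rightarrow> nat \<Rightarrow> rat" where
  "signed_loop w A p = sg (proj w A) * loop w A p"

definition left_loop :: "('l, 'a) nanoword \<Rightarrow> 'l + 'm \<Rightarrow> nat \<Rightarrow> rat" where
  "left_loop w X p = (case X of Inl A \<Rightarrow> signed_loop w A p | Inr _ \<Rightarrow> 0)"

definition right_loop :: "('l, 'a) nanoword \<Rightarrow> 'm + 'l \<Rightarrow> nat \<Rightarrow> rat" where
  "right_loop w X p = (case X of Inl _ \<Rightarrow> 0 | Inr A \<Rightarrow> signed_loop w A p)"

lemma sum_left_loop:
  "finite A \<Longrightarrow> finite B \<Longrightarrow> (\<Sum>X\<in>A <+> B. left_loop w X p) = (\<Sum>D\<in>A. signed_loop w D p)"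
  and sum_right_loop:
  "finite A \<Longrightarrow> finite B \<Longrightarrow> (\<Sum>X\<in>A <+> B. right_loop w X p) = (\<Sum>D\<in>B. signed_loop w D p)"
  by (simp_all add: sum.Plus left_loop_def right_loop_def)

text \<open>As \<tau> is an involution, two distinct letters can be combined to a short vector
  exactly when their classes agree.\<close>

definition tau_class :: "('l, 'a) nanoword \<Rightarrow> 'l \<Rightarrow> 'a set" where
  "tau_class w A = {proj w A, \<tau> (proj w A)}"

text \<open>An orbit with two letters stands for a short vector in these letters. A fixed letter
  contributes twice its loop, still a multiple of the short vector that consists of this letter
  alone.\<close>

definition matching ::
  "('l, 'a) nanoword \<Rightarrow> ('l, 'a) nanoword \<Rightarrow> ((nat \<Rightarrow> rat) \<times> (nat \<Rightarrow> rat)) set \<Rightarrow>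
   ('l + 'l \<Rightarrow> 'l + 'l) \<Rightarrow> bool" where
  "matching w v L \<theta> \<longleftrightarrow>
     (\<forall>X\<in>letters w <+> letters v.
        \<theta> X \<in> letters w <+> letters v \<and> \<theta> (\<theta> X) = X \<and>
        case_sum (tau_class w) (tau_class v) (\<theta> X) = case_sum (tau_class w) (tau_class v) X \<and>
        (\<exists>a b. (\<lambda>p. left_loop w X p + left_loop w (\<theta> X) p + a,
                \<lambda>p. right_loop v X p + right_loop v (\<theta> X) p + b) \<in> L))"

text \<open>
  The linear relation plays the role of the span of a filling.  The constants \<open>a\<close> and \<open>b\<close> in the
  definition of a matching are needed for circular shifts, which replace a loop by its complement.
\<close>

definition cobordant :: "('l, 'a) nanoword \<Rightarrow> ('l, 'a) nanoword \<Rightarrow> nat \<Rightarrow> bool" where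
  "cobordant w v m \<longleftrightarrow>
     (\<exists>\<theta> L. linear_relation L \<and> (\<lambda>_. 1, \<lambda>_. 1) \<in> L \<and> matching w v L \<theta> \<and>
        skew_rank_le m L (\<lambda>X Y. omega w (fst X) (fst Y) - omega v (snd X) (snd Y)))"

text \<open>Adding the members for all X in a set closed under \<open>\<theta>\<close> counts every
  letter twice, once as X and once as the partner of some X. Halving the total treats fixed letters
  and pairs uniformly.\<close>

lemma matching_closed_sum:
  assumes L: "linear_relation L" "(\<lambda>_. 1, \<lambda>_. 1) \<in> L" and \<theta>: "matching w v L \<theta>"
    and AB: "finite A" "finite B" "A \<subseteq> letters w" "B \<subseteq> letters v" "\<theta> ` (A <+> B) \<subseteq> A <+> B"
  shows "\<exists>a b. (\<lambda>p. (\<Sum>D\<in>A. signed_loop w D p) + a, \<lambda>p. (\<Sum>D\<in>B. signed_loop v D p) + b) \<in> L"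
proof -
  let ?S = "A <+> B"
  have S: "X \<in> letters w <+> letters v" if "X \<in> ?S" for X using that AB by auto
  have "\<forall>X\<in>?S. \<exists>a b. (\<lambda>p. left_loop w X p + left_loop w (\<theta> X) p + a,
                \<lambda>p. right_loop v X p + right_loop v (\<theta> X) p + b) \<in> L"
    using \<theta> S unfolding matching_def by blast
  then obtain a b where ab: "\<And>X. X \<in> ?S \<Longrightarrow>
      (\<lambda>p. left_loop w X p + left_loop w (\<theta> X) p + a X,
       \<lambda>p. right_loop v X p + right_loop v (\<theta> X) p + b X) \<in> L"
    by metis
  have fin: "finite ?S" using AB by simp
  have bij: "bij_betw \<theta> ?S ?S"
    by (rule bij_betwI[where g = \<theta>]) (use AB(5) \<theta> S in \<open>auto simp: matching_def\<close>)
  have eq: "1 / 2 * (\<Sum>X\<in>?S. f X + f (\<theta> X) + c X) = (\<Sum>X\<in>?S. f X) + (\<Sum>X\<in>?S. c X) / 2"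
    for f c :: "'b + 'b \<Rightarrow> rat"
    using sum.reindex_bij_betw[OF bij, of f] by (simp add: sum.distrib)
  have "(\<lambda>p. 1 / 2 * (\<Sum>X\<in>?S. left_loop w X p + left_loop w (\<theta> X) p + a X),
         \<lambda>p. 1 / 2 * (\<Sum>X\<in>?S. right_loop v X p + right_loop v (\<theta> X) p + b X)) \<in> L"
    by (rule linear_relation_sum[OF L fin ab])
  moreover have "1 / 2 * (\<Sum>X\<in>?S. left_loop w X p + left_loop w (\<theta> X) p + a X) =
      (\<Sum>D\<in>A. signed_loop w D p) + (\<Sum>X\<in>?S. a X) / 2" for p
    using eq[of "\<lambda>X. left_loop w X p" a] sum_left_loop[OF AB(1,2), of w p] by simp
  moreover have "1 / 2 * (\<Sum>X\<in>?S. right_loop v X p + right_loop v (\<theta> X) p + b X) =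
      (\<Sum>D\<in>B. signed_loop v D p) + (\<Sum>X\<in>?S. b X) / 2" for p
    using eq[of "\<lambda>X. right_loop v X p" b] sum_right_loop[OF AB(1,2), of v p] by simp
  ultimately show ?thesis
    by (intro exI[of _ "(\<Sum>X\<in>?S. a X) / 2"] exI[of _ "(\<Sum>X\<in>?S. b X) / 2"]) (simp only:)
qed

section \<open>Symmetry and transitivity of cobordance\<close>

lemma cobordant_sym:
  assumes "cobordant w v m"
  shows "cobordant v w m"
proof -
  obtain \<theta> L where L: "linear_relation L" "(\<lambda>_. 1, \<lambda>_. 1) \<in> L" and \<theta>: "matching w v L \<theta>"
    and F: "skew_rank_le m L (\<lambda>X Y. omega w (fst X) (fst Y) - omega v (snd X) (snd Y))"
    using assms unfolding cobordant_def by blast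
  let ?s = "case_sum Inr Inl :: 'b + 'b \<Rightarrow> 'b + 'b"
  have "matching v w (L\<inverse>) (?s \<circ> \<theta> \<circ> ?s)"
    unfolding matching_def
  proof
    fix X assume X: "X \<in> letters v <+> letters w"
    then have sX: "?s X \<in> letters w <+> letters v" by auto
    have ss: "?s (?s Y) = Y" for Y by (cases Y) auto
    have cls: "case_sum f g (?s Y) = case_sum g f Y" for f g :: "'b \<Rightarrow> 'c" and Y by (cases Y) auto
    have Ps: "?s Y \<in> letters v <+> letters w" if "Y \<in> letters w <+> letters v" for Y
      using that by auto
    have lr: "left_loop u (?s Y) = right_loop u Y" "right_loop u (?s Y) = left_loop u Y"
      for u :: "('b, 'a) nanoword" and Y
      by (auto simp: left_loop_def right_loop_def split: sum.splits)
    obtain a b where "\<theta> (?s X) \<in> letters w <+> letters v" "\<theta> (\<theta> (?s X)) = ?s X"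
      "case_sum (tau_class w) (tau_class v) (\<theta> (?s X)) = case_sum (tau_class w) (tau_class v) (?s X)"
      "(\<lambda>p. left_loop w (?s X) p + left_loop w (\<theta> (?s X)) p + a,
        \<lambda>p. right_loop v (?s X) p + right_loop v (\<theta> (?s X)) p + b) \<in> L"
      using bspec[OF \<theta>[unfolded matching_def] sX] by (elim conjE exE) (rule that; assumption)
    then show "(?s \<circ> \<theta> \<circ> ?s) X \<in> letters v <+> letters w \<and>
      (?s \<circ> \<theta> \<circ> ?s) ((?s \<circ> \<theta> \<circ> ?s) X) = X \<and>
      case_sum (tau_class v) (tau_class w) ((?s \<circ> \<theta> \<circ> ?s) X) =
          case_sum (tau_class v) (tau_class w) X \<and>
      (\<exists>a b. (\<lambda>p. left_loop v X p + left_loop v ((?s \<circ> \<theta> \<circ> ?s) X) p + a,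
              \<lambda>p. right_loop w X p + right_loop w ((?s \<circ> \<theta> \<circ> ?s) X) p + b) \<in> L\<inverse>)"
      unfolding o_apply lr cls ss by (intro conjI Ps) (auto simp: ss)
  qed
  moreover have "skew_rank_le m (L\<inverse>) (\<lambda>X Y. omega v (fst X) (fst Y) - omega w (snd X) (snd Y))"
    by (rule skew_rank_le_pullback[OF skew_rank_le_uminus[OF F], where h = prod.swap]) auto
  ultimately show ?thesis
    unfolding cobordant_def using L linear_relation_converse[OF L(1)] by blast
qed

text \<open>On an orbit closed under both matchings, L and M both contain a pair whose middle
  function is the sum of the loops of u in this orbit, but with different constants b and b'. As the
  pair of constants (1, 1) belongs to L, the member of L can be shifted by b' - b; then the middle
  functions coincide.\<close>

lemma cobordant_trans:
  assumes words: "nanoword \<alpha> w" "nanoword \<alpha> u" "nanoword \<alpha> v"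
    and "cobordant w u m" and "cobordant u v n"
  shows "cobordant w v (m + n)"
proof -
  obtain \<theta>\<^sub>1 L where L: "linear_relation L" "(\<lambda>_. 1, \<lambda>_. 1) \<in> L" and \<theta>1: "matching w u L \<theta>\<^sub>1"
    and F: "skew_rank_le m L (\<lambda>X Y. omega w (fst X) (fst Y) - omega u (snd X) (snd Y))"
    using assms(4) unfolding cobordant_def by blast
  obtain \<theta>\<^sub>2 M where M: "linear_relation M" "(\<lambda>_. 1, \<lambda>_. 1) \<in> M" and \<theta>2: "matching u v M \<theta>\<^sub>2"
    and G: "skew_rank_le n M (\<lambda>X Y. omega u (fst X) (fst Y) - omega v (snd X) (snd Y))"
    using assms(5) unfolding cobordant_def by blast
  note fin = words[THEN finite_letters]
  have \<theta>1': "\<theta>\<^sub>1 X \<in> letters w <+> letters u \<and> \<theta>\<^sub>1 (\<theta>\<^sub>1 X) = X \<and>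
      case_sum (tau_class w) (tau_class u) (\<theta>\<^sub>1 X) = case_sum (tau_class w) (tau_class u) X"
    if "X \<in> letters w <+> letters u" for X
    using bspec[OF \<theta>1[unfolded matching_def] that] by (elim conjE) (intro conjI)
  have \<theta>2': "\<theta>\<^sub>2 X \<in> letters u <+> letters v \<and> \<theta>\<^sub>2 (\<theta>\<^sub>2 X) = X \<and>
      case_sum (tau_class u) (tau_class v) (\<theta>\<^sub>2 X) = case_sum (tau_class u) (tau_class v) X"
    if "X \<in> letters u <+> letters v" for X
    using bspec[OF \<theta>2[unfolded matching_def] that] by (elim conjE) (intro conjI)
  obtain \<theta> where \<theta>: "\<forall>X\<in>letters w <+> letters v.
      \<theta> X \<in> letters w <+> letters v \<and> \<theta> (\<theta> X) = X \<and>
      case_sum (tau_class w) (tau_class v) (\<theta> X) = case_sum (tau_class w) (tau_class v) X \<and>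
      (\<exists>A' B' C'. A' \<subseteq> letters w \<and> B' \<subseteq> letters u \<and> C' \<subseteq> letters v \<and> A' <+> C' = {X, \<theta> X} \<and>
         \<theta>\<^sub>1 ` (A' <+> B') \<subseteq> A' <+> B' \<and> \<theta>\<^sub>2 ` (B' <+> C') \<subseteq> B' <+> C')"
    using compose_matchings[OF fin \<theta>1' \<theta>2'] ..
  have "\<exists>a b. (\<lambda>p. left_loop w X p + left_loop w (\<theta> X) p + a,
               \<lambda>p. right_loop v X p + right_loop v (\<theta> X) p + b) \<in> L O M"
    if X: "X \<in> letters w <+> letters v" for X
  proof -
    obtain A B C where sub: "A \<subseteq> letters w" "B \<subseteq> letters u" "C \<subseteq> letters v"
      and AC: "A <+> C = {X, \<theta> X}"
      and cl: "\<theta>\<^sub>1 ` (A <+> B) \<subseteq> A <+> B" "\<theta>\<^sub>2 ` (B <+> C) \<subseteq> B <+> C"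
      using bspec[OF \<theta> X] by (elim conjE exE) (rule that; assumption)
    have f: "finite A" "finite B" "finite C"
      using sub fin finite_subset by blast+
    obtain a b where ab: "(\<lambda>p. (\<Sum>D\<in>A. signed_loop w D p) + a, \<lambda>p. (\<Sum>D\<in>B. signed_loop u D p) + b) \<in> L"
      using matching_closed_sum[OF L \<theta>1 f(1,2) sub(1,2) cl(1)] by blast
    obtain b' c where bc: "(\<lambda>p. (\<Sum>D\<in>B. signed_loop u D p) + b', \<lambda>p. (\<Sum>D\<in>C. signed_loop v D p) +
        c) \<in> M"
      using matching_closed_sum[OF M \<theta>2 f(2,3) sub(2,3) cl(2)] by blast
    \<comment> \<open>The orbit sum counts a fixed X once, whereas a matching asks for X plus its
      partner, here twice X.\<close>
    let ?k = "if X = \<theta> X then 2 else 1 :: rat"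
    have k: "?k * (\<Sum>Y\<in>A <+> C. g Y) = g X + g (\<theta> X)" for g :: "'b + 'b \<Rightarrow> rat"
      unfolding AC by simp
    have "(\<lambda>p. (\<Sum>D\<in>B. signed_loop u D p) + b + (b' - b), \<lambda>p. (\<Sum>D\<in>C. signed_loop v D p) + c) \<in> M"
      using bc by simp
    moreover have "(\<lambda>p. (\<Sum>D\<in>A. signed_loop w D p) + a + (b' - b),
        \<lambda>p. (\<Sum>D\<in>B. signed_loop u D p) + b + (b' - b)) \<in> L"
      by (rule linear_relation_shift[OF L ab])
    ultimately have "(\<lambda>p. (\<Sum>D\<in>A. signed_loop w D p) + a + (b' - b), \<lambda>p. (\<Sum>D\<in>C. signed_loop v D p) +
        c) \<in> L O M"
      by blast
    from linear_relationD[OF linear_relation_comp[OF L(1) M(1)] this this, of ?k 0]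
    have "(\<lambda>p. ?k * (\<Sum>D\<in>A. signed_loop w D p) + ?k * (a + (b' -
        b)), \<lambda>p. ?k * (\<Sum>D\<in>C. signed_loop v D p) + ?k * c) \<in> L O M"
      by (simp only: mult_zero_left add_0_right distrib_left add.assoc)
    then show ?thesis
      unfolding sum_left_loop[OF f(1,3), symmetric] sum_right_loop[OF f(1,3), symmetric] k by blast
  qed
  note loops = this
  have match: "matching w v (L O M) \<theta>"
    unfolding matching_def
  proof
    fix X assume X: "X \<in> letters w <+> letters v"
    show "\<theta> X \<in> letters w <+> letters v \<and> \<theta> (\<theta> X) = X \<and>
        case_sum (tau_class w) (tau_class v) (\<theta> X) = case_sum (tau_class w) (tau_class v) X \<and>
        (\<exists>a b. (\<lambda>p. left_loop w X p + left_loop w (\<theta> X) p + a,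
                \<lambda>p. right_loop v X p + right_loop v (\<theta> X) p + b) \<in> L O M)"
      using bspec[OF \<theta> X] loops[OF X] by (elim conjE) (intro conjI; assumption)
  qed
  \<comment> \<open>The difference of the forms of w and v is split at a middle function, which is
    merely chosen and need not depend linearly on X.\<close>
  have "\<forall>X\<in>L O M. \<exists>y. (fst X, y) \<in> L \<and> (y, snd X) \<in> M" by auto
  then obtain mid where mid: "\<And>X. X \<in> L O M \<Longrightarrow> (fst X, mid X) \<in> L \<and> (mid X, snd X) \<in> M" by metis
  have "skew_rank_le m (L O M) (\<lambda>X Y. omega w (fst X) (fst Y) - omega u (mid X) (mid Y))"
    by (rule skew_rank_le_pullback[OF F, where h = "\<lambda>X. (fst X, mid X)"]) (use mid in auto)
  moreover have "skew_rank_le n (L O M) (\<lambda>X Y. omega u (mid X) (mid Y) - omega v (snd X) (snd Y))"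
    by (rule skew_rank_le_pullback[OF G, where h = "\<lambda>X. (mid X, snd X)"]) (use mid in auto)
  ultimately have "skew_rank_le (m + n) (L O M) (\<lambda>X Y. omega w (fst X) (fst Y) -
      omega v (snd X) (snd Y))"
    using skew_rank_le_add by fastforce
  then show ?thesis
    unfolding cobordant_def using match linear_relation_comp[OF L(1) M(1)] L(2) M(2) by blast
qed

text \<open>The shape of a single move: the letters in B disappear and are paired among themselves
  by \<open>\<iota>\<close>, while every surviving letter is paired with its counterpart in the
  other word. For all moves other than bridges B is empty.\<close>

lemma cobordantI:
  assumes B: "B \<subseteq> letters w"
    and \<iota>: "\<And>A. A \<in> B \<Longrightarrow> \<iota> A \<in> B \<and> \<iota> (\<iota> A) = A \<and> tau_class w (\<iota> A) = tau_class w A"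
    and f: "bij_betw f (letters w - B) (letters v)"
    and f_class: "\<And>A. A \<in> letters w - B \<Longrightarrow> tau_class v (f A) = tau_class w A"
    and L: "linear_relation L" "(\<lambda>_. 1, \<lambda>_. 1) \<in> L"
    and f_loop: "\<And>A. A \<in> letters w - B \<Longrightarrow>
        \<exists>a b. (\<lambda>p. signed_loop w A p + a, \<lambda>p. signed_loop v (f A) p + b) \<in> L"
    and \<iota>_loop: "\<And>A. A \<in> B \<Longrightarrow> \<exists>a b. (\<lambda>p. signed_loop w A p + signed_loop w (\<iota> A) p + a, \<lambda>_. b) \<in> L"
    and F: "skew_rank_le m L (\<lambda>X Y. omega w (fst X) (fst Y) - omega v (snd X) (snd Y))"
  shows "cobordant w v m"
proof -
  define g where "g = the_inv_into (letters w - B) f"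
  define \<theta> :: "'b + 'b \<Rightarrow> 'b + 'b" where
    "\<theta> X = (case X of Inl A \<Rightarrow> if A \<in> B then Inl (\<iota> A) else Inr (f A) | Inr A \<Rightarrow> Inl (g A))" for X
  have g: "g A \<in> letters w - B" "f (g A) = A" if "A \<in> letters v" for A
    unfolding g_def using f that f_the_inv_into_f_bij_betw[OF f]
    by (auto simp: bij_betw_def dest: the_inv_into_into[of f "letters w - B" A "letters w - B"])
  have gf: "g (f A) = A" if "A \<in> letters w - B" for A
    unfolding g_def using f that by (simp add: bij_betw_def the_inv_into_f_f)
  have fA: "f A \<in> letters v" if "A \<in> letters w - B" for A
    using f that by (auto simp: bij_betw_def)
  have "matching w v L \<theta>"
    unfolding matching_def
  proof
    fix X assume X: "X \<in> letters w <+> letters v"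
    consider (b) A where "X = Inl A" "A \<in> B" | (l) A where "X = Inl A" "A \<in> letters w - B"
      | (r) A where "X = Inr A" "A \<in> letters v" using X by blast
    then show "\<theta> X \<in> letters w <+> letters v \<and> \<theta> (\<theta> X) = X \<and>
        case_sum (tau_class w) (tau_class v) (\<theta> X) = case_sum (tau_class w) (tau_class v) X \<and>
        (\<exists>a b. (\<lambda>p. left_loop w X p + left_loop w (\<theta> X) p + a,
                \<lambda>p. right_loop v X p + right_loop v (\<theta> X) p + b) \<in> L)"
    proof cases
      case b
      then show ?thesis using \<iota>[OF b(2)] \<iota>_loop[OF b(2)] B
        by (auto simp: \<theta>_def left_loop_def right_loop_def)
    next
      case l
      then show ?thesis using f_loop[OF l(2)] f_class[OF l(2)] gf[OF l(2)] fA[OF l(2)]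
        by (auto simp: \<theta>_def left_loop_def right_loop_def)
    next
      case r
      then show ?thesis using f_loop[OF g(1)[OF r(2)]] f_class[OF g(1)[OF r(2)]] g[OF r(2)]
        by (auto simp: \<theta>_def left_loop_def right_loop_def)
    qed
  qed
  then show ?thesis unfolding cobordant_def using L F by blast
qed

end

section \<open>Isomorphisms, shifts and the third homotopy move\<close>

lemma loop_eq:
  assumes "first_occ w A < last_occ w A"
  shows "loop w A p =
    (if p < first_occ w A then 0 else if p = first_occ w A then 1 / 2
     else if p < last_occ w A then 1 else if p = last_occ w A then 1 / 2 else 0)"
  using assms by (auto simp: loop_def sgn_if)

text \<open>A loop changes only at and next to its own occurrences. In the third homotopy move this
  is applied to the letters that do not take part in it.\<close>

lemma loop_Suc:
  assumes lt: "first_occ w A < last_occ w A"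
    and "first_occ w A \<noteq> p" "first_occ w A \<noteq> Suc p" "last_occ w A \<noteq> p" "last_occ w A \<noteq> Suc p"
  shows "loop w A (Suc p) = loop w A p"
proof -
  have "Suc p < first_occ w A \<longleftrightarrow> p < first_occ w A" "Suc p < last_occ w A \<longleftrightarrow> p < last_occ w A"
    using assms by auto
  then show ?thesis using assms by (simp add: loop_eq)
qed

context signed_involution
begin

text \<open>Renaming letters moves no position, so the identity relation on functions does the
  job.\<close>

lemma cobordant_isomorphism:
  assumes w: "nanoword \<alpha> w" and w': "nanoword \<alpha> w'" and "isomorphism_move w w'"
  shows "cobordant w w' 0"
proof -
  obtain f where f: "bij_betw f (letters w) (letters w')"
    and pr: "\<And>A. A \<in> letters w \<Longrightarrow> proj w' (f A) = proj w A"
    and word: "word w' = map f (word w)"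
    using assms(3) unfolding isomorphism_move_def by blast
  have occ: "first_occ w' (f A) = first_occ w A" "last_occ w' (f A) = last_occ w A"
    if "A \<in> letters w" for A
    using occ_eqI[OF w' first_occ_less_last_occ[OF w that], of "f A"] nanoword_occ[OF w that]
      first_occ_less_length[OF w that]
    by (simp_all add: word)
  have sl: "signed_loop w' (f A) = signed_loop w A" if "A \<in> letters w" for A
    using occ[OF that] pr[OF that] by (simp add: signed_loop_def loop_def fun_eq_iff)
  show ?thesis
  proof (rule cobordantI[where B = "{}" and f = f and L = Id])
    show "skew_rank_le 0 Id (\<lambda>X Y. omega w (fst X) (fst Y) - omega w' (snd X) (snd Y))"
    proof (rule skew_rank_le_0)
      fix X Y :: "(nat \<Rightarrow> rat) \<times> (nat \<Rightarrow> rat)" assume XY: "X \<in> Id" "Y \<in> Id"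
      show "omega w (fst X) (fst Y) - omega w' (snd X) (snd Y) = 0"
        using XY unfolding omega_on_def sum.reindex_bij_betw[OF f, symmetric]
        by (auto simp: occ pr)
    qed
    show "linear_relation Id" by (simp add: linear_relation_def)
  qed (use f sl pr in \<open>auto simp: tau_class_def\<close>)
qed

text \<open>The shift rotates the positions by one. The first occurrence of A becomes the last one
  of A', which reverses the sign of its summand; the projection \<tau>(|A|) reverses it back. The
  span between the two occurrences is replaced by its complement.\<close>

lemma cobordant_shift:
  assumes w: "nanoword \<alpha> w" and w': "nanoword \<alpha> w'" and "circular_shift \<tau> w w'"
  shows "cobordant w w' 0"
proof -
  obtain x y A A' where word_w: "word w = [A] @ x @ [A] @ y" and A': "A' \<notin> letters w"
    and w'_def: "w' = \<lparr>letters = insert A' (letters w - {A}),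
              proj = (restrict (proj w) (letters w - {A}))(A' := \<tau> (proj w A)),
              word = x @ [A'] @ y @ [A']\<rparr>"
    using assms(3) unfolding circular_shift_def by blast
  have A: "A \<in> letters w" using nth_in_letters[OF w, of 0] word_w by simp
  have "count_list (word w) A = 2" using w A by (simp add: nanoword_def)
  then have Axy: "A \<notin> set x" "A \<notin> set y" by (auto simp: word_w count_list_0_iff)
  define n where "n = length (word w)"
  define f where "f D = (if D = A then A' else D)" for D
  have n': "length (word w') = n" by (simp add: w'_def n_def word_w)
  have map: "word w' = map f (tl (word w)) @ [A']"
    using Axy by (auto simp: w'_def word_w f_def intro!: map_idI[symmetric])
  have nth: "word w' ! p = f (word w ! Suc p)" if "Suc p < n" for p
  proof -
    have "p < length (tl (word w))" using that by (simp add: n_def)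
    then show ?thesis by (simp add: map nth_append nth_tl)
  qed
  have nth_last: "word w' ! (n - 1) = A'"
    unfolding map by (simp add: nth_append n_def)
  have n0: "n > 0" by (simp add: n_def word_w)
  have fD: "f D = D" "f D \<noteq> A'" if "D \<in> letters w - {A}" for D
    using that A' by (auto simp: f_def)
  have occ: "first_occ w D = Suc (first_occ w' D)" "last_occ w D = Suc (last_occ w' D)"
    "Suc (last_occ w' D) < n" "first_occ w' D < last_occ w' D"
    if D: "D \<in> letters w - {A}" for D
  proof -
    have Dw: "D \<in> letters w" using D by simp
    note o = nanoword_occ[OF w Dw]
    have "first_occ w D \<noteq> 0" using o(3) D by (metis DiffE append_Cons nth_Cons_0 singletonI word_w)
    then obtain i where i: "first_occ w D = Suc i" by (cases "first_occ w D") auto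
    then obtain j where j: "last_occ w D = Suc j" using o(1) by (cases "last_occ w D") auto
    have ij: "i < j" "Suc j < n" using o(1,2) i j by (simp_all add: n_def)
    have "word w' ! i = D" "word w' ! j = D"
      using nth[of i] nth[of j] ij o(3,4) i j fD(1)[OF D] by simp_all
    then have "first_occ w' D = i" "last_occ w' D = j"
      using occ_eqI[OF w' ij(1)] ij(2) n' by simp_all
    then show "first_occ w D = Suc (first_occ w' D)" "last_occ w D = Suc (last_occ w' D)"
      "Suc (last_occ w' D) < n" "first_occ w' D < last_occ w' D"
      using i j ij by simp_all
  qed
  define k where "k = last_occ w A - 1"
  have A0: "first_occ w A = 0"
  proof -
    have "word w ! 0 = A" by (simp add: word_w)
    then show ?thesis using nth_eq_iff_occ[OF w A, of 0] first_occ_less_last_occ[OF w A] n0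
      by (auto simp: n_def)
  qed
  have k: "last_occ w A = Suc k" "Suc k < n"
    using first_occ_less_last_occ[OF w A] last_occ_less_length[OF w A] by (auto simp: k_def n_def)
  have "word w' ! k = A'" using nth[OF k(2)] nth_last_occ[OF w A] by (simp add: k f_def)
  then have occ_A': "first_occ w' A' = k" "last_occ w' A' = n - 1"
    using occ_eqI[OF w', of k "n - 1" A'] k n' nth_last by auto
  have pr: "proj w' D = proj w D" if "D \<in> letters w - {A}" for D
    using that A' by (auto simp: w'_def)
  have pr_A': "proj w' A' = \<tau> (proj w A)" by (simp add: w'_def)
  have sg_A: "sg (proj w' A') = - sg (proj w A)"
    unfolding pr_A' by (rule sg_tau[OF proj_in[OF w A]])
  define L :: "((nat \<Rightarrow> rat) \<times> (nat \<Rightarrow> rat)) set" where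
    "L = {(u, u'). (\<forall>p. Suc p < n \<longrightarrow> u' p = u (Suc p)) \<and> u' (n - 1) = u 0}"
  have bij: "bij_betw f (letters w) (letters w')"
    using A' A by (auto simp: bij_betw_def inj_on_def f_def w'_def)
  show ?thesis
  proof (rule cobordantI[where B = "{}" and f = f and L = L])
    show "skew_rank_le 0 L (\<lambda>X Y. omega w (fst X) (fst Y) - omega w' (snd X) (snd Y))"
    proof (rule skew_rank_le_0)
      fix X Y assume XY: "X \<in> L" "Y \<in> L"
      have "omega w' (snd X) (snd Y) = omega w (fst X) (fst Y)"
        unfolding omega_on_def sum.reindex_bij_betw[OF bij, symmetric]
      proof (rule sum.cong)
        fix D assume D: "D \<in> letters w"
        have X: "snd X p = fst X (Suc p)" "snd X (n - 1) = fst X 0"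
          and Y: "snd Y p = fst Y (Suc p)" "snd Y (n - 1) = fst Y 0" if "Suc p < n" for p
          using XY that by (auto simp: L_def)
        show "sg (proj w' (f D)) * (snd X (first_occ w' (f D)) * snd Y (last_occ w' (f D)) -
            snd X (last_occ w' (f D)) * snd Y (first_occ w' (f D))) =
          sg (proj w D) * (fst X (first_occ w D) * fst Y (last_occ w D) -
            fst X (last_occ w D) * fst Y (first_occ w D))"
        proof (cases "D = A")
          case True
          then show ?thesis using k X[OF k(2)] Y[OF k(2)]
            by (simp add: f_def occ_A' A0 sg_A algebra_simps)
        next
          case False
          then have D': "D \<in> letters w - {A}" using D by simp
          have lt: "Suc (first_occ w' D) < n" using occ(3,4)[OF D'] by simp
          show ?thesis
            using X(1)[OF lt] Y(1)[OF lt] X(1)[OF occ(3)[OF D']] Y(1)[OF occ(3)[OF D']]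
            by (simp add: fD(1)[OF D'] occ(1,2)[OF D'] pr[OF D'])
        qed
      qed simp
      then show "omega w (fst X) (fst Y) - omega w' (snd X) (snd Y) = 0" by simp
    qed
    show "linear_relation L" by (auto simp: linear_relation_def L_def)
    show "(\<lambda>_. 1, \<lambda>_. 1) \<in> L" by (simp add: L_def)
    fix D assume "D \<in> letters w - {}"
    then have D: "D \<in> letters w" by simp
    show "tau_class w' (f D) = tau_class w D"
    proof (cases "D = A")
      case True
      then show ?thesis using tau_tau[OF proj_in[OF w A]]
        by (auto simp: f_def tau_class_def pr_A')
    qed (use D fD(1) pr in \<open>auto simp: tau_class_def\<close>)
    show "\<exists>a b. (\<lambda>p. signed_loop w D p + a, \<lambda>p. signed_loop w' (f D) p + b) \<in> L"
    proof (cases "D = A")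
      case True
      \<comment> \<open>After rotation the loop of A is 1 minus the loop of A'; with the opposite
        weight of A', the constant that remains is the weight of A.\<close>
      have "(\<lambda>p. signed_loop w A p + 0, \<lambda>p. signed_loop w' A' p + sg (proj w A)) \<in> L"
        using k n0 by (auto simp: L_def signed_loop_def sg_A loop_eq occ_A' A0)
      then show ?thesis unfolding True f_def if_P[OF refl] by blast
    next
      case False
      then have D': "D \<in> letters w - {A}" using D by simp
      have "(\<lambda>p. signed_loop w D p + 0, \<lambda>p. signed_loop w' D p + 0) \<in> L"
        using occ[OF D'] n0 by (auto simp: L_def signed_loop_def pr[OF D'] loop_eq)
      then show ?thesis using fD(1)[OF D'] by metis
    qed
  qed (use bij in auto)
qed

text \<open>A function in the relation crosses each of the three pairs of positions by two jumps,
  the jumps of one letter being opposite, and takes the mean value at each jump. The move performs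
  the same two jumps in the other order, so nothing changes outside the pairs.\<close>

lemma cobordant_homotopy3:
  assumes w: "nanoword \<alpha> w" and w': "nanoword \<alpha> w'" and "homotopy_move3 w w'"
  shows "cobordant w w' 0"
proof -
  obtain x y z t A B C where dist: "distinct [A, B, C]"
    and prABC: "proj w A = proj w B" "proj w B = proj w C"
    and word_w: "word w = x @ [A, B] @ y @ [A, C] @ z @ [B, C] @ t"
    and w'_def: "w' = w\<lparr>word := x @ [B, A] @ y @ [C, A] @ z @ [C, B] @ t\<rparr>"
    using assms(3) unfolding homotopy_move3_def by blast
  define p where "p = length x"
  define q where "q = length x + 2 + length y"
  define r where "r = length x + 2 + length y + 2 + length z"
  define n where "n = length (word w)"
  have pqr: "Suc p < q" "Suc q < r" "Suc r < n"
    by (simp_all add: p_def q_def r_def n_def word_w)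
  have n': "length (word w') = n" by (simp add: n_def w'_def word_w)
  have letters: "letters w' = letters w" and pr: "proj w' = proj w" by (simp_all add: w'_def)
  let ?P = "{p, Suc p, q, Suc q, r, Suc r}"
  have nth_w: "word w ! p = A" "word w ! Suc p = B" "word w ! q = A" "word w ! Suc q = C"
    "word w ! r = B" "word w ! Suc r = C"
    by (auto simp: word_w p_def q_def r_def nth_append)
  have nth_w': "word w' ! p = B" "word w' ! Suc p = A" "word w' ! q = C" "word w' ! Suc q = A"
    "word w' ! r = C" "word w' ! Suc r = B"
    by (auto simp: w'_def p_def q_def r_def nth_append)
  have nth_eq: "word w' ! i = word w ! i" if "i \<notin> ?P" for i
    using that by (auto simp: w'_def word_w p_def q_def r_def nth_append nth_Cons split: nat.splits)
  have ABC: "A \<in> letters w" "B \<in> letters w" "C \<in> letters w"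
    using nth_in_letters[OF w] nth_w pqr unfolding n_def by (metis Suc_lessD less_trans)+
  have lt: "p < q" "q < length (word w)" "Suc p < r" "r < length (word w)"
    "Suc q < Suc r" "Suc r < length (word w)"
    using pqr unfolding n_def by linarith+
  have occ: "first_occ w A = p" "last_occ w A = q" "first_occ w B = Suc p" "last_occ w B = r"
    "first_occ w C = Suc q" "last_occ w C = Suc r"
    using occ_eqI[OF w lt(1,2) nth_w(1,3)] occ_eqI[OF w lt(3,4) nth_w(2,5)]
      occ_eqI[OF w lt(5,6) nth_w(4,6)] by simp_all
  have occ': "first_occ w' A = Suc p" "last_occ w' A = Suc q" "first_occ w' B = p" "last_occ w' B =
      Suc r"
    "first_occ w' C = q" "last_occ w' C = r"
    using occ_eqI[OF w' _ _ nth_w'(2,4)] occ_eqI[OF w' _ _ nth_w'(1,6)]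
      occ_eqI[OF w' _ _ nth_w'(3,5)] pqr n' by simp_all
  let ?O = "letters w - {A, B, C}"
  have other: "first_occ w D \<notin> ?P" "last_occ w D \<notin> ?P"
    "first_occ w' D = first_occ w D" "last_occ w' D = last_occ w D" if D: "D \<in> ?O" for D
  proof -
    have Dw: "D \<in> letters w" using D by simp
    note o = nanoword_occ[OF w Dw]
    show P: "first_occ w D \<notin> ?P" "last_occ w D \<notin> ?P" using D o(3,4) nth_w by auto
    show "first_occ w' D = first_occ w D" "last_occ w' D = last_occ w D"
      using occ_eqI[OF w' o(1), of D] o(2-4) n' n_def nth_eq[OF P(1)] nth_eq[OF P(2)] by simp_all
  qed
  txt \<open>
    Here \<open>e\<close>, \<open>h\<close>, \<open>k\<close> are the values just before the three pairs of positions, and \<open>a\<close>, \<open>b\<close>, \<open>c\<close> the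
    jumps at the first occurrences of \<open>A\<close>, \<open>B\<close>, \<open>C\<close> (with the opposite jumps at the last ones).
  \<close>
  define L :: "((nat \<Rightarrow> rat) \<times> (nat \<Rightarrow> rat)) set" where
    "L = {(u, u'). (\<forall>i. i \<notin> ?P \<longrightarrow> u' i = u i) \<and>
       (\<exists>e h k a b c.
          u p = e + a / 2 \<and> u (Suc p) = e + a + b / 2 \<and>
          u q = h - a / 2 \<and> u (Suc q) = h - a + c / 2 \<and>
          u r = k - b / 2 \<and> u (Suc r) = k - b - c / 2 \<and>
          u' p = e + b / 2 \<and> u' (Suc p) = e + b + a / 2 \<and>
          u' q = h + c / 2 \<and> u' (Suc q) = h + c - a / 2 \<and>
          u' r = k - c / 2 \<and> u' (Suc r) = k - c - b / 2)}"
  have LI: "(u, u') \<in> L" if "\<And>i. i \<notin> ?P \<Longrightarrow> u' i = u i"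
    "u p = e + a / 2" "u (Suc p) = e + a + b / 2"
    "u q = h - a / 2" "u (Suc q) = h - a + c / 2"
    "u r = k - b / 2" "u (Suc r) = k - b - c / 2"
    "u' p = e + b / 2" "u' (Suc p) = e + b + a / 2"
    "u' q = h + c / 2" "u' (Suc q) = h + c - a / 2"
    "u' r = k - c / 2" "u' (Suc r) = k - c - b / 2" for u u' e h k a b c
    unfolding L_def using that by blast
  have LE: "\<exists>e h k a b c.
          u p = e + a / 2 \<and> u (Suc p) = e + a + b / 2 \<and>
          u q = h - a / 2 \<and> u (Suc q) = h - a + c / 2 \<and>
          u r = k - b / 2 \<and> u (Suc r) = k - b - c / 2 \<and>
          u' p = e + b / 2 \<and> u' (Suc p) = e + b + a / 2 \<and>
          u' q = h + c / 2 \<and> u' (Suc q) = h + c - a / 2 \<and>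
          u' r = k - c / 2 \<and> u' (Suc r) = k - c - b / 2"
    and LP: "i \<notin> ?P \<Longrightarrow> u' i = u i" if "(u, u') \<in> L" for u u' i
    using that unfolding L_def by blast+
  show ?thesis
  proof (rule cobordantI[where B = "{}" and f = id and L = L])
    show "skew_rank_le 0 L (\<lambda>X Y. omega w (fst X) (fst Y) - omega w' (snd X) (snd Y))"
    proof (rule skew_rank_le_0)
      fix X Y assume XY: "X \<in> L" "Y \<in> L"
      obtain u u' v v' where X: "X = (u, u')" and Y: "Y = (v, v')" by (cases X, cases Y)
      have uv: "(u, u') \<in> L" "(v, v') \<in> L" using XY X Y by simp_all
      have split: "sum f (letters w) = f A + f B + f C + sum f ?O" for f :: "'b \<Rightarrow> rat"
      proof -
        have "sum f (letters w) = sum f {A, B, C} + sum f ?O"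
          using sum.subset_diff[of "{A, B, C}" "letters w" f] ABC finite_letters[OF w]
          by (simp add: add.commute)
        then show ?thesis using dist by (simp add: add.assoc)
      qed
      have O: "omega_on w ?O u v = omega_on w' ?O u' v'"
        unfolding omega_on_def
      proof (rule sum.cong[OF refl])
        fix D assume D: "D \<in> ?O"
        show "sg (proj w D) * (u (first_occ w D) * v (last_occ w D) -
            u (last_occ w D) * v (first_occ w D)) =
          sg (proj w' D) * (u' (first_occ w' D) * v' (last_occ w' D) -
              u' (last_occ w' D) * v' (first_occ w' D))"
          unfolding other(3,4)[OF D] pr LP[OF uv(1) other(1)[OF D]] LP[OF uv(1) other(2)[OF D]]
            LP[OF uv(2) other(1)[OF D]] LP[OF uv(2) other(2)[OF D]] ..
      qed
      obtain e h k a b c where U: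
        "u p = e + a / 2" "u (Suc p) = e + a + b / 2"
        "u q = h - a / 2" "u (Suc q) = h - a + c / 2"
        "u r = k - b / 2" "u (Suc r) = k - b - c / 2"
        "u' p = e + b / 2" "u' (Suc p) = e + b + a / 2"
        "u' q = h + c / 2" "u' (Suc q) = h + c - a / 2"
        "u' r = k - c / 2" "u' (Suc r) = k - c - b / 2" using LE[OF uv(1)] by blast
      obtain e' h' k' a' b' c' where V:
        "v p = e' + a' / 2" "v (Suc p) = e' + a' + b' / 2"
        "v q = h' - a' / 2" "v (Suc q) = h' - a' + c' / 2"
        "v r = k' - b' / 2" "v (Suc r) = k' - b' - c' / 2"
        "v' p = e' + b' / 2" "v' (Suc p) = e' + b' + a' / 2"
        "v' q = h' + c' / 2" "v' (Suc q) = h' + c' - a' / 2"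
        "v' r = k' - c' / 2" "v' (Suc r) = k' - c' - b' / 2" using LE[OF uv(2)] by blast
      have "omega w u v - omega w' u' v' =
          sg (proj w C) * ((u p * v q - u q * v p) + (u (Suc p) * v r - u r * v (Suc p))
            + (u (Suc q) * v (Suc r) - u (Suc r) * v (Suc q))
            - (u' (Suc p) * v' (Suc q) - u' (Suc q) * v' (Suc p)) - (u' p * v' (Suc r) -
                u' (Suc r) * v' p)
            - (u' q * v' r - u' r * v' q))"
        using O unfolding omega_on_def letters split pr prABC occ occ' by (simp add: algebra_simps)
      \<comment> \<open>The three letters do not keep their summands individually. The terms with e,
        h or k cancel between two letters each and the products of jumps only in total, which is why
        the three projections have to agree.\<close>
      also have "\<dots> = 0" unfolding U V by (simp add: field_simps)
      finally show "omega w (fst X) (fst Y) - omega w' (snd X) (snd Y) = 0" by (simp add: X Y)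
    qed
    show "linear_relation L"
      unfolding linear_relation_def
    proof (intro allI impI)
      fix u u' v v' :: "nat \<Rightarrow> rat" and \<mu> \<nu> :: rat
      assume uv: "(u, u') \<in> L" "(v, v') \<in> L"
      obtain e h k a b c where U:
        "u p = e + a / 2" "u (Suc p) = e + a + b / 2"
        "u q = h - a / 2" "u (Suc q) = h - a + c / 2"
        "u r = k - b / 2" "u (Suc r) = k - b - c / 2"
        "u' p = e + b / 2" "u' (Suc p) = e + b + a / 2"
        "u' q = h + c / 2" "u' (Suc q) = h + c - a / 2"
        "u' r = k - c / 2" "u' (Suc r) = k - c - b / 2" using LE[OF uv(1)] by blast
      obtain e' h' k' a' b' c' where V:
        "v p = e' + a' / 2" "v (Suc p) = e' + a' + b' / 2"
        "v q = h' - a' / 2" "v (Suc q) = h' - a' + c' / 2"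
        "v r = k' - b' / 2" "v (Suc r) = k' - b' - c' / 2"
        "v' p = e' + b' / 2" "v' (Suc p) = e' + b' + a' / 2"
        "v' q = h' + c' / 2" "v' (Suc q) = h' + c' - a' / 2"
        "v' r = k' - c' / 2" "v' (Suc r) = k' - c' - b' / 2" using LE[OF uv(2)] by blast
      show "(\<lambda>i. \<mu> * u i + \<nu> * v i, \<lambda>i. \<mu> * u' i + \<nu> * v' i) \<in> L"
        by (rule LI[of _ _ "\<mu> * e + \<nu> * e'" "\<mu> * a + \<nu> * a'" "\<mu> * b + \<nu> * b'" "\<mu> * h +
            \<nu> * h'" "\<mu> * c + \<nu> * c'" "\<mu> * k + \<nu> * k'"])
          (use LP[OF uv(1)] LP[OF uv(2)] in simp, simp_all only: U V, simp_all add: field_simps)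
    qed
    show "(\<lambda>_. 1, \<lambda>_. 1) \<in> L"
      by (rule LI[of _ _ 1 0 0 1 0 1]) simp_all
    fix D assume "D \<in> letters w - {}"
    then have D: "D \<in> letters w" by simp
    show "tau_class w' (id D) = tau_class w D" by (simp add: tau_class_def pr)
    have lt: "first_occ w D < last_occ w D" "first_occ w' D < last_occ w' D"
      using D w w' by (auto intro: first_occ_less_last_occ simp: letters)
    have "(loop w D, loop w' D) \<in> L"
    proof -
      consider "D = A" | "D = B" | "D = C" | "D \<in> ?O" using D by blast
      then show ?thesis
      proof cases
        \<comment> \<open>The witnesses stand in the order e, a, b, h, c, k. For one of the three
          letters, its own jump is 1, the other two jumps are 0, and e, h, k say whether its loop is
          open just before each pair.\<close>
        case 1
        show ?thesis
          by (rule LI[of _ _ 0 1 0 1 0 0])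
            (use lt pqr in \<open>auto simp: loop_eq 1 occ occ'\<close>)
      next
        case 2
        show ?thesis
          by (rule LI[of _ _ 0 0 1 1 0 1])
            (use lt pqr in \<open>auto simp: loop_eq 2 occ occ'\<close>)
      next
        case 3
        show ?thesis
          by (rule LI[of _ _ 0 0 0 0 1 1])
            (use lt pqr in \<open>auto simp: loop_eq 3 occ occ'\<close>)
      next
        case 4
        have loop: "loop w' D = loop w D"
          using other(3,4)[OF 4] by (simp add: loop_def fun_eq_iff)
        have "loop w D (Suc p) = loop w D p" "loop w D (Suc q) = loop w D q"
          "loop w D (Suc r) = loop w D r"
          using other(1,2)[OF 4] by (simp_all add: loop_Suc[OF lt(1)])
        then show ?thesis
          unfolding loop
          by (intro LI[of _ _ "loop w D p" 0 0 "loop w D q" 0 "loop w D r"]) simp_all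
      qed
    qed
    from linear_relationD[OF \<open>linear_relation L\<close> this this, of "sg (proj w D)" 0]
    have "(\<lambda>p. signed_loop w D p + 0, \<lambda>p. signed_loop w' (id D) p + 0) \<in> L"
      by (simp add: signed_loop_def pr)
    then show "\<exists>a b. (\<lambda>p. signed_loop w D p + a, \<lambda>p. signed_loop w' (id D) p + b) \<in> L" by blast
  qed (auto simp: letters)
qed

end

section \<open>Bridge moves\<close>

text \<open>Removing the letters of a bridge filters the word; \<open>q\<close> locates the
  surviving positions in the longer word.\<close>

lemma filter_embedding:
  "\<exists>q. (\<forall>i<length (filter P xs). q i < length xs \<and> filter P xs ! i = xs ! q i) \<and>
      (\<forall>i j. i < j \<longrightarrow> j < length (filter P xs) \<longrightarrow> q i < q j)"
proof (induction xs)
    case (Cons a xs)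
    then obtain q where q: "\<And>i. i < length (filter P xs) \<Longrightarrow> q i < length xs \<and> filter P xs ! i =
        xs ! q i"
      "\<And>i j. i < j \<Longrightarrow> j < length (filter P xs) \<Longrightarrow> q i < q j" by blast
    show ?case
    proof (cases "P a")
      case True
      show ?thesis
        by (rule exI[of _ "\<lambda>i. case i of 0 \<Rightarrow> 0 | Suc i \<Rightarrow> Suc (q i)"])
          (use q True in \<open>auto split: nat.split simp: less_Suc_eq_0_disj\<close>)
    next
      case False
      show ?thesis
        by (rule exI[of _ "\<lambda>i. Suc (q i)"]) (use q False in auto)
    qed
qed simp

context signed_involution
begin

lemma omega_diff_left: "omega_on w S (\<lambda>p. x p - x' p) y = omega_on w S x y - omega_on w S x' y"
  using omega_linear_left[of w S 1 x "-1" x' y] by simp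

lemma omega_add_right: "omega_on w S y (\<lambda>p. x p + x' p) = omega_on w S y x + omega_on w S y x'"
  using omega_linear_right[of w S y 1 x 1 x'] by simp

lemma omega_diff_right: "omega_on w S y (\<lambda>p. x p - x' p) = omega_on w S y x - omega_on w S y x'"
  using omega_linear_right[of w S y 1 x "-1" x'] by simp

lemma omega_half_right: "omega_on w S y (\<lambda>p. x p / 2) = omega_on w S y x / 2"
  using omega_linear_right[of w S y "1 / 2" x 0 x] by simp

text \<open>
  Here \<open>R\<close> is the reflection of the positions in the blocks \<open>v\<^sub>r\<close> and \<open>bl\<close> the index of a block.
  The part of the form supported on the removed letters is anti-invariant under \<open>R\<close>, so it
  vanishes on functions that are \<open>R\<close>-invariant in the blocks.  The relation below allows a
  function to change under \<open>R\<close> by a constant \<open>c\<close> on each block, and to differ from the function on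
  the remaining word by a multiple \<open>t\<close> of the function \<open>a\<close> that separates the two feet of an
  arch; these are the two contributions of an arch to the rank.
\<close>

lemma cobordant_reflection:
  fixes bl R :: "nat \<Rightarrow> nat"
  assumes w: "nanoword \<alpha> w" and w': "nanoword \<alpha> w'" and B: "B \<subseteq> letters w"
    and letters': "letters w' = letters w - B"
    and proj': "\<And>A. A \<in> letters w - B \<Longrightarrow> proj w' A = proj w A"
    and word': "word w' = filter (\<lambda>A. A \<notin> B) (word w)"
    and P_def: "P = {p. p < length (word w) \<and> word w ! p \<in> B}"
    and R: "\<And>p. p \<in> P \<Longrightarrow> R p \<in> P \<and> R (R p) = p \<and> word w ! R p = \<iota> (word w ! p)"
    and K: "finite K"
    and bl: "\<And>p. p \<in> P \<Longrightarrow> bl p \<in> K \<and> bl (R p) = \<kappa> (bl p)"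
    and \<kappa>: "\<And>r. r \<in> K \<Longrightarrow> \<kappa> r \<in> K \<and> \<kappa> (\<kappa> r) = r"
    and rev: "\<And>p p'. p \<in> P \<Longrightarrow> p' \<in> P \<Longrightarrow> bl p = bl p' \<Longrightarrow> p < p' \<Longrightarrow> R p' < R p"
    and convex: "\<And>p p' i. p \<in> P \<Longrightarrow> p' \<in> P \<Longrightarrow> bl p = bl p' \<Longrightarrow> p < i \<Longrightarrow> i < p' \<Longrightarrow> i \<in> P \<and> bl i = bl p"
    and sign: "\<And>A. A \<in> B \<Longrightarrow>
      sg (proj w (\<iota> A)) = (if R (first_occ w A) = first_occ w (\<iota> A) then - 1 else 1) * sg (proj w A)"
    and cls: "\<And>A. A \<in> B \<Longrightarrow> tau_class w (\<iota> A) = tau_class w A"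
  shows "cobordant w w' (2 * card {r \<in> K. r < \<kappa> r})"
proof -
  define I where "I = {r \<in> K. r < \<kappa> r}"
  define s :: "nat \<Rightarrow> nat \<Rightarrow> rat" where "s p i = sgn (of_nat p - of_nat i)" for p i
  have s: "s p i = (if p < i then - 1 else if p = i then 0 else 1)" for p i
    by (simp add: s_def sgn_if)
  \<comment> \<open>By convexity a block is an interval of positions, so an outside position lies on
    the same side of all of it.\<close>
  have block_s: "s p i = s p' i" if "p \<in> P" "p' \<in> P" "bl p = bl p'" "\<not> (i \<in> P \<and> bl i = bl p)"
      for p p' i
  proof -
    have "\<not> (p < i \<and> i < p')" "\<not> (p' < i \<and> i < p)" "p \<noteq> i" "p' \<noteq> i"
      using convex[of p p' i] convex[of p' p i] that by auto
    then show ?thesis by (auto simp: s)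
  qed
  have Rinj: "R p \<noteq> R p'" if "p \<in> P" "p' \<in> P" "p \<noteq> p'" for p p'
  proof
    assume "R p = R p'"
    then have "R (R p) = R (R p')" by simp
    then show False using R[OF that(1)] R[OF that(2)] that(3) by simp
  qed
  have const: "\<exists>c. \<forall>p\<in>P. bl p = r \<longrightarrow> f p = c"
    if "\<And>p p0. p \<in> P \<Longrightarrow> p0 \<in> P \<Longrightarrow> bl p = r \<Longrightarrow> bl p0 = r \<Longrightarrow> f p = f p0"
    for f :: "nat \<Rightarrow> rat" and r
  proof (cases "\<exists>p0\<in>P. bl p0 = r")
    case True
    then obtain p0 where p0: "p0 \<in> P" "bl p0 = r" by blast
    show ?thesis by (intro exI[of _ "f p0"] ballI impI that) (assumption | rule p0)+
  qed auto
  \<comment> \<open>In the block of \<open>i\<close> the reflection reverses the order and hence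
    negates the sign, so the sum is 0. On any other block both signs are constant.\<close>
  have reflect: "\<exists>c. \<forall>p\<in>P. bl p = r \<longrightarrow> s (R p) (R i) + s p i = c" if i: "i \<in> P" for i r
  proof (cases "bl i = r")
    case True
    have "s (R p) (R i) + s p i = 0" if "p \<in> P" "bl p = r" for p
      using rev[of p i] rev[of i p] that i True by (cases p i rule: linorder_cases) (auto simp: s)
    then show ?thesis by (intro exI[of _ 0]) simp
  next
    case False
    show ?thesis
    proof (rule const)
      fix p p0 assume p: "p \<in> P" "p0 \<in> P" "bl p = r" "bl p0 = r"
      have "bl (R i) \<noteq> bl (R p)" using bl[OF i] bl[OF p(1)] False p(3) \<kappa> by metis
      then have "s (R p) (R i) = s (R p0) (R i)"
        using block_s[of "R p" "R p0" "R i"] R[OF p(1)] R[OF p(2)] bl[OF p(1)] bl[OF p(2)] p by simp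
      moreover have "s p i = s p0 i" using block_s[of p p0 i] p False by simp
      ultimately show "s (R p) (R i) + s p i = s (R p0) (R i) + s p0 i" by simp
    qed
  qed
  \<comment> \<open>\<open>\<chi> r\<close> is 1 on one foot of the arch and -1 on the other.
    Functions of the block index that are odd under \<open>\<kappa>\<close> vanish on the blocks
    fixed by \<open>\<kappa>\<close> and are combinations of these.\<close>
  define \<chi> :: "nat \<Rightarrow> nat \<Rightarrow> rat" where "\<chi> r p = (if bl p = r then 1 else 0) - (if bl p =
      \<kappa> r then 1 else 0)" for r p
  have \<chi>_sum: "(\<Sum>r\<in>I. c r * \<chi> r p) = c (bl p)" if p: "p \<in> P" and c: "c (\<kappa> (bl p)) = - c (bl p)"
    for c :: "nat \<Rightarrow> rat" and p
  proof -
    note blp = bl[OF p, THEN conjunct1]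
    have I: "finite I" using K by (simp add: I_def)
    have split: "(\<Sum>r\<in>I. c r * \<chi> r p) = (\<Sum>r\<in>I. if bl p = r then c r else 0) - (\<Sum>r\<in>I. if \<kappa> (bl p) =
        r then c r else 0)"
      unfolding sum_subtractf[symmetric]
    proof (rule sum.cong[OF refl])
      fix r assume "r \<in> I"
      then have "r \<in> K" by (simp add: I_def)
      then have "bl p = \<kappa> r \<longleftrightarrow> \<kappa> (bl p) = r" using \<kappa>[of r] \<kappa>[OF blp] by metis
      then show "c r * \<chi> r p = (if bl p = r then c r else 0) - (if \<kappa> (bl p) = r then c r else 0)"
        by (simp add: \<chi>_def)
    qed
    have "bl p \<in> I \<longleftrightarrow> bl p < \<kappa> (bl p)" "\<kappa> (bl p) \<in> I \<longleftrightarrow> \<kappa> (bl p) < bl p"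
      using \<kappa>[OF blp] blp by (auto simp: I_def)
    then show ?thesis
      unfolding split using I c by (cases "bl p" "\<kappa> (bl p)" rule: linorder_cases)
          (auto simp: sum.delta)
  qed
  \<comment> \<open>Seen from outside P, only the block of an occurrence matters, so one position
    per block represents it. For an empty block the choice is arbitrary; its arch has coefficient 0
    in \<open>arch\<close>, since \<open>\<chi> r\<close> then vanishes on P.\<close>
  define rep where "rep r = (SOME p. p \<in> P \<and> bl p = r)" for r
  have rep: "rep (bl p) \<in> P" "bl (rep (bl p)) = bl p" if "p \<in> P" for p
    using someI[of "\<lambda>p'. p' \<in> P \<and> bl p' = bl p" p] that by (auto simp: rep_def)
  define a where "a r p = s p (rep r) - s p (rep (\<kappa> r))" for r p
  \<comment> \<open>An occurrence and its mirror image sit on the two feet of an arch, and only this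
    arch contributes; if \<open>\<kappa>\<close> fixes the block, both sides are 0.\<close>
  have arch: "s p i - s p (R i) = (\<Sum>r\<in>I. \<chi> r i * a r p)" if i: "i \<in> P" and p: "p \<notin> P" for i p
  proof -
    have sym: "s p i' = - s i' p" for i' by (auto simp: s)
    have eq: "s p i' = s p (rep (bl i'))" if "i' \<in> P" for i'
      using block_s[of i' "rep (bl i')" p] that rep[OF that] p by (simp add: sym)
    have "(\<Sum>r\<in>I. a r p * \<chi> r i) = a (bl i) p"
      by (rule \<chi>_sum[OF i]) (use \<kappa> bl[OF i] in \<open>simp add: a_def\<close>)
    also have "\<dots> = s p i - s p (R i)"
      using eq[OF i] eq[of "R i"] R[OF i] bl[OF i] by (simp add: a_def)
    finally show ?thesis by (simp add: mult.commute)
  qed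
  obtain q where q: "\<And>i. i < length (word w') \<Longrightarrow> q i < length (word w) \<and> word w' ! i = word w ! q i"
    and q_mono: "\<And>i j. i < j \<Longrightarrow> j < length (word w') \<Longrightarrow> q i < q j"
    using filter_embedding[of "\<lambda>A. A \<notin> B" "word w"] unfolding word' by blast
  define n' where "n' = length (word w')"
  have qP: "q i \<notin> P" if "i < n'" for i
    using q[of i] nth_in_letters[OF w', of i] that unfolding letters' P_def n'_def by auto
  have occ': "first_occ w A = q (first_occ w' A)" "last_occ w A = q (last_occ w' A)"
    "first_occ w' A < n'" "last_occ w' A < n'" if "A \<in> letters w'" for A
  proof -
    note o = nanoword_occ[OF w' that]
    show l: "first_occ w' A < n'" "last_occ w' A < n'" using o(1,2) by (simp_all add: n'_def)
    show "first_occ w A = q (first_occ w' A)" "last_occ w A = q (last_occ w' A)"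
      using occ_eqI[OF w q_mono[OF o(1,2)]] q[of "first_occ w' A"] q[of "last_occ w' A"] o(3,4) l
      by (simp_all add: n'_def)
  qed
  have inB: "first_occ w A \<in> P" "last_occ w A \<in> P" if "A \<in> B" for A
  proof -
    have Aw: "A \<in> letters w" using that B by blast
    show "first_occ w A \<in> P" "last_occ w A \<in> P"
      using first_occ_less_length[OF w Aw] last_occ_less_length[OF w Aw] that
      by (simp_all add: P_def nth_first_occ[OF w Aw] nth_last_occ[OF w Aw])
  qed
  have \<iota>: "\<iota> A \<in> B" "\<iota> (\<iota> A) = A" if "A \<in> B" for A
  proof -
    have "A \<in> letters w" using that B by blast
    note o = nth_first_occ[OF w this]
    have "word w ! R (first_occ w A) = \<iota> A" "R (first_occ w A) \<in> P" using R[OF inB(1)[OF that]] o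
        by simp_all
    moreover then have "word w ! R (R (first_occ w A)) = \<iota> (\<iota> A)" using R by metis
    ultimately show "\<iota> A \<in> B" "\<iota> (\<iota> A) = A" using R[OF inB(1)[OF that]] o by (auto simp: P_def)
  qed
  \<comment> \<open>Either the reflection keeps the order of the two occurrences and the sign
    changes, or it swaps them and the sign stays. In both cases the summand of A is carried to minus
    the summand of its image, which is what the exponent \<epsilon> in the definition of a bridge
    achieves.\<close>
  have sym_occ: "(R (first_occ w A) = first_occ w (\<iota> A) \<and> R (last_occ w A) = last_occ w (\<iota> A) \<and>
        sg (proj w (\<iota> A)) = - sg (proj w A)) \<or>
      (R (first_occ w A) = last_occ w (\<iota> A) \<and> R (last_occ w A) = first_occ w (\<iota> A) \<and>
        sg (proj w (\<iota> A)) = sg (proj w A))" if A: "A \<in> B" for A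
  proof -
    have Aw: "A \<in> letters w" "\<iota> A \<in> letters w" using A \<iota>(1)[OF A] B by auto
    have "R (first_occ w A) \<in> {first_occ w (\<iota> A), last_occ w (\<iota> A)}"
      "R (last_occ w A) \<in> {first_occ w (\<iota> A), last_occ w (\<iota> A)}"
      using R[OF inB(1)[OF A]] R[OF inB(2)[OF A]] nth_eq_iff_occ[OF w Aw(2)]
        nth_first_occ[OF w Aw(1)] nth_last_occ[OF w Aw(1)] by (auto simp: P_def)
    moreover have "R (first_occ w A) \<noteq> R (last_occ w A)"
      using Rinj[OF inB(1)[OF A] inB(2)[OF A]] first_occ_less_last_occ[OF w Aw(1)] by simp
    ultimately show ?thesis using sign[OF A] by auto
  qed
  have loop: "signed_loop w A p = sg (proj w A) / 2 * (s p (first_occ w A) - s p (last_occ w A))"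
      for A p
    by (simp add: signed_loop_def loop_def s_def)
  define L :: "((nat \<Rightarrow> rat) \<times> (nat \<Rightarrow> rat)) set" where
    "L = {(x, y). (\<exists>t. \<forall>i<n'. x (q i) = y i + (\<Sum>r\<in>I. t r * a r (q i))) \<and>
            (\<exists>c. \<forall>p\<in>P. x (R p) - x p = c (bl p))}"
  have const_blocks: "\<exists>c. \<forall>p\<in>P. x (R p) - x p = c (bl p)"
    if "\<And>r. \<exists>c. \<forall>p\<in>P. bl p = r \<longrightarrow> x (R p) - x p = c" for x :: "nat \<Rightarrow> rat"
    using that by metis
  have "skew_rank_le (2 * card I) L (\<lambda>X Y. omega w (fst X) (fst Y) - omega w' (snd X) (snd Y))"
  proof -
    let ?W = "omega_on w B" and ?V = "omega_on w (letters w - B)"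
    have I: "finite I" using K by (simp add: I_def)
    have "\<forall>X\<in>L. \<exists>t c. (\<forall>i<n'. fst X (q i) = snd X i + (\<Sum>r\<in>I. t r * a r (q i))) \<and>
        (\<forall>p\<in>P. fst X (R p) - fst X p = c (bl p))"
      by (auto simp: L_def)
    then obtain t c where t: "\<And>X i. X \<in> L \<Longrightarrow> i < n' \<Longrightarrow> fst X (q i) = snd X i +
        (\<Sum>r\<in>I. t X r * a r (q i))"
      and c: "\<And>X p. X \<in> L \<Longrightarrow> p \<in> P \<Longrightarrow> fst X (R p) - fst X p = c X (bl p)"
      by metis
    \<comment> \<open>The summands are c with d for the removed letters and t with e for the others.
      The 1/4 compensates the factor in \<open>W4\<close>; the 1/2 divides the term in which both
      arguments are corrections evenly between the two products.\<close>
    define T where "T X p = (\<Sum>r\<in>I. t X r * a r p)" for X p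
    define d where "d X r = - ?W (\<chi> r) (\<lambda>p. fst X (R p) + fst X p) / 4"
      for X :: "(nat \<Rightarrow> rat) \<times> (nat \<Rightarrow> rat)" and r
    define e where "e X r = ?V (a r) (\<lambda>p. fst X p - T X p / 2)" for X r
    have bij: "bij_betw \<iota> B B"
      by (rule bij_betwI[where g = \<iota>]) (use \<iota> in auto)
    have WR: "?W (\<lambda>p. x (R p)) (\<lambda>p. y (R p)) = - ?W x y" for x y
      unfolding omega_on_def sum_negf[symmetric]
    proof (subst (2) sum.reindex_bij_betw[OF bij, symmetric], rule sum.cong[OF refl])
      fix D assume "D \<in> B"
      from sym_occ[OF this]
      show "sg (proj w D) * (x (R (first_occ w D)) * y (R (last_occ w D)) -
          x (R (last_occ w D)) * y (R (first_occ w D))) =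
        - (sg (proj w (\<iota> D)) * (x (first_occ w (\<iota> D)) * y (last_occ w (\<iota> D)) -
            x (last_occ w (\<iota> D)) * y (first_occ w (\<iota> D))))"
        by (auto simp: algebra_simps)
    qed
    have WR2: "?W (\<lambda>p. x (R p)) y = - ?W x (\<lambda>p. y (R p))" for x y
    proof -
      have "?W (\<lambda>p. x (R p)) (\<lambda>p. y (R (R p))) = ?W (\<lambda>p. x (R p)) y"
        by (rule omega_cong) (use inB R in auto)
      then show ?thesis using WR[of x "\<lambda>p. y (R p)"] by simp
    qed
    \<comment> \<open>Polarization with respect to R: a form that changes sign under R vanishes on
      two even and on two odd functions, so only the mixed terms of the decomposition into even and
      odd parts remain.\<close>
    have W4: "4 * ?W x y = ?W (\<lambda>p. y (R p) - y p) (\<lambda>p. x (R p) + x p) - ?W (\<lambda>p. x (R p) -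
        x p) (\<lambda>p. y (R p) + y p)" for x y
      unfolding omega_diff_left omega_add_right WR WR2
      using omega_skew[of w B y x] omega_skew[of w B y "\<lambda>p. x (R p)"] WR2[of x y] by simp
    have Wc: "?W (\<lambda>p. fst X (R p) - fst X p) y = (\<Sum>r\<in>I. c X r * ?W (\<chi> r) y)" if X: "X \<in> L" for X y
    proof -
      have "fst X (R p) - fst X p = (\<Sum>r\<in>I. c X r * \<chi> r p)" if p: "p \<in> P" for p
      proof -
        \<comment> \<open>R is an involution, so the increments at a position and at its mirror
          image are opposite.\<close>
        have "c X (\<kappa> (bl p)) = - c X (bl p)"
          using c[OF X p] c[OF X, of "R p"] R[OF p] bl[OF p] by simp
        then show ?thesis using \<chi>_sum[OF p] c[OF X p] by simp
      qed
      then show ?thesis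
        unfolding omega_sum_left[symmetric] by (intro omega_cong) (use inB in auto)
    qed
    have W: "?W (fst X) (fst Y) = (\<Sum>r\<in>I. c X r * d Y r - d X r * c Y r)" if "X \<in> L" "Y \<in> L" for X Y
      using W4[of "fst X" "fst Y"] unfolding Wc[OF that(1)] Wc[OF that(2)] d_def
      by (simp add: sum_subtractf sum_negf field_simps flip: sum_divide_distrib)
    have w'_eq: "omega w' (snd X) (snd Y) = ?V (\<lambda>p. fst X p - T X p) (\<lambda>p. fst Y p -
        T Y p)" if XY: "X \<in> L" "Y \<in> L" for X Y
      unfolding omega_on_def letters'
    proof (rule sum.cong[OF refl])
      fix D assume D: "D \<in> letters w - B"
      then have "D \<in> letters w'" using letters' by simp
      note o = occ'[OF this]
      show "sg (proj w' D) * (snd X (first_occ w' D) * snd Y (last_occ w' D) -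
          snd X (last_occ w' D) * snd Y (first_occ w' D)) =
        sg (proj w D) * ((fst X (first_occ w D) - T X (first_occ w D)) * (fst Y (last_occ w D) -
            T Y (last_occ w D)) -
          (fst X (last_occ w D) - T X (last_occ w D)) * (fst Y (first_occ w D) -
              T Y (first_occ w D)))"
        unfolding o(1,2) proj'[OF D] T_def
        using t[OF XY(1) o(3)] t[OF XY(1) o(4)] t[OF XY(2) o(3)] t[OF XY(2) o(4)] by simp
    qed
    have Vt: "?V (T X) y = (\<Sum>r\<in>I. t X r * ?V (a r) y)" for X y
      unfolding T_def[abs_def] by (rule omega_sum_left)
    have "?V (fst X) (fst Y) - ?V (\<lambda>p. fst X p - T X p) (\<lambda>p. fst Y p - T Y p) =
        ?V (T X) (\<lambda>p. fst Y p - T Y p / 2) - ?V (T Y) (\<lambda>p. fst X p - T X p / 2)" for X Y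
      unfolding omega_diff_left omega_diff_right omega_half_right
      using omega_skew[of w "letters w - B" "T Y" "fst X"] omega_skew[of w "letters w -
          B" "T Y" "T X"] by simp
    then have V: "?V (fst X) (fst Y) - omega w' (snd X) (snd Y) = (\<Sum>r\<in>I. t X r * e Y r -
        e X r * t Y r)" if "X \<in> L" "Y \<in> L" for X Y
      unfolding w'_eq[OF that] Vt e_def by (simp add: sum_subtractf mult.commute)
    have "omega w x y = ?V x y + ?W x y" for x y
      unfolding omega_on_def by (rule sum.subset_diff[OF B finite_letters[OF w]])
    then have "omega w (fst X) (fst Y) - omega w' (snd X) (snd Y) =
        ?W (fst X) (fst Y) + (?V (fst X) (fst Y) - omega w' (snd X) (snd Y))" for X Y
      by simp
    moreover have "skew_rank_le (card I + card I) L
        (\<lambda>X Y. ?W (fst X) (fst Y) + (?V (fst X) (fst Y) - omega w' (snd X) (snd Y)))"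
      by (intro skew_rank_le_add skew_rank_le_sum[OF I W] skew_rank_le_sum[OF I V])
    ultimately show ?thesis by (simp only: mult_2)
  qed
  moreover have linL: "linear_relation L"
    unfolding linear_relation_def
  proof (intro allI impI)
    fix x y x' y' :: "nat \<Rightarrow> rat" and \<mu> \<nu> :: rat
    assume "(x, y) \<in> L" "(x', y') \<in> L"
    then obtain t c t' c' where t: "\<forall>i<n'. x (q i) = y i + (\<Sum>r\<in>I. t r * a r (q i))"
        "\<forall>i<n'. x' (q i) = y' i + (\<Sum>r\<in>I. t' r * a r (q i))"
      and c: "\<forall>p\<in>P. x (R p) - x p = c (bl p)" "\<forall>p\<in>P. x' (R p) - x' p = c' (bl p)"
      unfolding L_def by blast
    have "\<forall>i<n'. \<mu> * x (q i) + \<nu> * x' (q i) =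
        \<mu> * y i + \<nu> * y' i + (\<Sum>r\<in>I. (\<mu> * t r + \<nu> * t' r) * a r (q i))"
      using t by (simp add: algebra_simps sum.distrib sum_distrib_left)
    moreover have "(\<mu> * x (R p) + \<nu> * x' (R p)) - (\<mu> * x p + \<nu> * x' p) = \<mu> * c (bl p) +
        \<nu> * c' (bl p)" if "p \<in> P" for p
      using bspec[OF c(1) that] bspec[OF c(2) that] by (simp add: algebra_simps flip: distrib_left)
    ultimately show "(\<lambda>p. \<mu> * x p + \<nu> * x' p, \<lambda>p. \<mu> * y p + \<nu> * y' p) \<in> L"
      unfolding L_def mem_Collect_eq prod.case
      by (intro conjI exI[of _ "\<lambda>r. \<mu> * t r + \<nu> * t' r"] exI[of _ "\<lambda>r. \<mu> * c r + \<nu> * c' r"]) auto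
  qed
  moreover have "(\<lambda>_. 1, \<lambda>_. 1) \<in> L"
    unfolding L_def mem_Collect_eq prod.case
    by (intro conjI exI[of _ "\<lambda>_. 0"]) simp_all
  moreover have "(signed_loop w A, signed_loop w' A) \<in> L" if A: "A \<in> letters w - B" for A
  proof -
    have A': "A \<in> letters w'" using A letters' by simp
    have notP: "first_occ w A \<notin> P" "last_occ w A \<notin> P"
      using A nth_first_occ[OF w] nth_last_occ[OF w] by (auto simp: P_def)
    have sq: "s (q i) (q j) = s i j" if "i < n'" "j < n'" for i j
      using q_mono[of i j] q_mono[of j i] that by (cases i j rule: linorder_cases)
          (auto simp: s n'_def)
    have outside: "signed_loop w A (q i) = signed_loop w' A i" if "i < n'" for i
      unfolding signed_loop_def loop_def s_def[symmetric] proj'[OF A] occ'(1,2)[OF A']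
      using sq[OF that occ'(3)[OF A']] sq[OF that occ'(4)[OF A']] by simp
    \<comment> \<open>A surviving letter has no occurrence in a block, so its loop is constant on
      each block and on its mirror image.\<close>
    have inside: "\<exists>c. \<forall>p\<in>P. bl p = r \<longrightarrow> signed_loop w A (R p) - signed_loop w A p = c" for r
    proof (rule const)
      fix p p0 assume p: "p \<in> P" "p0 \<in> P" "bl p = r" "bl p0 = r"
      have "s p i = s p0 i" "s (R p) i = s (R p0) i" if "i \<notin> P" for i
        using block_s[of p p0 i] block_s[of "R p" "R p0" i] p that R[OF p(1)] R[OF p(2)]
          bl[OF p(1)] bl[OF p(2)] by simp_all
      then show "signed_loop w A (R p) - signed_loop w A p = signed_loop w A (R p0) -
          signed_loop w A p0"
        unfolding loop using notP by simp
    qed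
    show ?thesis
      unfolding L_def mem_Collect_eq prod.case
    proof
      show "\<exists>t. \<forall>i<n'. signed_loop w A (q i) = signed_loop w' A i + (\<Sum>r\<in>I. t r * a r (q i))"
        by (intro exI[of _ "\<lambda>_. 0"]) (simp add: outside)
    qed (rule const_blocks[OF inside])
  qed
  moreover have "(\<lambda>p. signed_loop w A p + signed_loop w (\<iota> A) p, \<lambda>_. 0) \<in> L" if A: "A \<in> B" for A
  proof -
    let ?i = "first_occ w A" and ?j = "last_occ w A" and ?g = "sg (proj w A) / 2"
    \<comment> \<open>In both cases of \<open>sym_occ\<close> the signed loops of A and its image
      combine to differences between an occurrence and its mirror image, to which
      \<open>arch\<close> applies outside P and \<open>reflect\<close> inside.\<close>
    define G where "G i p = s p i - s p (R i)" for i p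
    have eq: "signed_loop w A p + signed_loop w (\<iota> A) p = ?g * (G ?i p - G ?j p)" for p
      using sym_occ[OF A] unfolding loop G_def by (auto simp: algebra_simps)
    have outside: "?g * (G ?i p - G ?j p) = 0 + (\<Sum>r\<in>I. ?g * (\<chi> r ?i - \<chi> r ?j) * a r p)" if "p \<notin> P"
        for p
      unfolding G_def arch[OF inB(1)[OF A] that] arch[OF inB(2)[OF A] that]
      by (simp only: sum_subtractf[symmetric] sum_distrib_left left_diff_distrib[symmetric] mult.assoc add_0_left)
    have G: "\<exists>c. \<forall>p\<in>P. bl p = r \<longrightarrow> G i (R p) - G i p = c" if i: "i \<in> P" for i r
    proof -
      have Ri: "R i \<in> P" "R (R i) = i" using R[OF i] by auto
      obtain c1 where c1: "\<forall>p\<in>P. bl p = r \<longrightarrow> s (R p) (R i) + s p i = c1"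
        using reflect[OF i, of r] ..
      obtain c2 where c2: "\<forall>p\<in>P. bl p = r \<longrightarrow> s (R p) i + s p (R i) = c2"
        using reflect[OF Ri(1), of r] unfolding Ri(2) ..
      have "G i (R p) - G i p = c2 - c1" if "p \<in> P" "bl p = r" for p
        using bspec[OF c1 that(1)] bspec[OF c2 that(1)] that(2) unfolding G_def by linarith
      then show ?thesis by (intro exI[of _ "c2 - c1"]) simp
    qed
    have inside: "\<exists>c. \<forall>p\<in>P. bl p = r \<longrightarrow> ?g * (G ?i (R p) - G ?j (R p)) - ?g * (G ?i p - G ?j p) =
        c" for r
    proof -
      obtain c where c: "\<forall>p\<in>P. bl p = r \<longrightarrow> G ?i (R p) - G ?i p = c"
        using G[OF inB(1)[OF A]] ..
      obtain d where d: "\<forall>p\<in>P. bl p = r \<longrightarrow> G ?j (R p) - G ?j p = d"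
        using G[OF inB(2)[OF A]] ..
      have "?g * (G ?i (R p) - G ?j (R p)) - ?g * (G ?i p - G ?j p) = ?g * (c - d)"
        if "p \<in> P" "bl p = r" for p
      proof -
        have "?g * (G ?i (R p) - G ?j (R p)) - ?g * (G ?i p - G ?j p) =
            ?g * ((G ?i (R p) - G ?i p) - (G ?j (R p) - G ?j p))"
          by (simp add: algebra_simps)
        then show ?thesis using bspec[OF c that(1)] bspec[OF d that(1)] that(2) by simp
      qed
      then show ?thesis by (intro exI[of _ "?g * (c - d)"]) simp
    qed
    show ?thesis
      unfolding L_def mem_Collect_eq prod.case eq
    proof
      show "\<exists>t. \<forall>i<n'. ?g * (G ?i (q i) - G ?j (q i)) = 0 + (\<Sum>r\<in>I. t r * a r (q i))"
        using outside[OF qP] by (intro exI[of _ "\<lambda>r. ?g * (\<chi> r ?i - \<chi> r ?j)"]) blast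
    qed (rule const_blocks[OF inside])
  qed
  ultimately show ?thesis
    unfolding I_def[symmetric]
    by (intro cobordantI[where B = B and \<iota> = \<iota> and f = id and L = L])
      (use B \<iota> cls proj' letters' in \<open>auto simp: tau_class_def intro!: exI[of _ 0]\<close>)
qed

end

section \<open>Blocks of a factor as intervals of positions\<close>

lemma block_start_Suc:
  "r \<ge> 1 \<Longrightarrow> block_start x v (Suc r) = block_start x v r + length (v r) + length (x (Suc r))"
  by (simp add: block_start_def)

lemma block_start_mono:
  assumes "1 \<le> r" and "r < r'"
  shows "block_start x v r + length (v r) \<le> block_start x v r'"
proof -
  have "Suc r \<le> r'" using assms(2) by simp
  then show ?thesis
  proof (induction r' rule: dec_induct)
    case base
    then show ?case using block_start_Suc[OF assms(1), of x v] by simp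
  next
    case (step n)
    then show ?case using block_start_Suc[of n x v] assms(1) by simp
  qed
qed

lemma nth_block:
  assumes "r \<in> {1..k}" and "j < length (v r)"
    and u_def: "u = concat (map (\<lambda>r. x r @ v r) [1..<Suc k]) @ x (Suc k)"
  shows "block_start x v r + j < length u \<and> u ! (block_start x v r + j) = v r ! j"
proof -
  have "[1..<Suc k] = [1..<r] @ r # [Suc r..<Suc k]"
    using assms(1) upt_add_eq_append[of 1 r "Suc k - r"] upt_conv_Cons[of r "Suc k"] by simp
  then have "u = (concat (map (\<lambda>r. x r @ v r) [1..<r]) @ x r) @ v r @
      concat (map (\<lambda>r. x r @ v r) [Suc r..<Suc k]) @ x (Suc k)"
    unfolding u_def by (simp del: upt_Suc)
  then show ?thesis using assms(2) by (simp only: block_start_def length_append nth_append) simp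
qed

text \<open>For a position in a gap it is enough to know its letter: gaps avoid the letters of the
  bridge, so this excludes positions of P.\<close>

lemma block_cover:
  assumes "p < length (concat (map (\<lambda>r. x r @ v r) [1..<Suc k]))"
  shows "(\<exists>r\<in>{1..k}. \<exists>j<length (v r). p = block_start x v r + j) \<or>
    (\<exists>r\<in>{1..k}. concat (map (\<lambda>r. x r @ v r) [1..<Suc k]) ! p \<in> set (x r))"
  using assms
proof (induction k)
  case (Suc k)
  let ?u = "concat (map (\<lambda>r. x r @ v r) [1..<Suc k])"
  have u: "concat (map (\<lambda>r. x r @ v r) [1..<Suc (Suc k)]) = ?u @ x (Suc k) @ v (Suc k)" by simp
  show ?case
  proof (cases "p < length ?u")
    case True
    then show ?thesis using Suc.IH[OF True] unfolding u nth_append by auto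
  next
    case False
    show ?thesis
    proof (cases "p < length ?u + length (x (Suc k))")
      case True
      then have lt: "p - length ?u < length (x (Suc k))" using False by linarith
      then have "(?u @ x (Suc k) @ v (Suc k)) ! p = x (Suc k) ! (p - length ?u)"
        using False by (simp add: nth_append del: upt_Suc)
      then show ?thesis using lt unfolding u
        by (intro disjI2 bexI[of _ "Suc k"]) (simp_all del: upt_Suc)
    next
      case False
      then have "p = block_start x v (Suc k) + (p - (length ?u + length (x (Suc k))))"
        "p - (length ?u + length (x (Suc k))) < length (v (Suc k))"
        using Suc.prems unfolding u block_start_def by (simp_all del: upt_Suc)
      then show ?thesis by (intro disjI1 bexI[of _ "Suc k"]) auto
    qed
  qed
qed simp

text \<open>Every two-element orbit is represented by its smaller foot; the summands of
  \<open>cobordant_reflection\<close> are indexed in this way.\<close>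

lemma card_arches:
  assumes "\<kappa> permutes {1..k}" and "\<forall>r\<in>{1..k}. \<kappa> (\<kappa> r) = r"
  shows "arches k \<kappa> = card {r \<in> {1..k}. r < \<kappa> r}"
proof -
  have \<kappa>_in: "\<kappa> r \<in> {1..k}" if "r \<in> {1..k}" for r using assms(1) that by
      (simp only: permutes_in_image)
  have "bij_betw (\<lambda>r. {r, \<kappa> r}) {r \<in> {1..k}. r < \<kappa> r} {{r, \<kappa> r} | r. r \<in> {1..k} \<and> \<kappa> r \<noteq> r}"
    unfolding bij_betw_def
  proof
    show "inj_on (\<lambda>r. {r, \<kappa> r}) {r \<in> {1..k}. r < \<kappa> r}"
      by (auto simp: inj_on_def doubleton_eq_iff)
    show "(\<lambda>r. {r, \<kappa> r}) ` {r \<in> {1..k}. r < \<kappa> r} = {{r, \<kappa> r} | r. r \<in> {1..k} \<and> \<kappa> r \<noteq> r}"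
    proof (intro equalityI subsetI)
      fix S assume "S \<in> {{r, \<kappa> r} | r. r \<in> {1..k} \<and> \<kappa> r \<noteq> r}"
      then obtain r where r: "S = {r, \<kappa> r}" "r \<in> {1..k}" "\<kappa> r \<noteq> r" by blast
      show "S \<in> (\<lambda>r. {r, \<kappa> r}) ` {r \<in> {1..k}. r < \<kappa> r}"
      proof (cases "r < \<kappa> r")
        case True
        then show ?thesis using r by blast
      next
        case False
        then have "S = (\<lambda>r. {r, \<kappa> r}) (\<kappa> r)" "\<kappa> r < \<kappa> (\<kappa> r)"
          using r bspec[OF assms(2) r(2)] by auto
        then show ?thesis using \<kappa>_in[OF r(2)] by blast
      qed
    qed auto
  qed
  then show ?thesis unfolding arches_def by (simp add: bij_betw_same_card)
qed

context signed_involution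
begin

text \<open>The symmetry of occurrences in a bridge is the reflection R of positions, and
  \<epsilon>(b) = 1 says that R sends the first occurrence of b to the first occurrence of its
  image. The condition on projections then turns into the sign rule by
  \<open>sg_tau\<close>.\<close>

lemma cobordant_bridge:
  assumes w: "nanoword \<alpha> w" and w': "nanoword \<alpha> w'" and "bridge_move \<tau> w g w'"
  shows "cobordant w w' (2 * g)"
proof -
  obtain B k x v \<kappa> \<iota> where br: "bridge \<tau> w B k x v \<kappa> \<iota>" and g: "g = arches k \<kappa>"
    and w'_def: "w' = remove_letters w B (concat (map x [1..<Suc (Suc k)]))"
    using assms(3) unfolding bridge_move_def by blast
  have fac: "is_factor w B k x v" and perm: "\<kappa> permutes {1..k}" and \<kappa>\<kappa>: "\<forall>r\<in>{1..k}. \<kappa> (\<kappa> r) = r"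
    and \<iota>B: "\<iota> \<in> B \<rightarrow> B" and \<iota>: "\<forall>r\<in>{1..k}. map \<iota> (v r) = rev (v (\<kappa> r))"
    and pr: "\<forall>b\<in>B. proj w (\<iota> b) = (\<tau> ^^ bridge_eps w k x v \<kappa> \<iota> b) (proj w b)"
    using br unfolding bridge_def quasi_bridge_def by blast+
  have B: "B \<subseteq> letters w" and vB: "\<forall>r\<in>{1..k}. set (v r) \<subseteq> B"
    and xB: "\<forall>r\<in>{1..Suc k}. set (x r) \<subseteq> letters w - B"
    and word: "word w = concat (map (\<lambda>r. x r @ v r) [1..<Suc k]) @ x (Suc k)"
    using fac unfolding is_factor_def by blast+
  have \<kappa>_in: "\<kappa> r \<in> {1..k}" if "r \<in> {1..k}" for r using perm that by (simp only: permutes_in_image)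
  define P where "P = {p. p < length (word w) \<and> word w ! p \<in> B}"
  define st where "st = block_start x v"
  define len where "len r = length (v r)" for r
  \<comment> \<open>Both maps are meaningful only on P, where the blocks are disjoint and the index
    is unique. As positions start from 0, offset j is reflected to the length minus 1 minus
    j.\<close>
  define bl where "bl p = (THE r. r \<in> {1..k} \<and> st r \<le> p \<and> p < st r + len r)" for p
  define R where "R p = st (\<kappa> (bl p)) + (len (bl p) - 1 - (p - st (bl p)))" for p
  have st_mono: "st r + len r \<le> st r'" if "r \<in> {1..k}" "r < r'" for r r'
    using block_start_mono[of r r' x v] that by (simp add: st_def len_def)
  have bl: "bl (st r + j) = r" if "r \<in> {1..k}" "j < len r" for r j
    unfolding bl_def
  proof (rule the_equality)
    fix r' assume r': "r' \<in> {1..k} \<and> st r' \<le> st r + j \<and> st r + j < st r' + len r'"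
    show "r' = r"
    proof (cases r r' rule: linorder_cases)
      case less
      then show ?thesis using st_mono[OF that(1) less] r' that(2) by linarith
    next
      case greater
      then show ?thesis using st_mono[of r' r] r' that(2) by linarith
    qed simp
  qed (use that in simp)
  have nth_st: "word w ! (st r + j) = v r ! j" "st r + j < length (word w)"
      if "r \<in> {1..k}" "j < len r" for r j
    using nth_block[OF that(1) that(2)[unfolded len_def] word] unfolding st_def by blast+
  have st_P: "st r + j \<in> P" if "r \<in> {1..k}" "j < len r" for r j
    using nth_st[OF that] bspec[OF vB that(1)] nth_mem[of j "v r"] that(2) by
        (auto simp: P_def len_def)
  have P_E: "\<exists>r j. r \<in> {1..k} \<and> j < len r \<and> p = st r + j" if p: "p \<in> P" for p
  proof -
    let ?u = "concat (map (\<lambda>r. x r @ v r) [1..<Suc k])"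
    have pB: "word w ! p \<in> B" "p < length (word w)" using p by (simp_all add: P_def)
    have "p < length ?u"
    proof (rule ccontr)
      assume "\<not> p < length ?u"
      then have "word w ! p \<in> set (x (Suc k))"
        using pB(2) unfolding word nth_append by (simp del: upt_Suc)
      then show False using pB(1) bspec[OF xB, of "Suc k"] by auto
    qed
    moreover from this have "word w ! p = ?u ! p" unfolding word by
        (simp add: nth_append del: upt_Suc)
    moreover have "word w ! p \<notin> set (x r)" if "r \<in> {1..k}" for r
      using pB(1) bspec[OF xB, of r] that by auto
    ultimately show ?thesis
      using block_cover[of p x v k] unfolding st_def len_def by metis
  qed
  have len_\<kappa>: "len (\<kappa> r) = len r" if "r \<in> {1..k}" for r
    using arg_cong[OF bspec[OF \<iota> that], of length] by (simp add: len_def)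
  have R_st: "R (st r + j) = st (\<kappa> r) + (len r - 1 - j)" if "r \<in> {1..k}" "j < len r" for r j
    by (simp add: R_def bl[OF that])
  have R: "R p \<in> P \<and> R (R p) = p \<and> word w ! R p = \<iota> (word w ! p) \<and> bl p \<in> {1..k} \<and> bl (R p) =
      \<kappa> (bl p)"
    if pP: "p \<in> P" for p
  proof -
    obtain r j where r: "r \<in> {1..k}" and j: "j < len r" and p: "p = st r + j" using P_E[OF pP]
        by blast
    let ?j = "len r - 1 - j"
    have j': "?j < len (\<kappa> r)" using j len_\<kappa>[OF r] by simp
    have Rp: "R p = st (\<kappa> r) + ?j" unfolding p by (rule R_st[OF r j])
    have "R (R p) = p"
      unfolding Rp R_st[OF \<kappa>_in[OF r] j'] using bspec[OF \<kappa>\<kappa> r] len_\<kappa>[OF r] j p by simp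
    moreover have "v (\<kappa> r) ! ?j = \<iota> (v r ! j)"
    proof -
      have "map \<iota> (v r) ! j = rev (v (\<kappa> r)) ! j" using bspec[OF \<iota> r] by simp
      then show ?thesis using j len_\<kappa>[OF r] by (simp add: len_def rev_nth)
    qed
    ultimately show ?thesis
      using st_P[OF \<kappa>_in[OF r] j'] nth_st[OF \<kappa>_in[OF r] j'] nth_st[OF r j] bl[OF \<kappa>_in[OF r] j'] bl[OF r j] r
      by (simp add: p R_st[OF r j])
  qed
  have split: "\<exists>j<len (bl p). p = st (bl p) + j" if p: "p \<in> P" for p
    using P_E[OF p] bl by metis
  have rev: "R p' < R p" if "p \<in> P" "p' \<in> P" "bl p = bl p'" "p < p'" for p p'
    using split[OF that(1)] split[OF that(2)] that(3,4) R_def by auto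
  have convex: "i \<in> P \<and> bl i = bl p" if "p \<in> P" "p' \<in> P" "bl p = bl p'" "p < i" "i < p'" for p p' i
  proof -
    have r: "bl p \<in> {1..k}" using R[OF that(1)] by simp
    have "i = st (bl p) + (i - st (bl p))" "i - st (bl p) < len (bl p)"
      using split[OF that(1)] split[OF that(2)] that(3-5) by auto
    then show ?thesis using st_P[OF r] bl[OF r] by metis
  qed
  \<comment> \<open>The first occurrence determines r and j uniquely, so the existential statement
    in \<open>bridge_eps\<close> is about a single value of R.\<close>
  have eps: "bridge_eps w k x v \<kappa> \<iota> b = (if R (first_occ w b) =
      first_occ w (\<iota> b) then 1 else 0)" if b: "b \<in> B" for b
  proof -
    have bw: "b \<in> letters w" using b B by blast
    have "first_occ w b \<in> P"
      using first_occ_less_length[OF w bw] nth_first_occ[OF w bw] b by (simp add: P_def)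
    then obtain r j where r: "r \<in> {1..k}" and j: "j < len r" and f: "first_occ w b = st r + j"
        using P_E by blast
    have "(\<exists>r\<in>{1..k}. \<exists>j<length (v r). block_start x v r + j = first_occ w b \<and>
           block_start x v (\<kappa> r) + (length (v r) - 1 - j) = first_occ w (\<iota> b)) \<longleftrightarrow>
      R (first_occ w b) = first_occ w (\<iota> b)"
      unfolding st_def[symmetric] len_def[symmetric]
    proof
      assume "\<exists>r\<in>{1..k}. \<exists>j<len r. st r + j = first_occ w b \<and> st (\<kappa> r) + (len r - 1 - j) =
          first_occ w (\<iota> b)"
      then obtain r j where "r \<in> {1..k}" "j < len r" "st r + j = first_occ w b"
        "st (\<kappa> r) + (len r - 1 - j) = first_occ w (\<iota> b)" by blast
      then show "R (first_occ w b) = first_occ w (\<iota> b)" using R_st by metis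
    next
      assume "R (first_occ w b) = first_occ w (\<iota> b)"
      then show "\<exists>r\<in>{1..k}. \<exists>j<len r. st r + j = first_occ w b \<and> st (\<kappa> r) + (len r - 1 - j) =
          first_occ w (\<iota> b)"
        by (intro bexI[OF _ r] exI[of _ j]) (simp add: j f R_st[OF r j] del: diff_diff_left)
    qed
    then show ?thesis unfolding bridge_eps_def by simp
  qed
  have pr': "proj w (\<iota> b) = (if R (first_occ w b) =
      first_occ w (\<iota> b) then \<tau> (proj w b) else proj w b)"
    if "b \<in> B" for b
    using bspec[OF pr that] eps[OF that] by simp
  have "filter (\<lambda>A. A \<notin> B) (concat (map (\<lambda>r. x r @ v r) rs)) = concat (map x rs)"
      if "set rs \<subseteq> {1..k}" for rs
    using that
  proof (induction rs)
    case (Cons r rs)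
    have "filter (\<lambda>A. A \<notin> B) (x r) = x r" "filter (\<lambda>A. A \<notin> B) (v r) = []"
      using bspec[OF xB, of r] bspec[OF vB, of r] Cons.prems by
          (auto simp: filter_id_conv filter_empty_conv)
    then show ?case using Cons by simp
  qed simp
  moreover have "filter (\<lambda>A. A \<notin> B) (x (Suc k)) = x (Suc k)"
    using bspec[OF xB, of "Suc k"] by (auto simp: filter_id_conv)
  ultimately have word': "word w' = filter (\<lambda>A. A \<notin> B) (word w)"
    unfolding word w'_def remove_letters_def by
        (simp add: atLeastLessThanSuc_atLeastAtMost del: upt_Suc)
      (simp add: upt_Suc_append)
  have "cobordant w w' (2 * card {r \<in> {1..k}. r < \<kappa> r})"
  proof (rule cobordant_reflection[OF w w' B _ _ word' P_def, of R \<iota> "{1..k}" bl \<kappa>])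
    show "sg (proj w (\<iota> A)) = (if R (first_occ w A) = first_occ w (\<iota> A) then -
        1 else 1) * sg (proj w A)" if "A \<in> B" for A
      using pr'[OF that] sg_tau[OF proj_in[OF w, of A]] that B by auto
    show "tau_class w (\<iota> A) = tau_class w A" if "A \<in> B" for A
      using pr'[OF that] tau_tau[OF proj_in[OF w, of A]] that B by (auto simp: tau_class_def)
    show "R p' < R p" if "p \<in> P" "p' \<in> P" "bl p = bl p'" "p < p'" for p p'
      by (rule rev[OF that])
    show "i \<in> P \<and> bl i = bl p" if "p \<in> P" "p' \<in> P" "bl p = bl p'" "p < i" "i < p'" for p p' i
      by (rule convex[OF that])
    show "\<kappa> r \<in> {1..k} \<and> \<kappa> (\<kappa> r) = r" if "r \<in> {1..k}" for r
      using \<kappa>_in[OF that] bspec[OF \<kappa>\<kappa> that] by blast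
    show "R p \<in> P \<and> R (R p) = p \<and> word w ! R p = \<iota> (word w ! p)"
      "bl p \<in> {1..k} \<and> bl (R p) = \<kappa> (bl p)" if "p \<in> P" for p
      using R[OF that] by blast+
  qed (simp_all add: w'_def remove_letters_def)
  then show ?thesis unfolding g card_arches[OF perm \<kappa>\<kappa>] .
qed

end

text \<open>The block AA is its own reversal, so it forms a bridge with \<open>\<kappa>\<close> and
  \<open>\<iota>\<close> the identity. The first A is symmetric to the second one, hence
  \<epsilon>(A) = 0 and the projection is unconstrained.\<close>

lemma bridge_move_homotopy1:
  assumes w: "nanoword \<alpha> w" and "homotopy_move1 w w'"
  shows "bridge_move \<tau> w 0 w'"
proof -
  obtain x y A where word: "word w = x @ [A, A] @ y" and w': "w' = remove_letters w {A} (x @ y)"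
    using assms(2) unfolding homotopy_move1_def by blast
  have A: "A \<in> letters w" using w by (auto simp: nanoword_def word)
  then have "count_list (word w) A = 2" using w by (simp add: nanoword_def)
  then have notin: "A \<notin> set x" "A \<notin> set y" by (auto simp: word count_list_0_iff)
  have sub: "set x \<subseteq> letters w" "set y \<subseteq> letters w" using w by (auto simp: nanoword_def word)
  define X where "X r = (if r = Suc 0 then x else y)" for r
  have "is_factor w {A} 1 X (\<lambda>_. [A, A])"
    unfolding is_factor_def using A notin sub by (auto simp: word X_def)
  then have "quasi_bridge w {A} 1 X (\<lambda>_. [A, A]) id id"
    by (simp add: quasi_bridge_def permutes_id)
  moreover have "bridge_eps w 1 X (\<lambda>_. [A, A]) id id A = 0"
    by (auto simp: bridge_eps_def less_Suc_eq)
  ultimately have "bridge \<tau> w {A} 1 X (\<lambda>_. [A, A]) id id"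
    by (simp add: bridge_def)
  moreover have "arches 1 id = 0" by (simp add: arches_def)
  moreover have "concat (map X [1..<Suc (Suc 1)]) = x @ y" by (simp add: X_def)
  ultimately show ?thesis unfolding bridge_move_def w' by metis
qed

text \<open>The blocks AB and BA are each mapped to their own reversal by exchanging A and B, so
  \<open>\<kappa>\<close> can be the identity and there is no arch. The first occurrences of A and B
  are symmetric, hence \<epsilon> = 1, in accordance with |B| = \<tau>(|A|).\<close>

lemma bridge_move_homotopy2:
  assumes inv: "involution_on \<alpha> \<tau>" and w: "nanoword \<alpha> w" and "homotopy_move2 \<tau> w w'"
  shows "bridge_move \<tau> w 0 w'"
proof -
  obtain x y z A B where word: "word w = x @ [A, B] @ y @ [B, A] @ z"
    and pr: "proj w B = \<tau> (proj w A)" and w': "w' = remove_letters w {A, B} (x @ y @ z)"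
    using assms(3) unfolding homotopy_move2_def by blast
  have AB: "A \<in> letters w" "B \<in> letters w" using w by (auto simp: nanoword_def word)
  then have count: "count_list (word w) A = 2" "count_list (word w) B = 2" using w by
      (simp_all add: nanoword_def)
  \<comment> \<open>If A and B were equal, this letter would occur at least four times.\<close>
  then have ne: "A \<noteq> B" by (auto simp: word)
  then have notin: "A \<notin> set x" "A \<notin> set y" "A \<notin> set z" "B \<notin> set x" "B \<notin> set y" "B \<notin> set z"
    using count by (auto simp: word count_list_0_iff)
  have sub: "set x \<subseteq> letters w" "set y \<subseteq> letters w" "set z \<subseteq> letters w"
    using w by (auto simp: nanoword_def word)
  define X where "X r = (if r = Suc 0 then x else if r = Suc (Suc 0) then y else z)" for r
  define V where "V r = (if r = Suc 0 then [A, B] else [B, A])" for r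
  define \<iota> where "\<iota> D = (if D = A then B else A)" for D
  have first: "first_occ w A = length x" "first_occ w B = Suc (length x)"
    using occ_eqI[OF w, of "length x" "length x + 3 + length y" A]
      occ_eqI[OF w, of "Suc (length x)" "length x + 2 + length y" B]
    by (simp_all add: word nth_append)
  have two: "{1..2} = {Suc 0, Suc (Suc 0)}" by auto
  have "is_factor w {A, B} 2 X V"
    unfolding is_factor_def using AB ne notin sub by (auto simp: word X_def V_def numeral_2_eq_2)
  then have "quasi_bridge w {A, B} 2 X V id \<iota>"
    using ne by (auto simp: quasi_bridge_def permutes_id V_def \<iota>_def)
  moreover have "bridge_eps w 2 X V id \<iota> A = 1"
    unfolding bridge_eps_def two using ne
    by (auto simp: first \<iota>_def V_def X_def block_start_def intro!: exI[of _ 0])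
  moreover have "bridge_eps w 2 X V id \<iota> B = 1"
    unfolding bridge_eps_def two using ne
    by (auto simp: first \<iota>_def V_def X_def block_start_def intro!: exI[of _ 1])
  moreover have "\<tau> (\<tau> (proj w A)) = proj w A"
    using inv AB(1) w by (auto simp: involution_on_def nanoword_def)
  ultimately have "bridge \<tau> w {A, B} 2 X V id \<iota>"
    using ne pr by (simp add: bridge_def \<iota>_def)
  moreover have "arches 2 id = 0" by (simp add: arches_def)
  moreover have "concat (map X [1..<Suc (Suc 2)]) = x @ y @ z" by (simp add: X_def numeral_2_eq_2)
  ultimately show ?thesis unfolding bridge_move_def w' by metis
qed

context signed_involution
begin

section \<open>From single moves to metamorphoses\<close>

lemma elementary_move_cobordant:
  assumes "elementary_move \<tau> w g v" and "nanoword \<alpha> w" and "nanoword \<alpha> v"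
  shows "cobordant w v (2 * g)"
  using assms
proof cases
  case homotopy1
  then show ?thesis using cobordant_bridge[OF assms(2,3) bridge_move_homotopy1] assms(2) by simp
next
  case homotopy2
  then show ?thesis using cobordant_bridge[OF assms(2,3) bridge_move_homotopy2] involution assms(2) by simp
qed (use assms cobordant_isomorphism cobordant_homotopy3 cobordant_shift cobordant_bridge in auto)

lemma metamorphosis_cobordant:
  assumes "metamorphosis \<alpha> \<tau> w g v"
  shows "nanoword \<alpha> w \<and> nanoword \<alpha> v \<and> cobordant w v (2 * g)"
  using assms
proof induction
  case (empty w)
  have "isomorphism_move w w" unfolding isomorphism_move_def by (intro exI[of _ id]) auto
  then show ?case using empty cobordant_isomorphism by simp
next
  case (move w g u h v)
  then show ?case
    using cobordant_trans elementary_move_cobordant unfolding distrib_left by blast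
next
  case (inverse_move w g u v h)
  then show ?case
    using cobordant_trans cobordant_sym elementary_move_cobordant unfolding distrib_left by blast
qed

end

section \<open>The pairing of a nanoword\<close>

lemma split_at: "i < length xs \<Longrightarrow> \<exists>a b. xs = a @ [xs ! i] @ b \<and> length a = i"
  by (intro exI[of _ "take i xs"] exI[of _ "drop (Suc i) xs"]) (simp add: id_take_nth_drop[symmetric])

lemma interlacing_pattern:
  assumes w: "nanoword \<alpha> w" and A: "A \<in> letters w" and B: "B \<in> letters w"
  shows "(\<exists>x1 x2 x3 x4 x5. word w = x1 @ [A] @ x2 @ [B] @ x3 @ [A] @ x4 @ [B] @ x5) \<longleftrightarrow>
    first_occ w A < first_occ w B \<and> first_occ w B < last_occ w A \<and> last_occ w A < last_occ w B"
    (is "?L \<longleftrightarrow> ?R")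
proof
  assume ?L
  then obtain x1 x2 x3 x4 x5 where word: "word w = x1 @ [A] @ x2 @ [B] @ x3 @ [A] @ x4 @ [B] @ x5"
      by blast
  let ?a = "length x1" and ?b = "length x1 + 1 + length x2"
  let ?c = "length x1 + 1 + length x2 + 1 + length x3"
  let ?d = "length x1 + 1 + length x2 + 1 + length x3 + 1 + length x4"
  have "word w ! ?a = A" "word w ! ?b = B" "word w ! ?c = A" "word w ! ?d = B" "?d < length (word w)"
    by (simp_all add: word nth_append)
  then have "first_occ w A = ?a" "last_occ w A = ?c" "first_occ w B = ?b" "last_occ w B = ?d"
    using occ_eqI[OF w, of ?a ?c A] occ_eqI[OF w, of ?b ?d B] by simp_all
  then show ?R by simp
next
  assume R: ?R
  let ?a = "first_occ w A" and ?b = "first_occ w B" and ?c = "last_occ w A" and ?d = "last_occ w B"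
  \<comment> \<open>The word is cut from the right, so that the earlier occurrences keep their
    position numbers in the remaining prefix.\<close>
  obtain u x5 where 1: "word w = u @ [B] @ x5" "length u = ?d"
    using split_at[OF last_occ_less_length[OF w B]] nth_last_occ[OF w B] by metis
  then have "u ! ?c = A" "?c < length u" using R nth_last_occ[OF w A] by (simp_all add: nth_append)
  then obtain u' x4 where 2: "u = u' @ [A] @ x4" "length u' = ?c" using split_at[of ?c u] by metis
  then have "u' ! ?b = B" "?b < length u'" using 1 R nth_first_occ[OF w B] by
      (simp_all add: nth_append)
  then obtain u'' x3 where 3: "u' = u'' @ [B] @ x3" "length u'' = ?b" using split_at[of ?b u']
      by metis
  then have "u'' ! ?a = A" "?a < length u''" using 1 2 R nth_first_occ[OF w A] by
      (simp_all add: nth_append)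
  then obtain x1 x2 where "u'' = x1 @ [A] @ x2" using split_at[of ?a u''] by metis
  then show ?L using 1 2 3 by (metis append.assoc)
qed

lemma interlacing_eq:
  assumes "nanoword \<alpha> w" and "A \<in> letters w" and "B \<in> letters w"
  shows "interlacing w A B =
    (if first_occ w A < first_occ w B \<and> first_occ w B < last_occ w A \<and>
        last_occ w A < last_occ w B then 1
     else if first_occ w B < first_occ w A \<and> first_occ w A < last_occ w B \<and>
         last_occ w B < last_occ w A then - 1
     else 0)"
  unfolding interlacing_def interlacing_pattern[OF assms] interlacing_pattern[OF assms(1,3,2)] ..

lemma loop_at:
  assumes "first_occ w A < last_occ w A" and "p \<noteq> first_occ w A" and "p \<noteq> last_occ w A"
  shows "loop w A p = of_bool (first_occ w A < p \<and> p < last_occ w A)"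
  using assms by (auto simp: loop_def sgn_if)

lemma loop_at_occ:
  assumes "first_occ w A < last_occ w A"
  shows "loop w A (first_occ w A) = 1 / 2" and "loop w A (last_occ w A) = 1 / 2"
  using assms by (auto simp: loop_def sgn_if)

lemma occ_distinct:
  assumes "nanoword \<alpha> w" and "A \<in> letters w" and "B \<in> letters w" and "A \<noteq> B"
  shows "first_occ w A \<noteq> first_occ w B" "first_occ w A \<noteq> last_occ w B"
    "last_occ w A \<noteq> first_occ w B" "last_occ w A \<noteq> last_occ w B"
  using nth_first_occ[OF assms(1)] nth_last_occ[OF assms(1)] assms(2-4) by metis+

text \<open>The values differ exactly when one occurrence of D lies between those of A and the other
  does not, which is interlacing, and the sign tells which one it is. For D = A both values are
  1/2.\<close>

lemma loop_diff_eq_interlacing: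
  assumes w: "nanoword \<alpha> w" and A: "A \<in> letters w" and D: "D \<in> letters w"
  shows "loop w A (first_occ w D) - loop w A (last_occ w D) = of_int (interlacing w A D)"
proof (cases "D = A")
  case True
  then show ?thesis
    using loop_at_occ[OF first_occ_less_last_occ[OF w A]] by (simp add: interlacing_eq[OF w A A])
next
  case False
  note d = occ_distinct[OF w D A False]
  note lt = first_occ_less_last_occ[OF w A] first_occ_less_last_occ[OF w D]
  have "loop w A (first_occ w D) = of_bool (first_occ w A < first_occ w D \<and>
      first_occ w D < last_occ w A)"
    "loop w A (last_occ w D) = of_bool (first_occ w A < last_occ w D \<and> last_occ w D < last_occ w A)"
    using loop_at[OF lt(1)] d by simp_all
  then show ?thesis
    using d lt unfolding interlacing_eq[OF w A D] by auto
qed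

section \<open>The pairing of a nanoword under \<phi>\<close>

locale pi_hom =
  fixes \<alpha> :: "'a set" and \<tau> :: "'a \<Rightarrow> 'a" and \<phi> :: "('a \<Rightarrow>\<^sub>0 int) set \<Rightarrow> int"
  assumes involution: "involution_on \<alpha> \<tau>"
    and hom: "\<phi> \<in> hom (pi_group \<alpha> \<tau>) integer_group"
    and gen_nonzero: "a \<in> \<alpha> \<Longrightarrow> \<phi> (pi_gen \<alpha> \<tau> a) \<noteq> 0"
begin

abbreviation "G \<equiv> pi_group \<alpha> \<tau>"

sublocale pi: comm_group G by (rule comm_group_pi_group[OF involution])

sublocale \<phi>: group_hom G integer_group \<phi>
  by (intro group_hom.intro group_hom_axioms.intro pi.is_group hom) simp

lemma gen_closed: "a \<in> \<alpha> \<Longrightarrow> pi_gen \<alpha> \<tau> a \<in> carrier G"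
  by (rule pi_gen_closed[OF involution])

lemma phi_mult: "x \<in> carrier G \<Longrightarrow> y \<in> carrier G \<Longrightarrow> \<phi> (x \<otimes>\<^bsub>G\<^esub> y) = \<phi> x + \<phi> y"
  using \<phi>.hom_mult by simp

lemma phi_inv: "x \<in> carrier G \<Longrightarrow> \<phi> (inv\<^bsub>G\<^esub> x) = - \<phi> x"
  using \<phi>.hom_inv by simp

lemma phi_one: "\<phi> \<one>\<^bsub>G\<^esub> = 0"
  using \<phi>.hom_one by simp

lemma phi_pow: "x \<in> carrier G \<Longrightarrow> \<phi> (x [^]\<^bsub>G\<^esub> (n::int)) = n * \<phi> x"
  using \<phi>.hom_int_pow[of x n] by simp

lemma phi_finprod:
  assumes "finite S" and "\<And>x. x \<in> S \<Longrightarrow> f x \<in> carrier G"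
  shows "\<phi> (finprod G f S) = (\<Sum>x\<in>S. \<phi> (f x))"
  using assms
proof (induction S rule: finite_induct)
  case (insert x S)
  then have "finprod G f (insert x S) = f x \<otimes>\<^bsub>G\<^esub> finprod G f S" by (intro pi.finprod_insert) auto
  then show ?case using insert by (simp add: phi_mult pi.finprod_closed Pi_iff)
qed (simp add: phi_one)

lemma phi_tau:
  assumes a: "a \<in> \<alpha>"
  shows "\<phi> (pi_gen \<alpha> \<tau> (\<tau> a)) = - \<phi> (pi_gen \<alpha> \<tau> a)"
proof -
  let ?F = "free_Abelian_group \<alpha>" and ?H = "pi_relators \<alpha> \<tau>"
  interpret F: comm_group ?F by (rule abelian_free_Abelian_group)
  have \<tau>a: "\<tau> a \<in> \<alpha>" using involution a by (auto simp: involution_on_def)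
  have gens: "{frag_of a + frag_of (\<tau> a) | a. a \<in> \<alpha>} \<subseteq> carrier ?F"
    using involution by (auto simp: involution_on_def Pi_iff dest!: subsetD[OF keys_add])
  then have sub: "subgroup ?H ?F"
    unfolding pi_relators_def by (rule F.generate_is_subgroup)
  then have normal: "?H \<lhd> ?F" by (rule F.subgroup_imp_normal)
  have fr: "frag_of a \<in> carrier ?F" "frag_of (\<tau> a) \<in> carrier ?F" using a \<tau>a by simp_all
  have "frag_of a + frag_of (\<tau> a) \<in> ?H"
    unfolding pi_relators_def using a by (auto intro: generate.incl)
  then have "?H #>\<^bsub>?F\<^esub> (frag_of a + frag_of (\<tau> a)) = ?H"
    using F.coset_join2[OF _ sub] gens a by auto
  moreover have "pi_gen \<alpha> \<tau> a \<otimes>\<^bsub>G\<^esub> pi_gen \<alpha> \<tau> (\<tau> a) = ?H #>\<^bsub>?F\<^esub> (frag_of a + frag_of (\<tau> a))"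
    unfolding pi_gen_def pi_group_def
    using normal.rcos_sum[OF normal fr] by simp
  ultimately have "pi_gen \<alpha> \<tau> a \<otimes>\<^bsub>G\<^esub> pi_gen \<alpha> \<tau> (\<tau> a) = \<one>\<^bsub>G\<^esub>"
    by (simp add: pi_group_def)
  then show ?thesis
    using phi_mult[OF gen_closed[OF a] gen_closed[OF \<tau>a]] phi_one by simp
qed

definition sg :: "'a \<Rightarrow> rat" where "sg a = of_int (\<phi> (pi_gen \<alpha> \<tau> a))"

sublocale signed_involution \<alpha> \<tau> sg
  by unfold_locales (simp_all add: involution sg_def phi_tau gen_nonzero)

text \<open>For D other than A and B the product of loop values at the first and last occurrence of
  D is the indicator of D in the sum A \<circ> B, and the opposite product that of B \<circ> A. For
  D = A and D = B one factor is 1/2, and the difference of the other loop leaves half of the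
  interlacing term.\<close>

lemma phi_letter_form:
  assumes w: "nanoword \<alpha> w" and A: "A \<in> letters w" and B: "B \<in> letters w"
  shows "of_int (\<phi> (letter_form \<alpha> \<tau> w A B)) = 2 * omega w (loop w A) (loop w B)"
proof -
  let ?c = "\<lambda>A B D. first_occ w A < first_occ w D \<and> first_occ w D < last_occ w A \<and>
          first_occ w B < last_occ w D \<and> last_occ w D < last_occ w B"
  have gen: "pi_gen \<alpha> \<tau> (proj w D) \<in> carrier G" if "D \<in> letters w" for D
    by (rule gen_closed[OF proj_in[OF w that]])
  have circ_closed: "circ \<alpha> \<tau> w A B \<in> carrier G" for A B
    unfolding circ_def by (rule pi.finprod_closed) (auto intro: gen)
  have fin: "finite (letters w)" by (rule finite_letters[OF w])
  have circ: "of_int (\<phi> (circ \<alpha> \<tau> w A B)) = (\<Sum>D\<in>letters w. of_bool (?c A B D) * sg (proj w D))"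
      for A B
  proof -
    have "\<phi> (circ \<alpha> \<tau> w A B) = (\<Sum>D\<in>{D \<in> letters w. ?c A B D}. \<phi> (pi_gen \<alpha> \<tau> (proj w D)))"
      unfolding circ_def by (rule phi_finprod) (use fin gen in auto)
    then have "of_int (\<phi> (circ \<alpha> \<tau> w A B)) = (\<Sum>D\<in>{D \<in> letters w. ?c A B D}. sg (proj w D))"
      by (simp add: sg_def)
    also have "\<dots> = (\<Sum>D\<in>letters w. of_bool (?c A B D) * sg (proj w D))"
      using fin by (intro sum.mono_neutral_cong_left) auto
    finally show ?thesis .
  qed
  have letter: "of_int (\<phi> (letter_form \<alpha> \<tau> w A B)) =
      2 * ((\<Sum>D\<in>letters w. of_bool (?c A B D) * sg (proj w D)) -
          (\<Sum>D\<in>letters w. of_bool (?c B A D) * sg (proj w D)))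
      + of_int (interlacing w A B) * (sg (proj w A) + sg (proj w B))"
    unfolding circ[symmetric]
    by (simp add: letter_form_def phi_mult phi_pow phi_inv circ_closed gen A B sg_def)
  show ?thesis
  proof (cases "A = B")
    case True
    then show ?thesis unfolding letter
      using omega_skew[of w "letters w" "loop w A" "loop w A"] by (simp add: interlacing_eq[OF w B B])
  next
    case False
    let ?n = "of_int (interlacing w A B) :: rat"
    have "2 * (sg (proj w D) * (loop w A (first_occ w D) * loop w B (last_occ w D) -
          loop w A (last_occ w D) * loop w B (first_occ w D))) =
        2 * (of_bool (?c A B D) * sg (proj w D) - of_bool (?c B A D) * sg (proj w D))
        + (if D = A then ?n * sg (proj w A) else 0) + (if D = B then ?n * sg (proj w B) else 0)"
      if D: "D \<in> letters w" for D
    proof -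
      note ltA = first_occ_less_last_occ[OF w A] and ltB = first_occ_less_last_occ[OF w B]
      consider "D = A" | "D = B" | "D \<noteq> A" "D \<noteq> B" by blast
      then show ?thesis
      proof cases
        case 1
        have "interlacing w A B = - interlacing w B A"
          unfolding interlacing_eq[OF w A B] interlacing_eq[OF w B A] by auto
        then have n: "?n = loop w B (last_occ w A) - loop w B (first_occ w A)"
          using loop_diff_eq_interlacing[OF w B A] by simp
        show ?thesis unfolding n using 1 False by (simp add: loop_at_occ[OF ltA] algebra_simps)
      next
        case 2
        have n: "?n = loop w A (first_occ w B) - loop w A (last_occ w B)"
          using loop_diff_eq_interlacing[OF w A B] by simp
        show ?thesis unfolding n using 2 False by (simp add: loop_at_occ[OF ltB] algebra_simps)
      next
        case 3
        then show ?thesis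
          using occ_distinct[OF w D A] occ_distinct[OF w D B]
          by (simp add: loop_at[OF ltA] loop_at[OF ltB])
      qed
    qed
    then have "2 * omega w (loop w A) (loop w B) = (\<Sum>D\<in>letters w.
        2 * (of_bool (?c A B D) * sg (proj w D) - of_bool (?c B A D) * sg (proj w D))
        + (if D = A then ?n * sg (proj w A) else 0) + (if D = B then ?n * sg (proj w B) else 0))"
      unfolding omega_on_def sum_distrib_left by (rule sum.cong[OF refl])
    then show ?thesis
      unfolding letter using fin A B
      by (simp add: sum.distrib sum_subtractf sum_distrib_left[symmetric] distrib_left)
  qed
qed

text \<open>The constant 1/2 that stands for s cancels the factor 2, so that D contributes n(A, D)
  times its weight.\<close>

lemma phi_base_form:
  assumes w: "nanoword \<alpha> w" and A: "A \<in> letters w"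
  shows "of_int (\<phi> (base_form \<alpha> \<tau> w A)) = 2 * omega w (loop w A) (\<lambda>_. 1 / 2)"
proof -
  have gen: "pi_gen \<alpha> \<tau> (proj w D) \<in> carrier G" if "D \<in> letters w" for D
    by (rule gen_closed[OF proj_in[OF w that]])
  have "of_int (\<phi> (base_form \<alpha> \<tau> w A)) = (\<Sum>D\<in>letters w. of_int (interlacing w A D) * sg (proj w D))"
    unfolding base_form_def
        by (subst phi_finprod) (use finite_letters[OF w] gen in \<open>auto simp: phi_pow sg_def\<close>)
  also have "\<dots> = (\<Sum>D\<in>letters w. 2 * (sg (proj w D) * (loop w A (first_occ w D) * (1 / 2) -
      loop w A (last_occ w D) * (1 / 2))))"
    by (rule sum.cong) (simp_all add: loop_diff_eq_interlacing[OF w A, symmetric] algebra_simps)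
  finally show ?thesis by (simp add: omega_on_def sum_distrib_left)
qed

end

section \<open>Fillings\<close>

context pi_hom
begin

text \<open>The outer option belongs to the base point of the sum, the inner one to the base point
  of each summand.\<close>

definition sum_elem :: "'l + 'l \<Rightarrow> ('l option + 'l option) option" where
  "sum_elem X = (case X of Inl A \<Rightarrow> Some (Inl (Some A)) | Inr A \<Rightarrow> Some (Inr (Some A)))"

text \<open>The base point of the sum pairs with each summand like the base point of that summand,
  hence the constant 1/2 in both components at once.\<close>

definition realize ::
  "('l, 'a) nanoword \<Rightarrow> ('l, 'a) nanoword \<Rightarrow> ('l option + 'l option) option \<Rightarrow>
   (nat \<Rightarrow> rat) \<times> (nat \<Rightarrow> rat)" where
  "realize w v u = (case u of None \<Rightarrow> (\<lambda>_. 1 / 2, \<lambda>_. 1 / 2)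
     | Some (Inl (Some A)) \<Rightarrow> (loop w A, \<lambda>_. 0)
     | Some (Inr (Some A)) \<Rightarrow> (\<lambda>_. 0, loop v A))"

definition sum_pairing ::
  "('l, 'a) nanoword \<Rightarrow> ('l, 'a) nanoword \<Rightarrow> (('l option + 'l option) option, 'a) pairing" where
  "sum_pairing w v = pairing_sum \<alpha> \<tau> (nanoword_pairing \<alpha> \<tau> w)
      (pairing_opp \<alpha> \<tau> (nanoword_pairing \<alpha> \<tau> v))"

definition Omega ::
  "('l, 'a) nanoword \<Rightarrow> ('l, 'a) nanoword \<Rightarrow> (nat \<Rightarrow> rat) \<times> (nat \<Rightarrow> rat) \<Rightarrow>
   (nat \<Rightarrow> rat) \<times> (nat \<Rightarrow> rat) \<Rightarrow> rat" where
  "Omega w v X Y = omega w (fst X) (fst Y) - omega v (snd X) (snd Y)"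

lemma base_sum_pairing: "base (sum_pairing w v) = None"
  by (simp add: sum_pairing_def pairing_sum_def)

lemma elems_sum_pairing:
  "elems (sum_pairing w v) = insert None (sum_elem ` (letters w <+> letters v))"
proof -
  have "insert None (Some ` S) - {None} = Some ` S" for S :: "'b set" by auto
  then show ?thesis
    by (simp add: sum_pairing_def pairing_sum_def pairing_opp_def nanoword_pairing_def
        Plus_def image_Un image_image sum_elem_def)
qed

lemma elems_minus_base: "elems (sum_pairing w v) - {base (sum_pairing w v)} =
    sum_elem ` (letters w <+> letters v)"
  by (auto simp: elems_sum_pairing base_sum_pairing sum_elem_def)

lemma pproj_sum_elem: "pproj (sum_pairing w v) (sum_elem X) = case_sum (proj w) (proj v) X"
  by (simp add: sum_pairing_def pairing_sum_def pairing_opp_def nanoword_pairing_def sum_elem_def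
      split: sum.splits)

lemma inj_sum_elem: "inj sum_elem"
  by (auto simp: inj_def sum_elem_def split: sum.splits)

lemma omega_zero: "omega_on w S (\<lambda>_. 0) y = 0" "omega_on w S y (\<lambda>_. 0) = 0" "omega_on w S x x = 0"
  by (simp_all add: omega_on_def)

lemma form_closed:
  assumes w: "nanoword \<alpha> w" and v: "nanoword \<alpha> v"
    and u: "u \<in> elems (sum_pairing w v)" "u' \<in> elems (sum_pairing w v)"
  shows "form (sum_pairing w v) u u' \<in> carrier G"
proof -
  have "alpha_pairing \<alpha> \<tau> (sum_pairing w v)"
    unfolding sum_pairing_def
    by (intro alpha_pairing_sum alpha_pairing_opp alpha_pairing_nanoword involution w v)
  then show ?thesis using u unfolding alpha_pairing_def by blast
qed

lemma phi_form:
  assumes w: "nanoword \<alpha> w" and v: "nanoword \<alpha> v"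
    and u: "u \<in> elems (sum_pairing w v)" "u' \<in> elems (sum_pairing w v)"
  shows "of_int (\<phi> (form (sum_pairing w v) u u')) = 2 * Omega w v (realize w v u) (realize w v u')"
proof -
  have closed: "letter_form \<alpha> \<tau> x A B \<in> carrier G" "base_form \<alpha> \<tau> x A \<in> carrier G"
    if x: "nanoword \<alpha> x" "A \<in> letters x" "B \<in> letters x" for x :: "('b, 'a) nanoword" and A B
  proof -
    have p: "alpha_pairing \<alpha> \<tau> (nanoword_pairing \<alpha> \<tau> x)"
      by (rule alpha_pairing_nanoword[OF involution x(1)])
    have "form (nanoword_pairing \<alpha> \<tau> x) (Some A) (Some B) \<in> carrier G"
      "form (nanoword_pairing \<alpha> \<tau> x) (Some A) None \<in> carrier G"
      using p that(2,3) unfolding alpha_pairing_def by (auto simp: nanoword_pairing_def Pi_iff)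
    then show "letter_form \<alpha> \<tau> x A B \<in> carrier G" "base_form \<alpha> \<tau> x A \<in> carrier G"
      by (simp_all add: nanoword_pairing_def)
  qed
  note defs = sum_pairing_def pairing_sum_def pairing_opp_def nanoword_pairing_def realize_def
    Omega_def sum_elem_def omega_zero
  have half: "omega x (\<lambda>_. 1 / 2) y = - omega x y (\<lambda>_. 1 / 2)" for x :: "('b, 'a) nanoword" and y
    by (rule omega_skew)
  consider "u = None" "u' = None"
    | A where "A \<in> letters w" "u = Some (Inl (Some A))" "u' = None"
    | A where "A \<in> letters v" "u = Some (Inr (Some A))" "u' = None"
    | B where "B \<in> letters w" "u = None" "u' = Some (Inl (Some B))"
    | B where "B \<in> letters v" "u = None" "u' = Some (Inr (Some B))"
    | A B where "A \<in> letters w" "B \<in> letters w" "u = Some (Inl (Some A))" "u' = Some (Inl (Some B))"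
    | A B where "A \<in> letters v" "B \<in> letters v" "u = Some (Inr (Some A))" "u' = Some (Inr (Some B))"
    | A B where "A \<in> letters w" "B \<in> letters v" "u = Some (Inl (Some A))" "u' = Some (Inr (Some B))"
    | A B where "A \<in> letters v" "B \<in> letters w" "u = Some (Inr (Some A))" "u' = Some (Inl (Some B))"
    using u unfolding elems_sum_pairing sum_elem_def by auto
  then show ?thesis
  proof cases
    case 1
    then show ?thesis by (simp add: defs phi_mult phi_inv phi_one)
  next
    case (2 A)
    then show ?thesis by (simp add: defs phi_base_form[OF w])
  next
    case (3 A)
    then show ?thesis by (simp add: defs phi_base_form[OF v] phi_inv closed(2)[OF v])
  next
    case (4 A)
    then show ?thesis by (simp add: defs phi_base_form[OF w] phi_inv closed(2)[OF w] half)
  next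
    case (5 A)
    then show ?thesis by (simp add: defs phi_base_form[OF v] phi_inv closed(2)[OF v] half)
  next
    case (6 A B)
    then show ?thesis by (simp add: defs phi_letter_form[OF w])
  next
    case (7 A B)
    then show ?thesis by (simp add: defs phi_letter_form[OF v] phi_inv closed(1)[OF v])
  qed (simp_all add: defs phi_one)
qed

section \<open>Linear extension to integral vectors\<close>

definition realize_vec ::
  "('l, 'a) nanoword \<Rightarrow> ('l, 'a) nanoword \<Rightarrow> (('l option + 'l option) option \<Rightarrow>\<^sub>0 int) \<Rightarrow>
   (nat \<Rightarrow> rat) \<times> (nat \<Rightarrow> rat)" where
  "realize_vec w v x =
     (\<lambda>p. \<Sum>u\<in>elems (sum_pairing w v). of_int (Poly_Mapping.lookup x u) * fst (realize w v u) p,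
      \<lambda>p. \<Sum>u\<in>elems (sum_pairing w v). of_int (Poly_Mapping.lookup x u) * snd (realize w v u) p)"

lemma finite_elems:
  "nanoword \<alpha> w \<Longrightarrow> nanoword \<alpha> v \<Longrightarrow> finite (elems (sum_pairing w v))"
  by (simp add: elems_sum_pairing finite_letters)

lemma phi_bilinear_form:
  assumes w: "nanoword \<alpha> w" and v: "nanoword \<alpha> v"
  shows "of_int (\<phi> (bilinear_form \<alpha> \<tau> (sum_pairing w v) x y)) =
    2 * Omega w v (realize_vec w v x) (realize_vec w v y)"
proof -
  let ?E = "elems (sum_pairing w v)"
  let ?r = "realize w v"
  have "\<phi> (bilinear_form \<alpha> \<tau> (sum_pairing w v) x y) =
      (\<Sum>(A, B)\<in>?E \<times> ?E. (Poly_Mapping.lookup x A * Poly_Mapping.lookup y B) * \<phi> (form (sum_pairing w v) A B))"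
    unfolding bilinear_form_def
    by (subst phi_finprod) (use finite_elems[OF w v] form_closed[OF w v] in \<open>auto simp: phi_pow intro!: sum.cong\<close>)
  then have "of_int (\<phi> (bilinear_form \<alpha> \<tau> (sum_pairing w v) x y)) =
      (\<Sum>(A, B)\<in>?E \<times> ?E. of_int (Poly_Mapping.lookup x A) * of_int (Poly_Mapping.lookup y B) * (2 * Omega w v (?r A) (?r B)))"
    using phi_form[OF w v] by (auto simp: case_prod_unfold intro!: sum.cong)
  also have "\<dots> = (\<Sum>A\<in>?E. \<Sum>B\<in>?E. of_int (Poly_Mapping.lookup x A) * of_int (Poly_Mapping.lookup y B) * (2 * Omega w v (?r A) (?r B)))"
    by (rule sum.cartesian_product[symmetric])
  also have "\<dots> = 2 * Omega w v (realize_vec w v x) (realize_vec w v y)"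
    unfolding realize_vec_def Omega_def fst_conv snd_conv omega_sum_left omega_sum_right
    by (simp add: sum_distrib_left sum_subtractf right_diff_distrib mult.assoc mult.left_commute)
  finally show ?thesis .
qed

lemma realize_vec_frag_of:
  assumes "finite (elems (sum_pairing w v))" and "u \<in> elems (sum_pairing w v)"
  shows "realize_vec w v (frag_of u) = realize w v u"
proof -
  have "(\<Sum>u'\<in>elems (sum_pairing w v). of_int (Poly_Mapping.lookup (frag_of u) u') * f u') = f u"
      for f :: "_ \<Rightarrow> rat"
  proof -
    have "(\<Sum>u'\<in>elems (sum_pairing w v). of_int (Poly_Mapping.lookup (frag_of u) u') * f u') =
        (\<Sum>u'\<in>elems (sum_pairing w v). if u' = u then f u' else 0)"
      by (rule sum.cong) (auto simp: lookup_frag_of)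
    then show ?thesis using assms by simp
  qed
  then show ?thesis unfolding realize_vec_def by simp
qed

lemma realize_vec_add:
  "realize_vec w v (x + y) = (\<lambda>p. fst (realize_vec w v x) p + fst (realize_vec w v y) p,
     \<lambda>p. snd (realize_vec w v x) p + snd (realize_vec w v y) p)"
  by (simp add: realize_vec_def lookup_add distrib_right sum.distrib)

lemma realize_vec_diff:
  "realize_vec w v (x - y) = (\<lambda>p. fst (realize_vec w v x) p - fst (realize_vec w v y) p,
     \<lambda>p. snd (realize_vec w v x) p - snd (realize_vec w v y) p)"
  by (simp add: realize_vec_def lookup_minus left_diff_distrib sum_subtractf)

lemma left_loop_realize: "left_loop w X p =
    sg (case_sum (proj w) (proj v) X) * fst (realize w v (sum_elem X)) p"
  and right_loop_realize: "right_loop v X p =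
      sg (case_sum (proj w) (proj v) X) * snd (realize w v (sum_elem X)) p"
  by (auto simp: left_loop_def right_loop_def signed_loop_def realize_def sum_elem_def split: sum.splits)

text \<open>
  A filling contains the sum of the two base points, which lies in \<open>L\<close>; the correction terms of a
  matching are, modulo this sum, multiples of the constant function on the first word alone.
\<close>

lemma skew_rank_extend:
  assumes F: "skew_rank_le m L (Omega w v)"
  shows "skew_rank_le (m + 1) {X. \<exists>a. (\<lambda>p. fst X p + a, snd X) \<in> L} (Omega w v)"
    (is "skew_rank_le _ ?S _")
proof -
  define a where "a X = (SOME a. (\<lambda>p. fst X p + a, snd X) \<in> L)" for X
  have a: "(\<lambda>p. fst X p + a X, snd X) \<in> L" if "X \<in> ?S" for X
    using someI_ex[OF that[unfolded mem_Collect_eq]] unfolding a_def .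
  define g where "g X = omega w (\<lambda>_. 1) (fst X)" for X :: "(nat \<Rightarrow> rat) \<times> (nat \<Rightarrow> rat)"
  \<comment> \<open>The form vanishes on two constants, so shifting both arguments costs only
    products of a shift with the functional \<open>g\<close>: a single skew summand.\<close>
  have add: "omega w (\<lambda>p. x p + b) (\<lambda>p. y p + c) =
      omega w x y + (b * omega w (\<lambda>_. 1) y - c * omega w (\<lambda>_. 1) x)" for x y b c
    using omega_linear_left[of w "letters w" 1 x b "\<lambda>_. 1" "\<lambda>p. y p + c"]
      omega_linear_right[of w "letters w" x 1 y c "\<lambda>_. 1"]
      omega_linear_right[of w "letters w" "\<lambda>_. 1" 1 y c "\<lambda>_. 1"]
      omega_skew[of w "letters w" x "\<lambda>_. 1"] by (simp add: omega_zero algebra_simps)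
  have "skew_rank_le m ?S (\<lambda>X Y. Omega w v (\<lambda>p. fst X p + a X, snd X) (\<lambda>p. fst Y p + a Y, snd Y))"
    by (rule skew_rank_le_pullback[OF F, where h = "\<lambda>X. (\<lambda>p. fst X p + a X, snd X)"]) (use a in auto)
  moreover have "skew_rank_le (card {()}) ?S (\<lambda>X Y. g X * a Y - a X * g Y)"
    by (rule skew_rank_le_sum[where c = "\<lambda>_. g" and d = "\<lambda>_. a"]) simp_all
  ultimately have "skew_rank_le (m + card {()}) ?S
      (\<lambda>X Y. Omega w v (\<lambda>p. fst X p + a X, snd X) (\<lambda>p. fst Y p + a Y, snd Y) + (g X * a Y -
          a X * g Y))"
    by (rule skew_rank_le_add)
  moreover have "(\<lambda>X Y. Omega w v (\<lambda>p. fst X p + a X, snd X) (\<lambda>p. fst Y p + a Y, snd Y) +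
      (g X * a Y - a X * g Y)) = Omega w v"
    by (intro ext) (simp add: Omega_def add g_def)
  ultimately show ?thesis by simp
qed

text \<open>The orbits of the matching, together with s, form a filling. Up to constants on the
  first word its vectors are multiples of members of L, so its Gram matrix is controlled by the
  extended relation S.\<close>

lemma genus_le_of_cobordant:
  fixes w v :: "('l, 'a) nanoword"
  assumes w: "nanoword \<alpha> w" and v: "nanoword \<alpha> v" and cob: "cobordant w v m"
  shows "phi_genus \<alpha> \<tau> \<phi> (sum_pairing w v) \<le> real (m + 1)"
proof -
  obtain \<theta> L where L: "linear_relation L" "(\<lambda>_. 1, \<lambda>_. 1) \<in> L" and match: "matching w v L \<theta>"
    and F: "skew_rank_le m L (\<lambda>X Y. omega w (fst X) (fst Y) - omega v (snd X) (snd Y))"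
    using cob unfolding cobordant_def by blast
  define S where "S = {X. \<exists>a. (\<lambda>p. fst X p + a, snd X) \<in> L}"
  have rank: "skew_rank_le (m + 1) S (Omega w v)"
    unfolding S_def by (rule skew_rank_extend) (use F in \<open>simp add: Omega_def[abs_def]\<close>)
  let ?Z = "letters w <+> letters v" and ?E = "elems (sum_pairing w v)"
  define pp where "pp = case_sum (proj w) (proj v)"
  have \<theta>: "\<theta> X \<in> ?Z" "\<theta> (\<theta> X) = X" if "X \<in> ?Z" for X
    using bspec[OF match[unfolded matching_def] that] by blast+
  have ppin: "pp X \<in> \<alpha>" if "X \<in> ?Z" for X
    using that proj_in[OF w] proj_in[OF v] by (auto simp: pp_def)
  \<comment> \<open>The inequality in the second case adapts the alternatives to the case
    distinction made by \<open>vec\<close>.\<close>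
  have pp\<theta>: "pp (\<theta> X) = pp X \<or> (pp (\<theta> X) \<noteq> pp X \<and> pp X = \<tau> (pp (\<theta> X)) \<and> sg (pp (\<theta> X)) = - sg (pp X))"
    if X: "X \<in> ?Z" for X
  proof -
    have cls: "case_sum (tau_class w) (tau_class v) Y = {pp Y, \<tau> (pp Y)}" for Y
      by (auto simp: pp_def tau_class_def split: sum.splits)
    have "{pp (\<theta> X), \<tau> (pp (\<theta> X))} = {pp X, \<tau> (pp X)}"
      using bspec[OF match[unfolded matching_def] X] unfolding cls by blast
    then have "pp (\<theta> X) = pp X \<or> pp (\<theta> X) = \<tau> (pp X)" by blast
    then show ?thesis using sg_tau[OF ppin[OF X]] tau_tau[OF ppin[OF X]] by auto
  qed
  define vec where "vec X = (if \<theta> X = X then frag_of (sum_elem X)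
      else if pp X = pp (\<theta> X) then frag_of (sum_elem X) + frag_of (sum_elem (\<theta> X))
      else frag_of (sum_elem X) - frag_of (sum_elem (\<theta> X)))" for X
  have fin: "finite ?E" by (rule finite_elems[OF w v])
  have Ein: "sum_elem X \<in> ?E" if "X \<in> ?Z" for X using that by (simp add: elems_sum_pairing)
  have vec_S: "realize_vec w v (vec X) \<in> S" if X: "X \<in> ?Z" for X
  proof -
    let ?r = "\<lambda>X. realize w v (sum_elem X)"
    have r: "realize_vec w v (frag_of (sum_elem Y)) = ?r Y" if "Y \<in> ?Z" for Y
      by (rule realize_vec_frag_of[OF fin Ein[OF that]])
    obtain a b where "(\<lambda>p. left_loop w X p + left_loop w (\<theta> X) p + a,
        \<lambda>p. right_loop v X p + right_loop v (\<theta> X) p + b) \<in> L"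
      using bspec[OF match[unfolded matching_def] X] by blast
    \<comment> \<open>The constant is moved entirely to the first word, the only place where S
      tolerates one.\<close>
    from linear_relation_shift[OF L this, of "- b"]
    have ab: "(\<lambda>p. left_loop w X p + left_loop w (\<theta> X) p + (a - b),
        \<lambda>p. right_loop v X p + right_loop v (\<theta> X) p) \<in> L" by (simp add: algebra_simps)
    have sg0: "sg (pp X) \<noteq> 0" by (rule sg_nonzero[OF ppin[OF X]])
    \<comment> \<open>The factor undoes the weight of the loops, and also the doubling when X is its
      own partner.\<close>
    define c where "c = 1 / (if \<theta> X = X then 2 * sg (pp X) else sg (pp X))"
    let ?l = "sg (pp X)" and ?l' = "sg (pp (\<theta> X))"
    have scaled: "(\<lambda>p. c * (?l * fst (?r X) p + ?l' * fst (?r (\<theta> X)) p + (a - b)),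
        \<lambda>p. c * (?l * snd (?r X) p + ?l' * snd (?r (\<theta> X)) p)) \<in> L"
      using linear_relationD[OF L(1) ab ab, of c 0]
      unfolding left_loop_realize[of w _ _ v] right_loop_realize[of v _ _ w] pp_def[symmetric] by simp
    have eqs: "fst (realize_vec w v (vec X)) p + c * (a - b) = c * (?l * fst (?r X) p +
        ?l' * fst (?r (\<theta> X)) p + (a - b))"
      "snd (realize_vec w v (vec X)) p = c * (?l * snd (?r X) p + ?l' * snd (?r (\<theta> X)) p)" for p
      using pp\<theta>[OF X] sg0 unfolding vec_def c_def
      by (auto simp: r X \<theta>[OF X] realize_vec_add realize_vec_diff field_simps)
    have "(\<lambda>p. fst (realize_vec w v (vec X)) p + c * (a -
        b), \<lambda>p. snd (realize_vec w v (vec X)) p) \<in> L"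
      unfolding eqs by (rule scaled)
    then show ?thesis unfolding S_def by blast
  qed
  have None_S: "realize_vec w v (frag_of None) \<in> S"
  proof -
    have NE: "None \<in> ?E" by (simp add: elems_sum_pairing)
    have "(\<lambda>p. 1 / 2, \<lambda>p. 1 / 2) \<in> L" using linear_relationD[OF L(1) L(2) L(2), of "1 / 2" 0] by simp
    then show ?thesis
      unfolding S_def realize_vec_frag_of[OF fin NE]
      by (intro CollectI exI[of _ 0]) (simp add: realize_def)
  qed
  \<comment> \<open>The choice depends only on the set, so both members of an orbit select the same
    representative and each orbit enters the filling once.\<close>
  define rep where "rep X = (SOME Y. Y \<in> {X, \<theta> X})" for X
  have rep: "rep X \<in> {X, \<theta> X}" for X unfolding rep_def by (rule someI[of _ X]) simp
  have rep\<theta>: "rep (\<theta> X) = rep X" if "X \<in> ?Z" for X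
    unfolding rep_def \<theta>(2)[OF that] by (simp add: insert_commute)
  have finZ: "finite ?Z" using finite_letters[OF w] finite_letters[OF v] by simp
  obtain xs where xs: "set xs = rep ` ?Z" "distinct xs"
    using finite_distinct_list[of "rep ` ?Z"] finZ by auto
  have xsZ: "Y \<in> ?Z" if Y: "Y \<in> set xs" for Y
  proof -
    obtain X where X: "X \<in> ?Z" "Y = rep X" using Y unfolding xs(1) by blast
    from rep[of X] have "rep X = X \<or> rep X = \<theta> X" by simp
    then show ?thesis using X \<theta>(1)[OF X(1)] by metis
  qed
  have class_rep: "X \<in> {Y, \<theta> Y} \<longleftrightarrow> Y = rep X" if X: "X \<in> ?Z" and Y: "Y \<in> set xs" for X Y
  proof -
    obtain X' where X': "X' \<in> ?Z" "Y = rep X'" using Y unfolding xs(1) by blast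
    from rep[of X'] have "rep X' = X' \<or> rep X' = \<theta> X'" by simp
    then have repY: "rep Y = Y" using rep\<theta>[OF X'(1)] X'(2) by metis
    show ?thesis
    proof
      assume "X \<in> {Y, \<theta> Y}"
      then have "X = Y \<or> X = \<theta> Y" by simp
      then show "Y = rep X" using repY rep\<theta>[OF xsZ[OF Y]] by metis
    next
      assume Y: "Y = rep X"
      from rep[of X] have "rep X = X \<or> rep X = \<theta> X" by simp
      then have "X = Y \<or> X = \<theta> Y" using \<theta>(2)[OF X] Y by metis
      then show "X \<in> {Y, \<theta> Y}" by simp
    qed
  qed
  define M where "M = frag_of None # map vec xs"
  have inj: "sum_elem X = sum_elem Y \<longleftrightarrow> X = Y" for X Y :: "'l + 'l"
    using inj_sum_elem by (auto simp: inj_def)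
  \<comment> \<open>In no case can the coefficients cancel, because the difference is formed only
    for two distinct letters; so a letter occurs exactly in the vector of its orbit.\<close>
  have supp: "Poly_Mapping.lookup (vec Y) (sum_elem X) \<noteq> 0 \<longleftrightarrow> X \<in> {Y, \<theta> Y}" for X Y
    unfolding vec_def by (auto simp: lookup_add lookup_minus lookup_frag_of inj)
  have fill: "filling \<tau> (sum_pairing w v) M"
    unfolding filling_def
  proof (intro conjI exI[of _ 0] allI impI ballI)
    show "0 < length M" "M ! 0 = frag_of (base (sum_pairing w v))"
      by (simp_all add: M_def base_sum_pairing)
    fix j assume j: "j < length M" "j \<noteq> 0"
    then obtain i where i: "j = Suc i" "i < length xs" by (cases j) (auto simp: M_def)
    define X where "X = xs ! i"
    have X: "X \<in> ?Z" using xsZ[of X] i by (simp add: X_def)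
    have Mj: "M ! j = vec X" using i by (simp add: M_def X_def)
    have e: "sum_elem X \<in> sum_elem ` ?Z" "sum_elem (\<theta> X) \<in> sum_elem ` ?Z"
      by (intro imageI X \<theta>(1))+
    have pr: "pproj (sum_pairing w v) (sum_elem Y) = pp Y" for Y by (simp add: pproj_sum_elem pp_def)
    consider (fixed) "\<theta> X = X" | (plus) "\<theta> X \<noteq> X" "pp X = pp (\<theta> X)"
      | (minus) "\<theta> X \<noteq> X" "pp X \<noteq> pp (\<theta> X)" by blast
    then show "short_vector \<tau> (sum_pairing w v) (M ! j)"
    proof cases
      case fixed
      then show ?thesis unfolding short_vector_def elems_minus_base Mj
        by (intro disjI1 bexI[OF _ e(1)]) (simp add: vec_def)
    next
      case plus
      then have "sum_elem X \<noteq> sum_elem (\<theta> X)" using inj by metis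
      then show ?thesis using plus unfolding short_vector_def elems_minus_base Mj
        by (intro disjI2 disjI1 bexI[OF _ e(1)] bexI[OF _ e(2)]) (simp add: pr vec_def)
    next
      case minus
      then have "sum_elem X \<noteq> sum_elem (\<theta> X)" using inj by metis
      moreover have "pp X = \<tau> (pp (\<theta> X))" using pp\<theta>[OF X] minus(2) by metis
      ultimately show ?thesis using minus unfolding short_vector_def elems_minus_base Mj
        by (intro disjI2 bexI[OF _ e(1)] bexI[OF _ e(2)]) (simp add: pr vec_def)
    qed
  next
    fix A assume "A \<in> elems (sum_pairing w v) - {base (sum_pairing w v)}"
    then obtain X where X: "X \<in> ?Z" "A = sum_elem X" unfolding elems_minus_base by blast
    have "rep X \<in> set xs" using X(1) xs(1) by blast
    then obtain i where i: "i < length xs" "xs ! i = rep X" by (metis in_set_conv_nth)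
    show "\<exists>!i. i < length M \<and> Poly_Mapping.lookup (M ! i) A \<noteq> 0"
    proof (rule ex1I[of _ "Suc i"])
      show "Suc i < length M \<and> Poly_Mapping.lookup (M ! Suc i) A \<noteq> 0"
        using i class_rep[OF X(1) \<open>rep X \<in> set xs\<close>] unfolding X(2)
        by (simp add: M_def supp del: insert_iff)
      fix j assume j: "j < length M \<and> Poly_Mapping.lookup (M ! j) A \<noteq> 0"
      moreover have "Poly_Mapping.lookup (M ! 0) A = 0"
        unfolding X(2) by (cases X) (simp_all add: M_def sum_elem_def lookup_frag_of)
      ultimately have "j \<noteq> 0" by metis
      then obtain i' where i': "j = Suc i'" "i' < length xs" using j by (cases j) (auto simp: M_def)
      then have "X \<in> {xs ! i', \<theta> (xs ! i')}" using j supp unfolding X(2) by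
          (simp add: M_def del: insert_iff)
      then have "xs ! i' = rep X" using class_rep[OF X(1), of "xs ! i'"] i'(2) by simp
      then show "j = Suc i" using i i' nth_eq_iff_index_eq[OF xs(2), of i' i] by simp
    qed
  qed
  let ?n = "length M"
  have MS: "realize_vec w v (M ! i) \<in> S" if "i < ?n" for i
  proof -
    have "M ! i \<in> insert (frag_of None) (vec ` set xs)" using nth_mem[OF that] by (simp add: M_def)
    then show ?thesis using None_S vec_S[OF xsZ] by auto
  qed
  have "filling_matrix \<alpha> \<tau> \<phi> (sum_pairing w v) M =
      mat ?n ?n (\<lambda>(i, j). 2 * Omega w v (realize_vec w v (M ! i)) (realize_vec w v (M ! j)))"
    unfolding filling_matrix_def phi_bilinear_form[OF w v] ..
  then have "vec_space.rank ?n (filling_matrix \<alpha> \<tau> \<phi> (sum_pairing w v) M) \<le> 2 * (m + 1)"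
    using rank_gram_le[OF rank MS] by simp
  moreover have "(LEAST r. \<exists>L. filling \<tau> (sum_pairing w v) L \<and>
       r = vec_space.rank (length L) (filling_matrix \<alpha> \<tau> \<phi> (sum_pairing w v) L)) \<le>
      vec_space.rank ?n (filling_matrix \<alpha> \<tau> \<phi> (sum_pairing w v) M)"
    using fill by (intro Least_le) blast
  ultimately have least: "(LEAST r. \<exists>L. filling \<tau> (sum_pairing w v) L \<and>
       r = vec_space.rank (length L) (filling_matrix \<alpha> \<tau> \<phi> (sum_pairing w v) L)) \<le> 2 * (m + 1)"
    by (rule le_trans[rotated])
  have half: "n \<le> 2 * k \<Longrightarrow> real n / 2 \<le> real k" for n k :: nat by linarith
  show ?thesis unfolding phi_genus_def by (rule half[OF least])
qed

end

theorem theorem10p2p1: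
  fixes \<alpha> :: "'a set" and \<tau> :: "'a \<Rightarrow> 'a"
    and \<phi> :: "('a \<Rightarrow>\<^sub>0 int) set \<Rightarrow> int"
    and w v :: "('l::infinite, 'a) nanoword"
  assumes "involution_on \<alpha> \<tau>"
    and "\<phi> \<in> hom (pi_group \<alpha> \<tau>) integer_group"
    and "\<forall>a\<in>\<alpha>. \<phi> (pi_gen \<alpha> \<tau> a) \<in> {1, - 1}"
    and "nanoword \<alpha> w" and "nanoword \<alpha> v"
  shows "real (rho_wbr \<alpha> \<tau> w v) \<ge>
    1 / 2 * (phi_genus \<alpha> \<tau> \<phi>
      (pairing_sum \<alpha> \<tau> (nanoword_pairing \<alpha> \<tau> w)
        (pairing_opp \<alpha> \<tau> (nanoword_pairing \<alpha> \<tau> v))) - 1)"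
proof -
  interpret pi_hom \<alpha> \<tau> \<phi>
    by unfold_locales (use assms(1-3) in auto)
  have "metamorphosis \<alpha> \<tau> w (rho_wbr \<alpha> \<tau> w v) v"
    unfolding rho_wbr_def using ex_metamorphosis[OF assms(4,5)] by (rule LeastI_ex)
  then have "cobordant w v (2 * rho_wbr \<alpha> \<tau> w v)"
    using metamorphosis_cobordant by blast
  note genus = genus_le_of_cobordant[OF assms(4,5) this, unfolded sum_pairing_def]
  \<comment> \<open>With two summands per arch and one for the constants, the genus is at most 2
    \<rho> + 1; this is the origin of the 1/2 and the -1 in the claim.\<close>
  have bound: "r \<le> real (2 * n + 1) \<Longrightarrow> real n \<ge> 1 / 2 * (r - 1)" for r n
    by simp
  show ?thesis by (rule bound[OF genus])
qed

end
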